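(* Let $q$ be a fixed prime power. The $n\to\infty$ limit of the probability that a uniformly random element of $Mat(n,q)$ is semisimple is $$\prod_{\substack{r\ge 1\\ r\equiv 0,\pm 2\ (\mathrm{mod}\ 5)}} \left(1-\frac{1}{q^{r-1}}\right).$$
   Context: $Mat(n,q)$ is the set of all $n\times n$ matrices over the finite field $F_q$. A matrix in $Mat(n,q)$ is semisimple if it is diagonalizable over $\overline{F_q}$, the algebraic closure of $F_q$. *)

theory Defs
  imports
    "HOL-Probability.Probability_Mass_Function"
    "HOL-Number_Theory.Prime_Powers"
    "HOL-Algebra.Algebraic_Closure_Type"
    "Jordan_Normal_Form.Matrix"
begin

(* similar_mat is similarity over the entry type, so for the entry type 'a alg_closure
   this is diagonalizability over the algebraic closure. *)
definition diagonalizable_mat :: "'a :: field mat \<Rightarrow> bool" where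
  "diagonalizable_mat A \<longleftrightarrow> (\<exists>D. diagonal_mat D \<and> similar_mat A D)"

definition semisimple_mat :: "'a :: field mat \<Rightarrow> bool" where
  "semisimple_mat A \<longleftrightarrow> diagonalizable_mat (map_mat to_ac A)"

(* Infinite products in the library run over all of nat, so indices outside
   the range of the product get the neutral factor 1. *)
definition semisimple_factor :: "nat \<Rightarrow> nat \<Rightarrow> real" where
  "semisimple_factor q r =
     (if r \<ge> 1 \<and> r mod 5 \<in> {0, 2, 3} then 1 - 1 / real q ^ (r - 1) else 1)"

(* The next two facts show that pmf_of_set (carrier_mat n n) really is the uniform
   distribution when the field is finite. *)
lemma finite_carrier_mat:
  "finite (carrier_mat n m :: 'a :: finite mat set)"
proof -
  let ?I = "{..<n} \<times> {..<m}"
  let ?F = "PiE ?I (\<lambda>_. UNIV :: 'a set)"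
  have "carrier_mat n m \<subseteq> (\<lambda>f. mat n m f) ` ?F"
  proof
    fix A :: "'a mat" assume A: "A \<in> carrier_mat n m"
    show "A \<in> (\<lambda>f. mat n m f) ` ?F"
    proof (rule image_eqI)
      show "A = mat n m (restrict (\<lambda>ij. A $$ ij) ?I)"
        using A by (intro eq_matI) simp_all
      show "restrict (\<lambda>ij. A $$ ij) ?I \<in> ?F"
        by (simp only: restrict_PiE_iff) simp
    qed
  qed
  moreover have "finite ?F" by (intro finite_PiE) simp_all
  ultimately show ?thesis by (rule finite_subset[OF _ finite_imageI])
qed

lemma carrier_mat_nonempty: "carrier_mat n m \<noteq> {}"
proof -
  have "mat n m undefined \<in> carrier_mat n m" by (rule mat_carrier)
  then show ?thesis by (metis empty_iff)
qed

(* prodinf is a definite description; this shows that it denotes a genuine limit here. *)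
lemma convergent_prod_semisimple_factor:
  assumes "q \<ge> 2"
  shows "convergent_prod (semisimple_factor q)"
proof -
  have "summable (\<lambda>r. norm (semisimple_factor q r - 1))"
  proof (rule summable_comparison_test')
    show "summable (\<lambda>r. real q * (1 / real q) ^ r)"
      using assms by (intro summable_mult summable_geometric) auto
    fix r :: nat
    show "norm (norm (semisimple_factor q r - 1)) \<le> real q * (1 / real q) ^ r"
    proof (cases r)
      case 0
      then show ?thesis by (simp add: semisimple_factor_def)
    next
      case (Suc k)
      have "real q * (1 / real q) ^ Suc k = 1 / real q ^ k"
        using assms by (simp add: power_one_over)
      then show ?thesis
        unfolding Suc semisimple_factor_def by simp
    qed
  qed
  then show ?thesis
    by (rule abs_convergent_prod_imp_convergent_prod[OF summable_imp_abs_convergent_prod])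
qed

end

theory Submission
  imports Defs "Jordan_Normal_Form.Determinant" "Jordan_Normal_Form.Char_Poly"
begin

text \<open>A matrix is semisimple iff it is annihilated by a product of distinct monic irreducible
  polynomials. Splitting along coprime factors multiplies the generating functions of
  \<open>card (ann n p) / card (GL n)\<close>, and a matrix annihilated by an irreducible \<open>\<phi>\<close> of degree \<open>d\<close> makes the
  space a vector space over a field with \<open>q\<^sup>d\<close> elements. Hence the number of semisimple matrices
  divided by \<open>card (GL n)\<close> is the coefficient of \<open>u\<^sup>n\<close> in the product over all \<open>\<phi>\<close> of
  \<open>\<Sum>m. u\<^bsup>d m\<^esup> / gl_order (q\<^sup>d) m\<close>. Dividing each factor by \<open>1 / (1 - (u / q)\<^sup>d)\<close>, whose product over all
  \<open>\<phi>\<close> is \<open>1 / (1 - u)\<close>, leaves an absolutely convergent product, whose value at \<open>u = 1\<close>, times the limit of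
  \<open>card (GL n) / q\<^bsup>n\<^sup>2\<^esup>\<close>, is the limiting probability.
  The Rogers-Ramanujan identity turns the factors into products of \<open>1 / (1 - q\<^bsup>-d r\<^esup>)\<close> with
  \<open>r \<equiv> \<plusminus>1 (mod 5)\<close>, \<open>r \<ge> 2\<close>, and the product over \<open>\<phi>\<close> of each of them is \<open>1 / (1 - q\<^bsup>1 - r\<^esup>)\<close>.\<close>

unbundle no vec_syntax
no_notation fps_nth (infixl "$" 75)

hide_const (open) Divisibility.irreducible Divisibility.prime Module.smult
  Polynomials.degree Polynomials.lead_coeff UnivPoly.up_ring.coeff UnivPoly.up_ring.monom

subsection \<open>Polynomials in a matrix\<close>

text \<open>The weight 1 / \<open>card (GL n)\<close> turns a count of matrices into a count of
  conjugacy classes, each weighted by the inverse order of its centralizer. Centralizers of blocks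
  with coprime annihilators are direct products, which is why the series multiply. The division by 1
  / (1 - (u / q)^d) is forced: about q^d / d irreducibles have degree d and each factor is 1 +
  O(q^-d) at u = 1, so the undivided product diverges there. Division cancels the leading term and
  leaves 1 + O(q^(-2 d)). Only irreducibles of degree at most n reach the coefficient of u^n, so all
  products over irreducibles are finite products over degrees at most D, compared with their limits
  by dominated convergence: once over coefficients, once over the index r. Finally,
  \<open>card (GL n)\<close> / q^(n^2) tends to the product of 1 - q^(1 - r) over all r >= 2. The
  product over irreducibles cancels the residues 1 and 4 modulo 5, and 0, 2 and 3 remain. The index
  r = 1, for which the product over irreducibles would diverge, is the one removed by the
  division.\<close>

definition poly_mat :: "'a::comm_ring_1 poly \<Rightarrow> 'a mat \<Rightarrow> 'a mat" where
  "poly_mat p A = fold_coeffs (\<lambda>a M. a \<cdot>\<^sub>m 1\<^sub>m (dim_row A) + A * M) p (0\<^sub>m (dim_row A) (dim_row A))"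

lemma poly_mat_0 [simp]: "A \<in> carrier_mat n n \<Longrightarrow> poly_mat 0 A = 0\<^sub>m n n"
  by (simp add: poly_mat_def)

lemma poly_mat_pCons:
  assumes A: "A \<in> carrier_mat n n"
  shows "poly_mat (pCons a p) A = a \<cdot>\<^sub>m 1\<^sub>m n + A * poly_mat p A"
proof (cases "a = 0 \<and> p = 0")
  case True
  then show ?thesis using A by (auto simp: poly_mat_def)
next
  case False
  then show ?thesis using A
    by (auto simp: poly_mat_def fold_coeffs_pCons_not_0_0_eq fold_coeffs_pCons_coeff_not_0_eq)
qed

lemma poly_mat_carrier [simp]:
  "A \<in> carrier_mat n n \<Longrightarrow> poly_mat p A \<in> carrier_mat n n"
  by (induct p) (auto simp: poly_mat_pCons)

lemma dim_poly_mat [simp]: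
  "A \<in> carrier_mat n n \<Longrightarrow> dim_row (poly_mat p A) = n"
  "A \<in> carrier_mat n n \<Longrightarrow> dim_col (poly_mat p A) = n"
  using poly_mat_carrier by blast+

lemma poly_mat_1 [simp]: "A \<in> carrier_mat n n \<Longrightarrow> poly_mat 1 A = 1\<^sub>m n"
  by (auto simp: one_pCons poly_mat_pCons intro!: eq_matI)

lemma poly_mat_add:
  assumes A: "A \<in> carrier_mat n n"
  shows "poly_mat (p + q) A = poly_mat p A + poly_mat q A"
proof (induct p q rule: poly_induct2)
  case (pCons a p b q)
  let ?p = "poly_mat p A" and ?q = "poly_mat q A"
  have [simp]: "?p \<in> carrier_mat n n" "?q \<in> carrier_mat n n" using A by auto
  have "A * (?p + ?q) = A * ?p + A * ?q"
    using A by (intro mult_add_distrib_mat) auto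
  then show ?case using A pCons
    by (simp add: poly_mat_pCons[OF A] add_smult_distrib_right_mat)
       (rule eq_matI, auto simp: algebra_simps)
qed (use A in auto)

lemma poly_mat_smult:
  assumes A: "A \<in> carrier_mat n n"
  shows "poly_mat (Polynomial.smult c p) A = c \<cdot>\<^sub>m poly_mat p A"
proof (induct p)
  case (pCons a p)
  have "A * (c \<cdot>\<^sub>m poly_mat p A) = c \<cdot>\<^sub>m (A * poly_mat p A)"
    using A by (intro mult_smult_distrib) auto
  then show ?case using A pCons
    by (simp add: poly_mat_pCons[OF A])
       (rule eq_matI, auto simp: algebra_simps)
qed (use A in auto)

lemma poly_mat_mult:
  assumes A: "A \<in> carrier_mat n n"
  shows "poly_mat (p * q) A = poly_mat p A * poly_mat q A"
proof (induct p)
  case (pCons a p)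
  let ?p = "poly_mat p A" and ?q = "poly_mat q A"
  have c [simp]: "?p \<in> carrier_mat n n" "?q \<in> carrier_mat n n" using A by auto
  have "poly_mat (pCons a p * q) A = a \<cdot>\<^sub>m ?q + (0 \<cdot>\<^sub>m 1\<^sub>m n + A * (?p * ?q))"
    using A by (simp add: mult_pCons_left poly_mat_add poly_mat_smult poly_mat_pCons[OF A] pCons)
  also have "0 \<cdot>\<^sub>m 1\<^sub>m n + A * (?p * ?q) = A * (?p * ?q)"
    using A by (intro eq_matI) auto
  also have "A * (?p * ?q) = A * ?p * ?q"
    using A by (intro assoc_mult_mat[symmetric]) auto
  also have "a \<cdot>\<^sub>m ?q + A * ?p * ?q = (a \<cdot>\<^sub>m 1\<^sub>m n) * ?q + A * ?p * ?q"
    using c by (simp add: mult_smult_assoc_mat[of _ n n _ n] left_mult_one_mat[OF c(2)])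
  also have "\<dots> = (a \<cdot>\<^sub>m 1\<^sub>m n + A * ?p) * ?q"
    using A c by (intro add_mult_distrib_mat[symmetric]) auto
  finally show ?case by (simp add: poly_mat_pCons[OF A])
qed (use A in auto)

text \<open>\<open>Z\<close> may be rectangular. This serves conjugation (\<open>Z\<close>
  invertible), commutation of a matrix with its own polynomials (\<open>Z = A\<close>), and the
  vanishing of off-diagonal blocks, where \<open>Z\<close> has the shape of the block.\<close>

lemma poly_mat_commute_gen:
  assumes A: "A \<in> carrier_mat n n" and B: "B \<in> carrier_mat m m"
    and Z: "Z \<in> carrier_mat m n" and eq: "Z * A = B * Z"
  shows "Z * poly_mat p A = poly_mat p B * Z"
proof (induct p)
  case 0
  then show ?case using A B Z by simp
next
  case (pCons a p)
  let ?a = "poly_mat p A" and ?b = "poly_mat p B"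
  have c: "?a \<in> carrier_mat n n" "?b \<in> carrier_mat m m" using A B by auto
  have "Z * (A * ?a) = Z * A * ?a" using A Z c by (intro assoc_mult_mat[symmetric]) auto
  also have "\<dots> = B * (Z * ?a)" unfolding eq using B Z c by (intro assoc_mult_mat) auto
  also have "\<dots> = B * ?b * Z" unfolding pCons using B Z c by (intro assoc_mult_mat[symmetric]) auto
  finally have *: "Z * (A * ?a) = B * ?b * Z" .
  have "Z * (a \<cdot>\<^sub>m 1\<^sub>m n + A * ?a) = Z * (a \<cdot>\<^sub>m 1\<^sub>m n) + Z * (A * ?a)"
    using A Z c by (intro mult_add_distrib_mat) auto
  also have "\<dots> = (a \<cdot>\<^sub>m 1\<^sub>m m) * Z + B * ?b * Z"
    using Z * by (simp add: mult_smult_assoc_mat[of _ m m _ n] mult_smult_distrib[of _ m n _ n])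
  also have "\<dots> = (a \<cdot>\<^sub>m 1\<^sub>m m + B * ?b) * Z"
    using B Z c by (intro add_mult_distrib_mat[symmetric]) auto
  finally show ?case by (simp add: poly_mat_pCons[OF A] poly_mat_pCons[OF B])
qed

lemma mult_inverse_cancel:
  fixes P :: "'a::semiring_1 mat"
  assumes "P \<in> carrier_mat n n" "Q \<in> carrier_mat n n" "M \<in> carrier_mat n k" "P * Q = 1\<^sub>m n"
  shows "P * (Q * M) = M"
  using assoc_mult_mat[OF assms(1,2,3)] assms by simp

lemma poly_mat_similar:
  assumes B: "B \<in> carrier_mat n n" and P: "P \<in> carrier_mat n n" and Q: "Q \<in> carrier_mat n n"
    and PQ: "P * Q = 1\<^sub>m n" "Q * P = 1\<^sub>m n"
  shows "poly_mat p (P * B * Q) = P * poly_mat p B * Q"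
proof -
  let ?p = "poly_mat p (P * B * Q)"
  have [simp]: "poly_mat p B \<in> carrier_mat n n" "?p \<in> carrier_mat n n"
    using B P Q by (auto intro!: poly_mat_carrier)
  have "P * B = P * B * (Q * P)" using B P PQ by simp
  also have "\<dots> = P * B * Q * P"
    using B P Q by (intro assoc_mult_mat[symmetric]) auto
  finally have comm: "P * B = P * B * Q * P" .
  have "P * poly_mat p B = ?p * P"
    using B P Q by (intro poly_mat_commute_gen[OF B _ P comm]) auto
  then have "P * poly_mat p B * Q = ?p * P * Q" by simp
  also have "\<dots> = ?p * (P * Q)"
    using B P Q by (intro assoc_mult_mat) auto
  finally show ?thesis using PQ by (simp add: right_mult_one_mat[of _ n n])
qed

section \<open>Block matrices and the general linear group\<close>

abbreviation block_diag :: "nat \<Rightarrow> nat \<Rightarrow> 'a::zero mat \<Rightarrow> 'a mat \<Rightarrow> 'a mat" where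
  "block_diag a b B C \<equiv> four_block_mat B (0\<^sub>m a b) (0\<^sub>m b a) C"

lemma poly_mat_four_block:
  assumes B: "B \<in> carrier_mat m m" and C: "C \<in> carrier_mat k k"
  shows "poly_mat p (block_diag m k B C) =
    block_diag m k (poly_mat p B) (poly_mat p C)"
proof (induct p)
  case 0
  show ?case using B C by (auto intro!: eq_matI)
next
  case (pCons a p)
  let ?b = "poly_mat p B" and ?c = "poly_mat p C"
  have bc [simp]: "?b \<in> carrier_mat m m" "?c \<in> carrier_mat k k" using B C by auto
  have A: "block_diag m k B C \<in> carrier_mat (m + k) (m + k)"
    using B C by simp
  have "block_diag m k B C * block_diag m k ?b ?c
    = block_diag m k (B * ?b) (C * ?c)"
    by (subst mult_four_block_mat[OF B _ _ C bc(1) _ _ bc(2)])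
       (use B C bc in \<open>auto simp: left_add_zero_mat[of _ m m] right_add_zero_mat[of _ m m]
          left_add_zero_mat[of _ k k] right_add_zero_mat[of _ k k]\<close>)
  then show ?case
    using B C bc by (auto simp: pCons poly_mat_pCons[OF A] poly_mat_pCons[OF B] poly_mat_pCons[OF C]
        intro!: eq_matI)
qed

definition GL :: "nat \<Rightarrow> 'a::field mat set" where
  "GL n = {P \<in> carrier_mat n n. det P \<noteq> 0}"

lemma GL_inverse:
  assumes "P \<in> GL n"
  obtains Q where "Q \<in> GL n" "P * Q = 1\<^sub>m n" "Q * P = 1\<^sub>m n"
proof -
  have P: "P \<in> carrier_mat n n" "det P \<noteq> 0" using assms by (auto simp: GL_def)
  from det_non_zero_imp_unit[OF this] obtain Q where
    Q: "Q \<in> carrier_mat n n" "P * Q = 1\<^sub>m n" "Q * P = 1\<^sub>m n"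
    by (auto simp: Units_def ring_mat_def)
  from det_mult[OF P(1) Q(1)] Q(2) have "det P * det Q = 1" by simp
  then have "det Q \<noteq> 0" by auto
  with Q that show ?thesis by (auto simp: GL_def)
qed

lemma GL_carrier: "P \<in> GL n \<Longrightarrow> P \<in> carrier_mat n n"
  by (simp add: GL_def)

lemma GLI:
  assumes "P \<in> carrier_mat n n" "Q \<in> carrier_mat n n" "P * Q = 1\<^sub>m n"
  shows "P \<in> GL n"
proof -
  have "det P * det Q = 1" using det_mult[OF assms(1,2)] assms(3) by simp
  then show ?thesis using assms by (auto simp: GL_def)
qed

lemma GL_mult: "P \<in> GL n \<Longrightarrow> Q \<in> GL n \<Longrightarrow> P * Q \<in> GL n"
  by (auto simp: GL_def det_mult)

lemma GL_four_block_diag: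
  assumes "P \<in> carrier_mat m m" "Q \<in> carrier_mat k k"
  shows "block_diag m k P Q \<in> GL (m + k) \<longleftrightarrow> P \<in> GL m \<and> Q \<in> GL k"
  using det_four_block_mat_lower_left_zero[OF assms(1) zero_carrier_mat refl assms(2)] assms
  by (auto simp: GL_def)

text \<open>Completes a nonzero vector to a basis. Once the entries 0 and \<open>i\<close> of
  \<open>v\<close> are exchanged, the matrix with first column \<open>w\<close> and unit columns
  elsewhere is lower triangular with determinant \<open>v $ i\<close>; exchanging the two rows back
  restores \<open>v\<close>.\<close>

lemma GL_col:
  assumes v: "v \<in> carrier_vec n" and i: "i < n" "v $ i \<noteq> (0 :: 'a :: field)"
  obtains P where "P \<in> GL n" "col P 0 = v"
proof -
  obtain m where n: "n = Suc m" using i by (cases n) auto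
  define w where "w = (if i = 0 then v else vec n (\<lambda>j. if j = 0 then v $ i else if j = i then v $ 0 else v $ j))"
  define M where "M = mat n n (\<lambda>(a, b). if b = 0 then w $ a else if a = b then 1 else 0)"
  have w: "w \<in> carrier_vec n" "w $ 0 \<noteq> 0" using v i by (auto simp: w_def)
  have M: "M \<in> carrier_mat n n" by (simp add: M_def)
  have "det M = prod_list (diag_mat M)"
    by (rule det_lower_triangular[OF _ M]) (auto simp: M_def)
  also have "\<dots> \<noteq> 0"
    using w i M by (auto simp: prod_list_zero_iff diag_mat_def M_def split: if_splits)
  finally have dM: "det M \<noteq> 0" .
  show ?thesis
  proof (cases "i = 0")
    case True
    have "col M 0 = v" using i v w True by (auto simp: M_def w_def)
    with that[of M] M dM show ?thesis by (auto simp: GL_def)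
  next
    case False
    define P where "P = swaprows 0 i M"
    have P: "P \<in> carrier_mat n n" using M by (simp add: P_def)
    have "det P = - det M" unfolding P_def using i M False by (intro det_swaprows) auto
    moreover have "col P 0 = v"
      using i v w M False by (auto simp: P_def M_def w_def intro!: eq_vecI)
    ultimately show ?thesis using that[of P] P dM by (auto simp: GL_def)
  qed
qed

lemma four_block_mat_inject:
  assumes "four_block_mat A B C D = four_block_mat A' B' C' D'"
    and "A \<in> carrier_mat nr1 nc1" "B \<in> carrier_mat nr1 nc2" "C \<in> carrier_mat nr2 nc1" "D \<in> carrier_mat nr2 nc2"
    and "A' \<in> carrier_mat nr1 nc1" "B' \<in> carrier_mat nr1 nc2" "C' \<in> carrier_mat nr2 nc1" "D' \<in> carrier_mat nr2 nc2"
  shows "A = A'" "B = B'" "C = C'" "D = D'"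
proof -
  have *: "four_block_mat A B C D $$ (i, j) = four_block_mat A' B' C' D' $$ (i, j)" for i j
    using assms(1) by simp
  show "A = A'"
  proof (rule eq_matI)
    fix i j assume "i < dim_row A'" "j < dim_col A'"
    then show "A $$ (i, j) = A' $$ (i, j)" using *[of i j] assms(2-) by auto
  qed (use assms in auto)
  show "B = B'"
  proof (rule eq_matI)
    fix i j assume "i < dim_row B'" "j < dim_col B'"
    then show "B $$ (i, j) = B' $$ (i, j)" using *[of i "j + nc1"] assms(2-) by auto
  qed (use assms in auto)
  show "C = C'"
  proof (rule eq_matI)
    fix i j assume "i < dim_row C'" "j < dim_col C'"
    then show "C $$ (i, j) = C' $$ (i, j)" using *[of "i + nr1" j] assms(2-) by auto
  qed (use assms in auto)
  show "D = D'"
  proof (rule eq_matI)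
    fix i j assume "i < dim_row D'" "j < dim_col D'"
    then show "D $$ (i, j) = D' $$ (i, j)" using *[of "i + nr1" "j + nc1"] assms(2-) by auto
  qed (use assms in auto)
qed

lemma split_four_block:
  assumes A: "A \<in> carrier_mat (a + b) (c + d)"
  obtains A1 A2 A3 A4 where "A1 \<in> carrier_mat a c" "A2 \<in> carrier_mat a d"
    "A3 \<in> carrier_mat b c" "A4 \<in> carrier_mat b d" "A = four_block_mat A1 A2 A3 A4"
proof -
  obtain A1 A2 A3 A4 where sp: "split_block A a c = (A1, A2, A3, A4)"
    by (metis prod_cases4)
  have dims: "dim_row A = a + b" "dim_col A = c + d" using A by auto
  from split_block[OF sp dims] that show ?thesis by blast
qed

section \<open>Diagonalizing idempotents and splitting along coprime factors\<close>

lemma mult_block_upper: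
  fixes A1 :: "'a::semiring_1 mat"
  assumes "A1 \<in> carrier_mat a a" "B1 \<in> carrier_mat a b" "D1 \<in> carrier_mat b b"
    and "A2 \<in> carrier_mat a a" "B2 \<in> carrier_mat a b" "D2 \<in> carrier_mat b b"
  shows "four_block_mat A1 B1 (0\<^sub>m b a) D1 * four_block_mat A2 B2 (0\<^sub>m b a) D2 =
    four_block_mat (A1 * A2) (A1 * B2 + B1 * D2) (0\<^sub>m b a) (D1 * D2)"
proof -
  have "A1 * A2 + B1 * 0\<^sub>m b a = A1 * A2" "0\<^sub>m b a * A2 + D1 * 0\<^sub>m b a = 0\<^sub>m b a"
    "0\<^sub>m b a * B2 + D1 * D2 = D1 * D2"
    using assms by (auto intro!: eq_matI)
  then show ?thesis
    using mult_four_block_mat[OF assms(1,2) zero_carrier_mat assms(3,4,5) zero_carrier_mat assms(6)] by simp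
qed

text \<open>The shear by \<open>y\<close> conjugates one matrix into the other:
  \<open>y * G = y\<close> makes \<open>U * ?F'\<close> and \<open>?F * U\<close> both equal to
  \<open>?F\<close>.\<close>

lemma similar_block_upper_zero:
  fixes G :: "'a::field mat"
  assumes y: "y \<in> carrier_mat a n" and G: "G \<in> carrier_mat n n" and yG: "y * G = y"
  shows "similar_mat (four_block_mat (0\<^sub>m a a) y (0\<^sub>m n a) G)
    (block_diag a n (0\<^sub>m a a) G)" (is "similar_mat ?F ?F'")
proof -
  define U where "U = four_block_mat (1\<^sub>m a) y (0\<^sub>m n a) (1\<^sub>m n)"
  define V where "V = four_block_mat (1\<^sub>m a) (- y) (0\<^sub>m n a) (1\<^sub>m n)"
  have ny: "- y \<in> carrier_mat a n" using y by simp
  have ym: "- y + y = 0\<^sub>m a n" "y + - y = 0\<^sub>m a n" using y by (auto intro!: eq_matI)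
  have one: "block_diag a n (1\<^sub>m a) (1\<^sub>m n) = (1\<^sub>m (a + n) :: 'a mat)"
    by (intro eq_matI) auto
  have c: "U \<in> carrier_mat (a + n) (a + n)" "V \<in> carrier_mat (a + n) (a + n)"
    "?F \<in> carrier_mat (a + n) (a + n)" "?F' \<in> carrier_mat (a + n) (a + n)"
    unfolding U_def V_def by (rule four_block_carrier_mat; use G in simp)+
  have "U * V = four_block_mat (1\<^sub>m a * 1\<^sub>m a) (1\<^sub>m a * - y + y * 1\<^sub>m n) (0\<^sub>m n a) (1\<^sub>m n * 1\<^sub>m n)"
    unfolding U_def V_def by (rule mult_block_upper) (use y ny in auto)
  then have UV: "U * V = 1\<^sub>m (a + n)" using ym one y ny by simp
  have "V * U = four_block_mat (1\<^sub>m a * 1\<^sub>m a) (1\<^sub>m a * y + - y * 1\<^sub>m n) (0\<^sub>m n a) (1\<^sub>m n * 1\<^sub>m n)"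
    unfolding U_def V_def by (rule mult_block_upper) (use y ny in auto)
  then have VU: "V * U = 1\<^sub>m (a + n)" using ym one y ny by simp
  have "U * ?F' = four_block_mat (1\<^sub>m a * 0\<^sub>m a a) (1\<^sub>m a * 0\<^sub>m a n + y * G) (0\<^sub>m n a) (1\<^sub>m n * G)"
    unfolding U_def by (rule mult_block_upper) (use y G in auto)
  then have UF: "U * ?F' = ?F" using y G yG by simp
  have "?F * U = four_block_mat (0\<^sub>m a a * 1\<^sub>m a) (0\<^sub>m a a * y + y * 1\<^sub>m n) (0\<^sub>m n a) (G * 1\<^sub>m n)"
    unfolding U_def by (rule mult_block_upper) (use y G in auto)
  then have FU: "?F * U = ?F" using y G by simp
  have "U * ?F' * V = ?F * U * V" using UF FU by simp
  also have "\<dots> = ?F * (U * V)" using c by (intro assoc_mult_mat) auto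
  also have "\<dots> = ?F" unfolding UV by (rule right_mult_one_mat[OF c(3)])
  finally show ?thesis using UV VU c by (intro similar_matI[of _ _ U V "a + n"]) auto
qed

text \<open>Induction on the size. An invertible idempotent is the identity; otherwise a kernel
  vector becomes the first basis vector, and a shear separates it from the smaller idempotent
  \<open>G\<close> that remains.\<close>

lemma idempotent_similar:
  fixes E :: "'a::field mat"
  assumes "E \<in> carrier_mat n n" "E * E = E"
  shows "\<exists>m k. n = m + k \<and> similar_mat E (block_diag m k (0\<^sub>m m m) (1\<^sub>m k))"
  using assms
proof (induct n arbitrary: E)
  case 0
  have "E = block_diag 0 0 (0\<^sub>m 0 0) (1\<^sub>m 0)"
    using 0 by (intro eq_matI) auto
  with similar_mat_refl[OF 0(1)] show ?case by (intro exI[of _ 0]) auto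
next
  case (Suc n)
  let ?n = "Suc n"
  note E = Suc(2)
  show ?case
  proof (cases "det E = 0")
    case False
    then have "E \<in> GL ?n" using E by (simp add: GL_def)
    then obtain Q where Q: "Q \<in> GL ?n" "E * Q = 1\<^sub>m ?n" "Q * E = 1\<^sub>m ?n" by (rule GL_inverse)
    have "Q * (E * E) = E"
      using mult_inverse_cancel[OF _ E E Q(3)] Q by (auto simp: GL_def)
    then have "E = 1\<^sub>m ?n" using Suc(3) Q by simp
    also have "\<dots> = four_block_mat (0\<^sub>m 0 0) (0\<^sub>m 0 ?n) (0\<^sub>m ?n 0) (1\<^sub>m ?n)"
      by (intro eq_matI) auto
    finally have "E = four_block_mat (0\<^sub>m 0 0) (0\<^sub>m 0 ?n) (0\<^sub>m ?n 0) (1\<^sub>m ?n)" .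
    with similar_mat_refl[OF E] show ?thesis by (intro exI[of _ 0] exI[of _ ?n]) auto
  next
    case True
    then obtain v where v: "v \<in> carrier_vec ?n" "v \<noteq> 0\<^sub>v ?n" "E *\<^sub>v v = 0\<^sub>v ?n"
      using det_0_iff_vec_prod_zero_field[OF E] by blast
    then obtain i where i: "i < ?n" "v $ i \<noteq> 0" by (metis carrier_vecD eq_vecI index_zero_vec)
    from GL_col[OF v(1) i] obtain P where P: "P \<in> GL ?n" "col P 0 = v" .
    obtain Q where Q: "Q \<in> GL ?n" "P * Q = 1\<^sub>m ?n" "Q * P = 1\<^sub>m ?n" using GL_inverse[OF P(1)] .
    note cP = GL_carrier[OF P(1)] and cQ = GL_carrier[OF Q(1)]
    define F where "F = Q * E * P"
    have F: "F \<in> carrier_mat ?n ?n" using cP cQ E by (simp add: F_def)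
    have simEF: "similar_mat E F"
    proof (rule similar_mat_sym, rule similar_matI)
      show "{F, E, Q, P} \<subseteq> carrier_mat ?n ?n" using cP cQ E F by auto
    qed (use Q F_def in auto)
    have "F * F = Q * E * (P * (Q * (E * P)))"
      unfolding F_def using cP cQ E by (simp add: assoc_mult_mat[of _ ?n ?n _ ?n _ ?n])
    also have "P * (Q * (E * P)) = E * P"
      using cP cQ E Q by (intro mult_inverse_cancel[of _ ?n _ _ ?n]) auto
    also have "Q * E * (E * P) = Q * (E * E) * P"
      using cP cQ E by (simp add: assoc_mult_mat[of _ ?n ?n _ ?n _ ?n])
    finally have FF: "F * F = F" using Suc(3) by (simp add: F_def)
    have "F = Q * (E * P)"
      unfolding F_def using cP cQ E by (simp add: assoc_mult_mat[of _ ?n ?n _ ?n _ ?n])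
    then have "col F 0 = Q *\<^sub>v (E *\<^sub>v v)"
      using cP cQ E P(2) by (simp add: col_mult2[of _ ?n ?n _ ?n])
    then have colF: "col F 0 = 0\<^sub>v ?n" using v cQ by (auto intro!: eq_vecI)
    from F have F': "F \<in> carrier_mat (1 + n) (1 + n)" by simp
    obtain F1 y F3 G where FB: "F1 \<in> carrier_mat 1 1" "y \<in> carrier_mat 1 n"
      "F3 \<in> carrier_mat n 1" and G: "G \<in> carrier_mat n n" and Feq: "F = four_block_mat F1 y F3 G"
      using split_four_block[OF F'] .
    have entry: "F $$ (i, 0) = 0" if "i < ?n" for i
      using arg_cong[OF colF, of "\<lambda>w. w $ i"] that F by auto
    have "F1 = 0\<^sub>m 1 1" using entry[of 0] FB G by (intro eq_matI) (auto simp: Feq)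
    moreover have "F3 = 0\<^sub>m n 1"
    proof (rule eq_matI)
      fix i j assume "i < dim_row (0\<^sub>m n 1)" "j < dim_col (0\<^sub>m n 1)"
      then show "F3 $$ (i, j) = 0\<^sub>m n 1 $$ (i, j)" using entry[of "Suc i"] FB G by (auto simp: Feq)
    qed (use FB in auto)
    ultimately have Feq: "F = four_block_mat (0\<^sub>m 1 1) y (0\<^sub>m n 1) G" using Feq by simp
    have y: "y \<in> carrier_mat 1 n" by fact
    have "F * F = four_block_mat (0\<^sub>m 1 1 * 0\<^sub>m 1 1) (0\<^sub>m 1 1 * y + y * G) (0\<^sub>m n 1) (G * G)"
      unfolding Feq by (rule mult_block_upper) (use y G in auto)
    also have "0\<^sub>m 1 1 * y + y * G = y * G"
      using y G by (intro eq_matI) auto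
    also have "0\<^sub>m 1 1 * 0\<^sub>m 1 1 = (0\<^sub>m 1 1 :: 'a mat)" by (intro eq_matI) auto
    finally have "F * F = four_block_mat (0\<^sub>m 1 1) (y * G) (0\<^sub>m n 1) (G * G)" .
    with FF have "four_block_mat (0\<^sub>m 1 1) (y * G) (0\<^sub>m n 1) (G * G) = four_block_mat (0\<^sub>m 1 1) y (0\<^sub>m n 1) G"
      unfolding Feq by simp
    \<comment> \<open>Idempotence read block by block gives both the condition of the shear and the
      premise of the induction hypothesis.\<close>
    from four_block_mat_inject[OF this, of 1 1 n n] y G have yG: "y * G = y" "G * G = G" by auto
    from Suc(1)[OF G yG(2)] obtain m k where n: "n = m + k"
      and simG: "similar_mat G (block_diag m k (0\<^sub>m m m) (1\<^sub>m k))" by blast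
    define F' where "F' = block_diag 1 n (0\<^sub>m 1 1) G"
    have "similar_mat F F'"
      unfolding Feq F'_def by (rule similar_block_upper_zero[OF y G yG(1)])
    moreover have "similar_mat F' (four_block_mat (0\<^sub>m 1 1) (0\<^sub>m 1 n) (0\<^sub>m n 1)
        (block_diag m k (0\<^sub>m m m) (1\<^sub>m k)))"
      unfolding F'_def using G
      by (intro similar_mat_four_block_0_0[OF _ simG] similar_mat_refl) auto
    moreover have "four_block_mat (0\<^sub>m 1 1) (0\<^sub>m 1 n) (0\<^sub>m n 1)
        (block_diag m k (0\<^sub>m m m) (1\<^sub>m k)) =
        (four_block_mat (0\<^sub>m (Suc m) (Suc m)) (0\<^sub>m (Suc m) k) (0\<^sub>m k (Suc m)) (1\<^sub>m k) :: 'a mat)"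
      using n by (intro eq_matI) auto
    ultimately have "similar_mat E (four_block_mat (0\<^sub>m (Suc m) (Suc m)) (0\<^sub>m (Suc m) k) (0\<^sub>m k (Suc m)) (1\<^sub>m k))"
      using similar_mat_trans simEF by metis
    then show ?thesis using n by (intro exI[of _ "Suc m"] exI[of _ k]) auto
  qed
qed

text \<open>The value of \<open>u * p\<close> at \<open>A\<close> is idempotent because
  \<open>(u * p) * (v * r)\<close> is a multiple of \<open>p * r\<close>. \<open>A\<close> commutes
  with this projection, so it is block diagonal in a basis adapted to it. Where the projection is 0,
  \<open>p = p * (u * p) + v * (p * r)\<close> vanishes; where it is 1, \<open>r\<close> acts as
  \<open>u * (p * r)\<close>, which vanishes.\<close>

lemma coprime_annihilator_split:
  fixes A :: "'a::field mat"
  assumes A: "A \<in> carrier_mat n n" and bez: "u * p + v * r = 1"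
    and ann: "poly_mat (p * r) A = 0\<^sub>m n n"
  obtains m k B C where "n = m + k" "B \<in> carrier_mat m m" "C \<in> carrier_mat k k"
    "similar_mat A (block_diag m k B C)"
    "poly_mat p B = 0\<^sub>m m m" "poly_mat r C = 0\<^sub>m k k"
proof -
  define E where "E = poly_mat (u * p) A"
  have E: "E \<in> carrier_mat n n" using A by (simp add: E_def)
  have up: "(u * p) * (u * p) = u * p - (u * v) * (p * r)"
  proof -
    have "u * p * (u * p) = u * p * (1 - v * r)" using bez by (simp add: eq_diff_eq)
    then show ?thesis by (simp add: algebra_simps)
  qed
  have "E * E + poly_mat ((u * v) * (p * r)) A = E"
    unfolding E_def poly_mat_mult[OF A, symmetric] poly_mat_add[OF A, symmetric] up by simp
  moreover have "poly_mat ((u * v) * (p * r)) A = 0\<^sub>m n n"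
    unfolding poly_mat_mult[OF A, of "u * v"] ann using A by (simp add: poly_mat_carrier[of _ n] right_mult_zero_mat[of _ n n])
  ultimately have "E * E = E" using E by simp
  from idempotent_similar[OF E this] obtain m k where n: "n = m + k" and
    sim: "similar_mat E (block_diag m k (0\<^sub>m m m) (1\<^sub>m k))" by blast
  define D where "D = (block_diag m k (0\<^sub>m m m) (1\<^sub>m k) :: 'a mat)"
  have D: "D \<in> carrier_mat n n" using n four_block_carrier_mat[of "0\<^sub>m m m" m m "1\<^sub>m k" k k] by (simp add: D_def)
  from similar_mat_sym[OF sim, folded D_def] obtain P Q where wit: "similar_mat_wit D E P Q"
    by (auto simp: similar_mat_def)
  note w = similar_mat_witD2[OF D wit]
  define A' where "A' = P * A * Q"
  have A': "A' \<in> carrier_mat n n" using A w by (simp add: A'_def)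
  have pm: "poly_mat f A' = P * poly_mat f A * Q" for f
    unfolding A'_def using A w by (intro poly_mat_similar) auto
  have DE: "D = poly_mat (u * p) A'" using w by (simp add: pm E_def)
  have ann': "poly_mat (p * r) A' = 0\<^sub>m n n" using ann w by (simp add: pm)
  have "A' * D = D * A'" unfolding DE using A' by (intro poly_mat_commute_gen) auto
  obtain B Y Z C where blocks: "B \<in> carrier_mat m m" "Y \<in> carrier_mat m k" "Z \<in> carrier_mat k m"
    "C \<in> carrier_mat k k" and eq: "A' = four_block_mat B Y Z C"
    using split_four_block[OF A'[unfolded n]] by blast
  have "A' * D = four_block_mat (0\<^sub>m m m) Y (0\<^sub>m k m) C"
    unfolding eq D_def using blocks
    by (subst mult_four_block_mat[of _ m m _ k _ k _ _ m _ k]) auto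
  moreover have "D * A' = four_block_mat (0\<^sub>m m m) (0\<^sub>m m k) Z C"
    unfolding eq D_def using blocks
    by (subst mult_four_block_mat[of _ m m _ k _ k _ _ m _ k]) auto
  ultimately have "four_block_mat (0\<^sub>m m m) Y (0\<^sub>m k m) C = four_block_mat (0\<^sub>m m m) (0\<^sub>m m k) Z C"
    using \<open>A' * D = D * A'\<close> by simp
  from four_block_mat_inject[OF this, of m m k k] blocks have "Y = 0\<^sub>m m k" "Z = 0\<^sub>m k m" by auto
  with eq have eq: "A' = block_diag m k B C" by simp
  note fb = poly_mat_four_block[OF blocks(1,4)]
  from four_block_mat_inject[OF DE[unfolded D_def eq fb], of m m k k] blocks
  have BC: "poly_mat (u * p) B = 0\<^sub>m m m" "poly_mat (u * p) C = 1\<^sub>m k" by auto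
  have "0\<^sub>m n n = (block_diag m k (0\<^sub>m m m) (0\<^sub>m k k) :: 'a mat)"
    unfolding n by (intro eq_matI) auto
  from four_block_mat_inject[OF ann'[unfolded eq fb this], of m m k k] blocks
  have BC0: "poly_mat (p * r) B = 0\<^sub>m m m" "poly_mat (p * r) C = 0\<^sub>m k k" by auto
  have "poly_mat p B = poly_mat (p * (u * p + v * r)) B" using bez by simp
  also have "p * (u * p + v * r) = p * (u * p) + v * (p * r)" by (simp add: algebra_simps)
  also have "poly_mat (p * (u * p) + v * (p * r)) B = 0\<^sub>m m m"
    unfolding poly_mat_add[OF blocks(1)] poly_mat_mult[OF blocks(1), of p "u * p"]
      poly_mat_mult[OF blocks(1), of v] BC BC0 using blocks
    by (simp add: poly_mat_carrier[of _ m] right_mult_zero_mat[of _ m m])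
  finally have pB: "poly_mat p B = 0\<^sub>m m m" .
  have "poly_mat r C = poly_mat (u * p) C * poly_mat r C" using blocks BC by (simp add: poly_mat_carrier[of _ k] left_mult_one_mat[of _ k k])
  also have "\<dots> = poly_mat (u * (p * r)) C" unfolding poly_mat_mult[OF blocks(4), symmetric] by (simp add: mult.assoc)
  also have "\<dots> = 0\<^sub>m k k" unfolding poly_mat_mult[OF blocks(4), of u] BC0 using blocks
    by (simp add: poly_mat_carrier[of _ k] right_mult_zero_mat[of _ k k])
  finally have rC: "poly_mat r C = 0\<^sub>m k k" .
  have "similar_mat A A'" using w A A' unfolding A'_def
    by (intro similar_mat_sym[OF similar_matI[of _ _ P Q n]]) auto
  with eq show ?thesis using that n blocks pB rC by blast
qed

subsection \<open>Counting matrices annihilated by a product of coprime polynomials\<close>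

lemma field_poly_bezout:
  fixes p q :: "'a::field poly"
  assumes "coprime p q"
  obtains a b where "a * p + b * q = 1"
proof -
  have "\<exists>a b g. a * p + b * q = g \<and> g dvd p \<and> g dvd q" for p q :: "'a poly"
  \<comment> \<open>The measure is shifted by one because \<open>degree 0 = 0\<close> would not
    separate a zero remainder from a nonzero constant one.\<close>
  proof (induct "if q = 0 then 0 else Suc (degree q)" arbitrary: p q rule: less_induct)
    case less
    show ?case
    proof (cases "q = 0")
      case True
      then show ?thesis by (intro exI[of _ 1] exI[of _ 0] exI[of _ p]) auto
    next
      case False
      have "degree (p mod q) < degree q \<or> p mod q = 0" using degree_mod_less[OF False, of p] by auto
      then have "(if p mod q = 0 then 0 else Suc (degree (p mod q))) < (if q = 0 then 0 else Suc (degree q))"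
        using False by auto
      from less[OF this, of q] obtain a b g where
        g: "a * q + b * (p mod q) = g" "g dvd q" "g dvd p mod q" by blast
      have "p = (p div q) * q + p mod q" by simp
      with g(2,3) have "g dvd p" by (metis dvd_add dvd_mult)
      moreover have "b * p + (a - b * (p div q)) * q = g"
        unfolding g(1)[symmetric] by (simp add: algebra_simps minus_div_mult_eq_mod[symmetric])
      ultimately show ?thesis using g(2) by blast
    qed
  qed
  then obtain a b g where g: "a * p + b * q = g" "g dvd p" "g dvd q" by blast
  with assms have "is_unit g" by (meson coprime_def)
  then obtain h where "g * h = 1" by (metis dvdE)
  then have "(h * a) * p + (h * b) * q = 1" unfolding g(1)[symmetric] by (simp add: algebra_simps)
  with that show thesis by blast
qed

lemma irreducible_imp_coprime_field_poly:
  fixes p :: "'a::field poly"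
  assumes "irreducible p" "\<not> p dvd q"
  shows "coprime p q"
proof (rule coprimeI)
  fix c assume c: "c dvd p" "c dvd q"
  show "is_unit c"
  proof (rule ccontr)
    assume "\<not> is_unit c"
    with assms(1) c(1) have "p dvd c" by (meson irreducibleD')
    with c(2) have "p dvd q" by (rule comm_monoid_mult_class.dvd_trans[rotated])
    with assms(2) show False by simp
  qed
qed

lemma card_carrier_vec: "card (carrier_vec n :: 'a::finite vec set) = CARD('a) ^ n"
proof -
  have "bij_betw vec_of_list {xs :: 'a list. set xs \<subseteq> UNIV \<and> length xs = n} (carrier_vec n)"
    by (rule bij_betwI[of _ _ _ list_of_vec]) (auto simp: list_vec vec_list intro!: carrier_vecI)
  from bij_betw_same_card[OF this] show ?thesis
    using card_lists_length_eq[of "UNIV :: 'a set" n] by simp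
qed

lemma finite_carrier_vec: "finite (carrier_vec n :: 'a::finite vec set)"
  by (rule card_ge_0_finite) (simp add: card_carrier_vec card_gt_0_iff)

lemma card_field_gt_1: "CARD('a::{field,finite}) > 1"
proof -
  have "card {0, 1 :: 'a} \<le> CARD('a)" by (rule card_mono) auto
  then show ?thesis by simp
qed

text \<open>Counting vectors takes the place of rank: \<open>B\<close> is injective on a space with
  q^a elements and maps into one with q^b elements, where q is the size of the field.\<close>

lemma one_mat_factor_le:
  fixes A :: "'a::{field,finite} mat"
  assumes A: "A \<in> carrier_mat a b" and B: "B \<in> carrier_mat b a" and AB: "A * B = 1\<^sub>m a"
  shows "a \<le> b"
proof -
  have "inj_on (\<lambda>v. B *\<^sub>v v) (carrier_vec a)"
  proof (rule inj_on_inverseI[of _ "\<lambda>w. A *\<^sub>v w"])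
    fix v :: "'a vec" assume v: "v \<in> carrier_vec a"
    show "A *\<^sub>v (B *\<^sub>v v) = v"
      using assoc_mult_mat_vec[OF A B v] AB v by simp
  qed
  moreover have "(\<lambda>v. B *\<^sub>v v) ` carrier_vec a \<subseteq> carrier_vec b" using B by auto
  ultimately have "card (carrier_vec a :: 'a vec set) \<le> card (carrier_vec b :: 'a vec set)"
    using finite_carrier_vec by (rule card_inj_on_le)
  then have "CARD('a) ^ a \<le> CARD('a) ^ b" by (simp add: card_carrier_vec)
  moreover have "CARD('a) > 1" by (rule card_field_gt_1)
  ultimately show ?thesis by simp
qed

text \<open>A chosen two-sided inverse, meaningful on \<open>GL n\<close>, so that the bijections
  below can be given by formulas.\<close>

definition mat_inv :: "'a::field mat \<Rightarrow> 'a mat" where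
  "mat_inv P = (SOME Q. Q \<in> GL (dim_row P) \<and> P * Q = 1\<^sub>m (dim_row P) \<and> Q * P = 1\<^sub>m (dim_row P))"

lemma mat_inv:
  assumes P: "P \<in> GL n"
  shows "mat_inv P \<in> GL n" "P * mat_inv P = 1\<^sub>m n" "mat_inv P * P = 1\<^sub>m n"
    "mat_inv P \<in> carrier_mat n n"
proof -
  have d: "dim_row P = n" using GL_carrier[OF P] by simp
  have "\<exists>Q. Q \<in> GL n \<and> P * Q = 1\<^sub>m n \<and> Q * P = 1\<^sub>m n"
    using GL_inverse[OF P] by blast
  from someI_ex[OF this] show "mat_inv P \<in> GL n" "P * mat_inv P = 1\<^sub>m n" "mat_inv P * P = 1\<^sub>m n"
    "mat_inv P \<in> carrier_mat n n"
    by (auto simp: mat_inv_def d intro: GL_carrier)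
qed

lemma mult_block_diag_left:
  fixes B :: "'a::semiring_1 mat"
  assumes "B \<in> carrier_mat a a" "C \<in> carrier_mat b b"
    and "T1 \<in> carrier_mat a c" "T2 \<in> carrier_mat a d" "T3 \<in> carrier_mat b c" "T4 \<in> carrier_mat b d"
  shows "block_diag a b B C * four_block_mat T1 T2 T3 T4 =
    four_block_mat (B * T1) (B * T2) (C * T3) (C * T4)"
proof -
  have "B * T1 + 0\<^sub>m a b * T3 = B * T1" "B * T2 + 0\<^sub>m a b * T4 = B * T2"
    "0\<^sub>m b a * T1 + C * T3 = C * T3" "0\<^sub>m b a * T2 + C * T4 = C * T4"
    using assms by (auto intro!: eq_matI)
  then show ?thesis
    using mult_four_block_mat[OF assms(1) zero_carrier_mat zero_carrier_mat assms(2) assms(3-6)] by simp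
qed

lemma mult_block_diag_right:
  fixes B :: "'a::semiring_1 mat"
  assumes "B \<in> carrier_mat c c" "C \<in> carrier_mat d d"
    and "T1 \<in> carrier_mat a c" "T2 \<in> carrier_mat a d" "T3 \<in> carrier_mat b c" "T4 \<in> carrier_mat b d"
  shows "four_block_mat T1 T2 T3 T4 * block_diag c d B C =
    four_block_mat (T1 * B) (T2 * C) (T3 * B) (T4 * C)"
proof -
  have "T1 * B + T2 * 0\<^sub>m d c = T1 * B" "T1 * 0\<^sub>m c d + T2 * C = T2 * C"
    "T3 * B + T4 * 0\<^sub>m d c = T3 * B" "T3 * 0\<^sub>m c d + T4 * C = T4 * C"
    using assms by (auto intro!: eq_matI)
  then show ?thesis
    using mult_four_block_mat[OF assms(3-6) assms(1) zero_carrier_mat zero_carrier_mat assms(2)] by simp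
qed

definition ann :: "nat \<Rightarrow> 'a::field poly \<Rightarrow> 'a mat set" where
  "ann n p = {A \<in> carrier_mat n n. poly_mat p A = 0\<^sub>m n n}"

lemma annD: "A \<in> ann n p \<Longrightarrow> A \<in> carrier_mat n n" "A \<in> ann n p \<Longrightarrow> poly_mat p A = 0\<^sub>m n n"
  by (auto simp: ann_def)

lemma finite_ann: "finite (ann n p :: 'a::{field,finite} mat set)"
  by (rule finite_subset[OF _ finite_carrier_mat[of n n]]) (auto simp: ann_def)

lemma finite_GL: "finite (GL n :: 'a::{field,finite} mat set)"
  by (rule finite_subset[OF _ finite_carrier_mat[of n n]]) (auto simp: GL_def)

lemma card_GL_pos: "card (GL n :: 'a::{field,finite} mat set) > 0"
proof -
  have "1\<^sub>m n \<in> (GL n :: 'a mat set)" by (rule GLI[of _ _ "1\<^sub>m n"]) auto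
  then show ?thesis using finite_GL card_gt_0_iff by blast
qed

lemma ann_conj:
  assumes B: "B \<in> ann n p" and P: "P \<in> GL n"
  shows "P * B * mat_inv P \<in> ann n p"
  using poly_mat_similar[OF annD(1)[OF B] GL_carrier[OF P] mat_inv(4)[OF P] mat_inv(2)[OF P] mat_inv(3)[OF P], of p]
    annD[OF B] GL_carrier[OF P] mat_inv(4)[OF P]
  by (auto simp: ann_def)

lemma ann_mult_left: "A \<in> ann n p \<Longrightarrow> A \<in> ann n (f * p)"
  by (auto simp: ann_def poly_mat_mult right_mult_zero_mat[of _ n n])

text \<open>Multiplying \<open>Z\<close> by \<open>u * p + v * r\<close> evaluated at
  \<open>C\<close>, which is the identity, leaves only the part with \<open>u * p\<close>. Moved
  across \<open>Z\<close>, this polynomial is evaluated at \<open>B\<close>, where it is 0.\<close>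

lemma coprime_intertwiner_zero:
  assumes B: "B \<in> ann a p" and C: "C \<in> ann b r" and bez: "u * p + v * r = 1"
    and Z: "Z \<in> carrier_mat a b" and eq: "Z * C = B * Z"
  shows "Z = 0\<^sub>m a b"
proof -
  note cB = annD(1)[OF B] and cC = annD(1)[OF C]
  have "Z = Z * poly_mat (u * p + v * r) C" using Z bez cC by (simp add: right_mult_one_mat[of _ a b])
  also have "poly_mat (u * p + v * r) C = poly_mat (u * p) C"
    using annD(2)[OF ann_mult_left[OF C], of v] cC by (simp add: poly_mat_add[OF cC] poly_mat_carrier[of _ b] right_add_zero_mat[of _ b b])
  also have "Z * poly_mat (u * p) C = poly_mat (u * p) B * Z"
    using cB cC Z eq by (intro poly_mat_commute_gen) auto
  also have "\<dots> = 0\<^sub>m a b" using annD(2)[OF ann_mult_left[OF B], of u] Z by (simp add: left_mult_zero_mat[of _ a b])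
  finally show ?thesis .
qed

text \<open>The block sizes on the two sides may differ, because their equality is derived only
  afterwards, from the invertibility of \<open>T\<close>.\<close>

lemma intertwiner_block_diag:
  fixes B :: "'a::field mat"
  assumes B: "B \<in> ann a p" and C: "C \<in> ann b r" and B': "B' \<in> ann a' p" and C': "C' \<in> ann b' r"
    and bez: "u * p + v * r = 1" and T: "T \<in> carrier_mat (a + b) (a' + b')"
    and eq: "block_diag a b B C * T = T * block_diag a' b' B' C'"
  obtains T1 T4 where "T1 \<in> carrier_mat a a'" "T4 \<in> carrier_mat b b'"
    "T = four_block_mat T1 (0\<^sub>m a b') (0\<^sub>m b a') T4" "B * T1 = T1 * B'" "C * T4 = T4 * C'"
proof -
  obtain T1 T2 T3 T4 where T4: "T1 \<in> carrier_mat a a'" "T2 \<in> carrier_mat a b'"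
    "T3 \<in> carrier_mat b a'" "T4 \<in> carrier_mat b b'" and Teq: "T = four_block_mat T1 T2 T3 T4"
    using split_four_block[OF T] .
  note c = annD(1)[OF B] annD(1)[OF C] annD(1)[OF B'] annD(1)[OF C']
  have "four_block_mat (B * T1) (B * T2) (C * T3) (C * T4) =
      four_block_mat (T1 * B') (T2 * C') (T3 * B') (T4 * C')"
    using eq unfolding Teq mult_block_diag_left[OF c(1,2) T4] mult_block_diag_right[OF c(3,4) T4] .
  from four_block_mat_inject[OF this, of a a' b' b] c T4
  have e: "B * T1 = T1 * B'" "B * T2 = T2 * C'" "C * T3 = T3 * B'" "C * T4 = T4 * C'" by auto
  have "T2 = 0\<^sub>m a b'" by (rule coprime_intertwiner_zero[OF B C' bez T4(2) e(2)[symmetric]])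
  moreover have "T3 = 0\<^sub>m b a'"
    by (rule coprime_intertwiner_zero[OF C B' _ T4(3) e(3)[symmetric], of v u]) (use bez in \<open>simp add: add.commute\<close>)
  ultimately show thesis using that[of T1 T4] T4 e Teq by auto
qed

text \<open>Double counting of the tuples (k, B, C, P), each sent to the conjugate by
  \<open>P\<close> of the block diagonal matrix of \<open>B\<close> and \<open>C\<close>.
  \<open>coprime_annihilator_split\<close> makes this map surjective, and the vanishing of
  intertwiners between coprime blocks determines its fibres.\<close>

theorem card_ann_mult:
  fixes p r :: "'a::{field,finite} poly"
  assumes cop: "coprime p r"
  shows "real (card (ann n (p * r))) / card (GL n :: 'a mat set) =
    (\<Sum>k\<le>n. (card (ann (n - k) p) / card (GL (n - k) :: 'a mat set)) *
      (card (ann k r) / card (GL k :: 'a mat set)))"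
proof -
  obtain u v where bez: "u * p + v * r = 1" using field_poly_bezout[OF cop] .
  define D where "D k B C = block_diag (n - k) k B C" for k and B C :: "'a mat"
  define Y where "Y = (SIGMA k:{..n}. ann (n - k) p \<times> ann k r \<times> (GL n :: 'a mat set))"
  define f where "f = (\<lambda>(k, B, C, P). P * D k B C * mat_inv P)"
  \<comment> \<open>The inverse order of the group that acts simply transitively on the fibre, so
    that every fibre has total weight 1.\<close>
  define w where "w = (\<lambda>(k, B :: 'a mat, C :: 'a mat, P :: 'a mat).
    1 / (real (card (GL (n - k) :: 'a mat set)) * real (card (GL k :: 'a mat set))))"
  have finX: "finite Y" unfolding Y_def by (auto intro!: finite_ann finite_GL)
  have D_carrier: "D k B C \<in> carrier_mat n n"
    if "k \<le> n" "B \<in> carrier_mat (n - k) (n - k)" "C \<in> carrier_mat k k" for k B C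
    using four_block_carrier_mat[OF that(2,3)] that(1) by (simp add: D_def)
  have D_ann: "D k B C \<in> ann n (p * r)" if k: "k \<le> n" and B: "B \<in> ann (n - k) p" and C: "C \<in> ann k r" for k B C
  proof -
    note c = annD(1)[OF B] annD(1)[OF C]
    have "poly_mat (p * r) B = 0\<^sub>m (n - k) (n - k)"
      using annD(2)[OF ann_mult_left[OF B], of r] by (simp add: mult.commute)
    moreover have "poly_mat (p * r) C = 0\<^sub>m k k" using annD(2)[OF ann_mult_left[OF C], of p] .
    ultimately have "poly_mat (p * r) (D k B C) = 0\<^sub>m n n"
      unfolding D_def poly_mat_four_block[OF c] using k by (auto intro!: eq_matI)
    then show ?thesis using D_carrier[OF k c] by (simp add: ann_def)
  qed
  have fX: "f ` Y \<subseteq> ann n (p * r)"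
    by (auto simp: Y_def f_def intro!: ann_conj D_ann)
  have f_eq_iff: "P * M * mat_inv P = A \<longleftrightarrow> P * M = A * P"
    if P: "P \<in> GL n" and M: "M \<in> carrier_mat n n" and A: "A \<in> carrier_mat n n" for P M A :: "'a mat"
  proof
    note i = mat_inv[OF P] GL_carrier[OF P]
    assume "P * M * mat_inv P = A"
    then have "A * P = P * M * mat_inv P * P" by simp
    also have "\<dots> = P * M * (mat_inv P * P)" using i M by (intro assoc_mult_mat) auto
    finally show "P * M = A * P" using i M by (simp add: right_mult_one_mat[of _ n n])
  next
    note i = mat_inv[OF P] GL_carrier[OF P]
    assume "P * M = A * P"
    then have "P * M * mat_inv P = A * P * mat_inv P" by simp
    also have "\<dots> = A * (P * mat_inv P)" using i A by (intro assoc_mult_mat) auto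
    finally show "P * M * mat_inv P = A" using i A by (simp add: right_mult_one_mat[of _ n n])
  qed
  have fibre: "sum w {x \<in> Y. f x = A} = 1" if A: "A \<in> ann n (p * r)" for A
  proof -
    note cA = annD(1)[OF A]
    obtain m k0 B0 C0 where nm: "n = m + k0" and c0: "B0 \<in> carrier_mat m m" "C0 \<in> carrier_mat k0 k0"
      and sim: "similar_mat A (block_diag m k0 B0 C0)"
      and p0: "poly_mat p B0 = 0\<^sub>m m m" "poly_mat r C0 = 0\<^sub>m k0 k0"
      using coprime_annihilator_split[OF cA bez annD(2)[OF A]] .
    have m: "m = n - k0" "k0 \<le> n" using nm by auto
    have B0: "B0 \<in> ann (n - k0) p" and C0: "C0 \<in> ann k0 r" using c0 p0 m by (auto simp: ann_def)
    from sim obtain P0 Q0 where wit: "similar_mat_wit A (D k0 B0 C0) P0 Q0"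
      by (auto simp: similar_mat_def D_def m(1))
    note W = similar_mat_witD2[OF cA wit]
    have P0: "P0 \<in> GL n" using GLI[OF W(6,7,1)] .
    note i0 = mat_inv[OF P0]
    have D0: "D k0 B0 C0 \<in> carrier_mat n n" using W by simp
    have "A * P0 = P0 * D k0 B0 C0 * (Q0 * P0)"
      unfolding W(3) using D0 W(6,7) by (intro assoc_mult_mat) auto
    then have AP0: "P0 * D k0 B0 C0 = A * P0" using W D0 by (simp add: right_mult_one_mat[of _ n n])
    \<comment> \<open>Change of basis within the two summands: \<open>P0\<close> may be followed by
      any block diagonal matrix of \<open>g\<close> and \<open>e\<close>, at the price of
      conjugating \<open>B0\<close> and \<open>C0\<close>.\<close>
    define h where "h = (\<lambda>(g, e). (k0, mat_inv g * B0 * g, mat_inv e * C0 * e, P0 * D k0 g e))"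
    have h_bij: "bij_betw h (GL (n - k0) \<times> GL k0) {x \<in> Y. f x = A}"
    proof (rule bij_betw_imageI)
      show "inj_on h (GL (n - k0) \<times> GL k0)"
      proof (rule inj_onI, clarify)
        fix g e g' e' :: "'a mat"
        assume ge: "g \<in> GL (n - k0)" "e \<in> GL k0" "g' \<in> GL (n - k0)" "e' \<in> GL k0"
          and eq: "h (g, e) = h (g', e')"
        note c = ge[THEN GL_carrier]
        from eq have "mat_inv P0 * (P0 * D k0 g e) = mat_inv P0 * (P0 * D k0 g' e')" by (simp add: h_def)
        then have "D k0 g e = D k0 g' e'"
          using mult_inverse_cancel[OF i0(4) W(6) D_carrier i0(3)] m c by auto
        from four_block_mat_inject[OF this[unfolded D_def], of "n - k0" "n - k0" k0 k0] c
        show "g = g' \<and> e = e'" by auto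
      qed
      show "h ` (GL (n - k0) \<times> GL k0) = {x \<in> Y. f x = A}"
      proof (intro equalityI subsetI)
        fix x assume "x \<in> h ` (GL (n - k0) \<times> GL k0)"
        then obtain g e where ge: "g \<in> GL (n - k0)" "e \<in> GL k0" and x: "x = h (g, e)" by auto
        note c = ge[THEN GL_carrier]
        let ?B = "mat_inv g * B0 * g" and ?C = "mat_inv e * C0 * e"
        have inv2: "y * mat_inv y = 1\<^sub>m l \<and> mat_inv y * y = 1\<^sub>m l \<and> mat_inv y \<in> carrier_mat l l \<and> y \<in> carrier_mat l l"
          if "y \<in> GL l" for y :: "'a mat" and l using mat_inv[OF that] GL_carrier[OF that] by auto
        have conj2: "mat_inv y * M * y \<in> ann l s" "y * (mat_inv y * M * y) = M * y"
          if "y \<in> GL l" "M \<in> ann l s" for y M :: "'a mat" and l s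
        proof -
          note y = mat_inv[OF that(1)] GL_carrier[OF that(1)] annD[OF that(2)]
          show "mat_inv y * M * y \<in> ann l s"
            using poly_mat_similar[OF y(6) y(4) y(5) y(3) y(2), of s] y
            by (simp add: ann_def)
          have "y * (mat_inv y * M * y) = y * (mat_inv y * (M * y))"
            using assoc_mult_mat[OF y(4) y(6) y(5)] by simp
          also have "\<dots> = M * y" using y by (intro mult_inverse_cancel) auto
          finally show "y * (mat_inv y * M * y) = M * y" .
        qed
        have B: "?B \<in> ann (n - k0) p" "g * ?B = B0 * g" using conj2[OF ge(1) B0] by auto
        have C: "?C \<in> ann k0 r" "e * ?C = C0 * e" using conj2[OF ge(2) C0] by auto
        have Dge: "D k0 g e \<in> GL n"
          using GL_four_block_diag[OF c] ge m by (simp add: D_def)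
        have P: "P0 * D k0 g e \<in> GL n" by (rule GL_mult[OF P0 Dge])
        note cD = GL_carrier[OF Dge]
        have cBC: "D k0 ?B ?C \<in> carrier_mat n n" using B C m by (intro D_carrier annD(1)) auto
        have "D k0 g e * D k0 ?B ?C = D k0 (g * ?B) (e * ?C)"
          unfolding D_def using mult_block_diag_left[OF c zero_carrier_mat[of _ k0]] annD(1)[OF B(1)] annD(1)[OF C(1)] c
          by (subst mult_block_diag_left[of _ "n - k0" _ k0 _ "n - k0" _ k0]) auto
        also have "\<dots> = D k0 B0 C0 * D k0 g e"
          unfolding B(2) C(2) unfolding D_def using annD(1)[OF B0] annD(1)[OF C0] c
          by (subst mult_block_diag_left[of _ "n - k0" _ k0 _ "n - k0" _ k0]) auto
        finally have DD: "D k0 g e * D k0 ?B ?C = D k0 B0 C0 * D k0 g e" .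
        have "P0 * D k0 g e * D k0 ?B ?C = P0 * (D k0 g e * D k0 ?B ?C)"
          using cD cBC W by (intro assoc_mult_mat) auto
        also have "\<dots> = P0 * D k0 B0 C0 * D k0 g e"
          unfolding DD using cD D0 W by (intro assoc_mult_mat[symmetric]) auto
        also have "\<dots> = A * (P0 * D k0 g e)"
          unfolding AP0 using cD cA W by (intro assoc_mult_mat) auto
        finally have "f x = A"
          unfolding x h_def f_def using f_eq_iff[OF P cBC cA] by simp
        then show "x \<in> {x \<in> Y. f x = A}"
          using B C P m by (simp add: x h_def Y_def)
      next
        fix x assume "x \<in> {x \<in> Y. f x = A}"
        then obtain k B C P where x: "x = (k, B, C, P)" and k: "k \<le> n" and B: "B \<in> ann (n - k) p"
          and C: "C \<in> ann k r" and P: "P \<in> GL n" and fx: "P * D k B C * mat_inv P = A"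
          by (auto simp: Y_def f_def)
        have cD: "D k B C \<in> carrier_mat n n" using D_carrier k B C annD(1) by blast
        have PD: "P * D k B C = A * P" using f_eq_iff[OF P cD cA] fx by simp
        note iP = mat_inv[OF P] and cP = GL_carrier[OF P]
        \<comment> \<open>\<open>T\<close> compares the basis \<open>P\<close> with the reference
          basis \<open>P0\<close>. It intertwines the two block diagonal forms, so it is block
          diagonal itself, and so is its inverse \<open>S\<close>.\<close>
        define T where "T = mat_inv P0 * P"
        define S where "S = mat_inv P * P0"
        have cT: "T \<in> carrier_mat n n" and cS: "S \<in> carrier_mat n n" using iP i0 cP W by (auto simp: T_def S_def)
        have P0T: "P0 * T = P" unfolding T_def using W i0 cP by (intro mult_inverse_cancel) auto
        have PS: "P * S = P0" unfolding S_def using W iP cP by (intro mult_inverse_cancel) auto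
        have "P0 * (T * S) = P0 * T * S" using cT cS W by (intro assoc_mult_mat[symmetric]) auto
        then have "mat_inv P0 * (P0 * (T * S)) = mat_inv P0 * P0" using P0T PS by simp
        moreover have "mat_inv P0 * (P0 * (T * S)) = T * S"
          using W i0 cT cS by (intro mult_inverse_cancel[of _ n _ _ n]) auto
        ultimately have TS: "T * S = 1\<^sub>m n" using i0 by simp
        have ST: "S * T = 1\<^sub>m n" by (rule mat_mult_left_right_inverse[OF cT cS TS])
        have "P0 * (D k0 B0 C0 * T) = P0 * D k0 B0 C0 * T" using W D0 cT by (intro assoc_mult_mat[symmetric]) auto
        also have "\<dots> = A * (P0 * T)" unfolding AP0 using W cT cA by (intro assoc_mult_mat) auto
        also have "\<dots> = P0 * T * D k B C" unfolding P0T PD ..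
        also have "\<dots> = P0 * (T * D k B C)" using W cT cD by (intro assoc_mult_mat) auto
        finally have "mat_inv P0 * (P0 * (D k0 B0 C0 * T)) = mat_inv P0 * (P0 * (T * D k B C))" by simp
        moreover have "mat_inv P0 * (P0 * (D k0 B0 C0 * T)) = D k0 B0 C0 * T"
          using W i0 cT D0 by (intro mult_inverse_cancel[of _ n _ _ n]) auto
        moreover have "mat_inv P0 * (P0 * (T * D k B C)) = T * D k B C"
          using W i0 cT cD by (intro mult_inverse_cancel[of _ n _ _ n]) auto
        ultimately have DT: "D k0 B0 C0 * T = T * D k B C" by simp
        have "D k B C * S = S * T * (D k B C * S)" using ST cD cS by (simp add: left_mult_one_mat[of _ n n])
        also have "\<dots> = S * (T * (D k B C * S))" using cD cS cT by (intro assoc_mult_mat) auto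
        also have "T * (D k B C * S) = T * D k B C * S" using cD cS cT by (intro assoc_mult_mat[symmetric]) auto
        also have "\<dots> = D k0 B0 C0 * (T * S)" unfolding DT[symmetric] using D0 cS cT by (intro assoc_mult_mat) auto
        also have "\<dots> = D k0 B0 C0" using TS D0 by (simp add: right_mult_one_mat[of _ n n])
        finally have DS: "D k B C * S = S * D k0 B0 C0" .
        have cT': "T \<in> carrier_mat ((n - k0) + k0) ((n - k) + k)" and cS': "S \<in> carrier_mat ((n - k) + k) ((n - k0) + k0)"
          using cT cS k m by auto
        obtain T1 T4 where T14: "T1 \<in> carrier_mat (n - k0) (n - k)" "T4 \<in> carrier_mat k0 k"
          and Teq: "T = four_block_mat T1 (0\<^sub>m (n - k0) k) (0\<^sub>m k0 (n - k)) T4"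
          and BT: "B0 * T1 = T1 * B" and CT: "C0 * T4 = T4 * C"
          using intertwiner_block_diag[OF B0 C0 B C bez cT' DT[unfolded D_def]] .
        obtain S1 S4 where S14: "S1 \<in> carrier_mat (n - k) (n - k0)" "S4 \<in> carrier_mat k k0"
          and Seq: "S = four_block_mat S1 (0\<^sub>m (n - k) k0) (0\<^sub>m k (n - k0)) S4"
          using intertwiner_block_diag[OF B C B0 C0 bez cS' DS[unfolded D_def]] .
        have prod: "T * S = block_diag (n - k0) k0 (T1 * S1) (T4 * S4)"
        proof -
          have "T1 * S1 + 0\<^sub>m (n - k0) k * 0\<^sub>m k (n - k0) = T1 * S1"
            "T1 * 0\<^sub>m (n - k) k0 + 0\<^sub>m (n - k0) k * S4 = 0\<^sub>m (n - k0) k0"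
            "0\<^sub>m k0 (n - k) * S1 + T4 * 0\<^sub>m k (n - k0) = 0\<^sub>m k0 (n - k0)"
            "0\<^sub>m k0 (n - k) * 0\<^sub>m (n - k) k0 + T4 * S4 = T4 * S4"
            using T14 S14 by (auto intro!: eq_matI)
          then show ?thesis unfolding Teq Seq
            using mult_four_block_mat[OF T14(1) zero_carrier_mat zero_carrier_mat T14(2) S14(1) zero_carrier_mat zero_carrier_mat S14(2)]
            by simp
        qed
        have "(1\<^sub>m n :: 'a mat) = four_block_mat (1\<^sub>m (n - k0)) (0\<^sub>m (n - k0) k0) (0\<^sub>m k0 (n - k0)) (1\<^sub>m k0)"
          using m(2) by (intro eq_matI) auto
        from four_block_mat_inject[OF TS[unfolded prod this], of "n - k0" "n - k0" k0 k0] T14 S14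
        have one: "T1 * S1 = 1\<^sub>m (n - k0)" "T4 * S4 = 1\<^sub>m k0" by auto
        \<comment> \<open>The two diagonal blocks give n - k0 <= n - k and k0 <= k, hence
          equality.\<close>
        from one_mat_factor_le[OF T14(1) S14(1) one(1)] one_mat_factor_le[OF T14(2) S14(2) one(2)] k m
        have kk: "k = k0" by linarith
        note T14 = T14[unfolded kk] and S14 = S14[unfolded kk]
        have G: "T1 \<in> GL (n - k0)" "T4 \<in> GL k0" using GLI[OF T14(1) S14(1) one(1)] GLI[OF T14(2) S14(2) one(2)] by auto
        have cB: "B \<in> carrier_mat (n - k0) (n - k0)" "C \<in> carrier_mat k0 k0" using B C kk annD(1) by auto
        have "mat_inv T1 * B0 * T1 = mat_inv T1 * (B0 * T1)"
          using mat_inv(4)[OF G(1)] annD(1)[OF B0] T14 by (intro assoc_mult_mat) auto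
        also have "\<dots> = B" unfolding BT using mat_inv[OF G(1)] T14 cB by (intro mult_inverse_cancel) auto
        finally have 1: "mat_inv T1 * B0 * T1 = B" .
        have "mat_inv T4 * C0 * T4 = mat_inv T4 * (C0 * T4)"
          using mat_inv(4)[OF G(2)] annD(1)[OF C0] T14 by (intro assoc_mult_mat) auto
        also have "\<dots> = C" unfolding CT using mat_inv[OF G(2)] T14 cB by (intro mult_inverse_cancel) auto
        finally have 2: "mat_inv T4 * C0 * T4 = C" .
        have "D k0 T1 T4 = T" unfolding D_def Teq kk ..
        then have "x = h (T1, T4)" using 1 2 P0T by (simp add: x h_def kk)
        then show "x \<in> h ` (GL (n - k0) \<times> GL k0)" using G by auto
      qed
    qed
    have "sum w {x \<in> Y. f x = A} = (\<Sum>y\<in>GL (n - k0) \<times> GL k0. w (h y))"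
      by (rule sum.reindex_bij_betw[OF h_bij, symmetric])
    also have "\<dots> = (\<Sum>y\<in>(GL (n - k0) :: 'a mat set) \<times> (GL k0 :: 'a mat set). 1 / (real (card (GL (n - k0) :: 'a mat set)) * real (card (GL k0 :: 'a mat set))))"
      by (intro sum.cong) (auto simp: w_def h_def)
    also have "\<dots> = 1"
      using card_GL_pos[where 'a='a and n=k0] card_GL_pos[where 'a='a and n="n - k0"]
      by (simp add: card_cartesian_product)
    finally show ?thesis .
  qed
  have "real (card (ann n (p * r))) = (\<Sum>A\<in>ann n (p * r). sum w {x \<in> Y. f x = A})"
    by (simp add: fibre)
  also have "\<dots> = sum w Y" by (rule sum.group[OF finX finite_ann fX])
  also have "\<dots> = (\<Sum>k\<le>n. \<Sum>y\<in>ann (n - k) p \<times> ann k r \<times> (GL n :: 'a mat set). w (k, y))"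
    unfolding Y_def by (subst sum.Sigma) (auto intro!: finite_ann finite_GL)
  also have "\<dots> = (\<Sum>k\<le>n. card (GL n :: 'a mat set) * ((card (ann (n - k) p) / card (GL (n - k) :: 'a mat set)) *
      (card (ann k r) / card (GL k :: 'a mat set))))"
  proof (rule sum.cong[OF refl])
    fix k
    have "(\<Sum>y\<in>ann (n - k) p \<times> ann k r \<times> (GL n :: 'a mat set). w (k, y)) =
      (\<Sum>y\<in>ann (n - k) p \<times> ann k r \<times> (GL n :: 'a mat set).
         1 / (real (card (GL (n - k) :: 'a mat set)) * real (card (GL k :: 'a mat set))))"
      by (intro sum.cong) (auto simp: w_def)
    then show "(\<Sum>y\<in>ann (n - k) p \<times> ann k r \<times> (GL n :: 'a mat set). w (k, y)) =
      card (GL n :: 'a mat set) * ((card (ann (n - k) p) / card (GL (n - k) :: 'a mat set)) *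
      (card (ann k r) / card (GL k :: 'a mat set)))"
      by (simp add: card_cartesian_product)
  qed
  finally have "real (card (ann n (p * r))) = \<dots>" .
  then show ?thesis
    unfolding sum_distrib_left[symmetric] using card_GL_pos[where 'a='a and n=n]
    by simp
qed

subsection \<open>Matrices annihilated by an irreducible polynomial\<close>

lemma vec_add_eq_zero:
  fixes v w :: "'a::ab_group_add vec"
  assumes "v + w = 0\<^sub>v n" "v \<in> carrier_vec n" "w \<in> carrier_vec n"
  shows "v = - w"
proof (rule eq_vecI)
  fix i assume "i < dim_vec (- w)"
  then show "v $ i = (- w) $ i"
    using arg_cong[OF assms(1), of "\<lambda>u. u $ i"] assms(2,3) by (simp add: eq_neg_iff_add_eq_0)
qed (use assms in auto)

lemma vec_add_left_cancel:
  fixes u v w :: "'a::ab_group_add vec"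
  assumes "u \<in> carrier_vec n" "v \<in> carrier_vec n" "w \<in> carrier_vec n" "u + v = u + w"
  shows "v = w"
proof (rule eq_vecI)
  fix i assume "i < dim_vec w"
  then show "v $ i = w $ i"
    using arg_cong[OF assms(4), of "\<lambda>u. u $ i"] assms(1-3) by simp
qed (use assms in auto)

lemma irreducible_degree_pos:
  fixes p :: "'a::field poly"
  assumes "irreducible p"
  shows "degree p > 0"
proof (rule ccontr)
  assume "\<not> degree p > 0"
  moreover have "p \<noteq> 0" using assms by auto
  ultimately have "is_unit p" by (simp add: is_unit_iff_degree)
  moreover have "\<not> is_unit p" by (rule irreducible_not_unit[OF assms])
  ultimately show False by blast
qed

text \<open>Coefficients are bounded instead of the degree, so that \<open>polys_below 0\<close> is
  {0} rather than empty. For irreducible \<open>\<phi>\<close> of degree \<open>d\<close> these are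
  the representatives of the residue field modulo \<open>\<phi>\<close>.\<close>

definition polys_below :: "nat \<Rightarrow> 'a::zero poly set" where
  "polys_below d = {f. \<forall>i\<ge>d. coeff f i = 0}"

lemma polys_below_0: "polys_below 0 = {0}"
  by (auto simp: polys_below_def poly_eq_iff)

lemma polys_below_Suc:
  "polys_below (Suc d) = (\<lambda>(a, f). pCons a f) ` (UNIV \<times> polys_below d)"
proof (intro equalityI subsetI)
  fix f :: "'a poly" assume f: "f \<in> polys_below (Suc d)"
  obtain a g where fg: "f = pCons a g" by (cases f)
  have "coeff g i = 0" if "i \<ge> d" for i
    using f that unfolding polys_below_def fg by (auto dest!: spec[of _ "Suc i"])
  then have "g \<in> polys_below d" by (simp add: polys_below_def)
  then show "f \<in> (\<lambda>(a, f). pCons a f) ` (UNIV \<times> polys_below d)" using fg by auto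
qed (auto simp: polys_below_def coeff_pCons split: nat.splits)

lemma card_polys_below: "card (polys_below d :: 'a::{zero,finite} poly set) = CARD('a) ^ d"
proof (induct d)
  case (Suc d)
  have "inj_on (\<lambda>(a, f). pCons a f) (UNIV \<times> (polys_below d :: 'a poly set))"
    by (auto simp: inj_on_def)
  from card_image[OF this] show ?case
    by (simp add: polys_below_Suc card_cartesian_product Suc)
qed (simp add: polys_below_0)

lemma finite_polys_below: "finite (polys_below d :: 'a::{zero,finite} poly set)"
  by (rule card_ge_0_finite) (simp add: card_polys_below card_gt_0_iff)

lemma polys_below_iff:
  assumes "d > 0"
  shows "f \<in> polys_below d \<longleftrightarrow> degree f < d"
proof
  assume f: "f \<in> polys_below d"
  show "degree f < d"
  proof (rule ccontr)
    assume "\<not> degree f < d"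
    with f have "coeff f (degree f) = 0" by (simp add: polys_below_def)
    then have "f = 0" by (rule iffD1[OF leading_coeff_0_iff])
    with assms \<open>\<not> degree f < d\<close> show False by simp
  qed
qed (auto simp: polys_below_def intro: coeff_eq_0)

lemma polys_below_diff: "f \<in> polys_below d \<Longrightarrow> g \<in> polys_below d \<Longrightarrow> (f - g :: 'a::ab_group_add poly) \<in> polys_below d"
  by (auto simp: polys_below_def)

text \<open>A linear combination of \<open>vs\<close> in the module over polynomials on which X acts
  as \<open>A\<close>.\<close>

fun poly_comb :: "'a::comm_ring_1 mat \<Rightarrow> 'a poly list \<Rightarrow> 'a vec list \<Rightarrow> 'a vec" where
  "poly_comb A (f # fs) (v # vs) = poly_mat f A *\<^sub>v v + poly_comb A fs vs"
| "poly_comb A fs vs = 0\<^sub>v (dim_row A)"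

lemma poly_mat_mult_vec_carrier [simp, intro]:
  "A \<in> carrier_mat n n \<Longrightarrow> v \<in> carrier_vec n \<Longrightarrow> poly_mat f A *\<^sub>v v \<in> carrier_vec n"
  by (rule mult_mat_vec_carrier[OF poly_mat_carrier])

definition tuples :: "nat \<Rightarrow> nat \<Rightarrow> 'a::zero poly list set" where
  "tuples d m = {fs. set fs \<subseteq> polys_below d \<and> length fs = m}"

lemma card_tuples: "card (tuples d m :: 'a::{zero,finite} poly list set) = CARD('a) ^ (d * m)"
  using card_lists_length_eq[OF finite_polys_below[of d], where n=m]
  by (simp add: tuples_def card_polys_below power_mult)

lemma poly_comb_carrier:
  assumes "A \<in> carrier_mat n n" "set vs \<subseteq> carrier_vec n"
  shows "poly_comb A fs vs \<in> carrier_vec n"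
  using assms(1,2)
  by (induct A fs vs rule: poly_comb.induct) auto

lemma poly_comb_diff:
  assumes A: "A \<in> carrier_mat n n" and "set vs \<subseteq> carrier_vec n" "length fs = length vs" "length gs = length vs"
  shows "poly_comb A (map2 (-) fs gs) vs = poly_comb A fs vs - poly_comb A gs vs"
  using assms(2-)
proof (induct vs arbitrary: fs gs)
  case (Cons v vs)
  obtain f fs' g gs' where fg: "fs = f # fs'" "gs = g # gs'" using Cons(3,4) by (cases fs; cases gs) auto
  have c: "poly_comb A fs' vs \<in> carrier_vec n" "poly_comb A gs' vs \<in> carrier_vec n" "v \<in> carrier_vec n"
    "poly_mat f A *\<^sub>v v \<in> carrier_vec n" "poly_mat g A *\<^sub>v v \<in> carrier_vec n"
    using Cons A by (auto intro!: poly_comb_carrier)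
  have "poly_mat ((f - g) + g) A = poly_mat (f - g) A + poly_mat g A" by (rule poly_mat_add[OF A])
  then have "poly_mat f A *\<^sub>v v = poly_mat (f - g) A *\<^sub>v v + poly_mat g A *\<^sub>v v"
    using A c by (simp add: add_mult_distrib_mat_vec[of _ n n])
  moreover have "poly_mat (f - g) A *\<^sub>v v \<in> carrier_vec n" using A c by auto
  ultimately have "poly_mat (f - g) A *\<^sub>v v = poly_mat f A *\<^sub>v v - poly_mat g A *\<^sub>v v"
    using c A by (auto intro!: eq_vecI)
  then show ?case using Cons fg c A by (auto intro!: eq_vecI)
qed (use A in auto)

lemma poly_comb_smult:
  assumes A: "A \<in> carrier_mat n n" and "set vs \<subseteq> carrier_vec n" "length fs = length vs"
  shows "poly_comb A (map ((*) h) fs) vs = poly_mat h A *\<^sub>v poly_comb A fs vs"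
  using assms(2-)
proof (induct vs arbitrary: fs)
  case (Cons v vs)
  obtain f fs' where fg: "fs = f # fs'" using Cons(3) by (cases fs) auto
  have c: "poly_comb A fs' vs \<in> carrier_vec n" "v \<in> carrier_vec n"
    "poly_mat f A \<in> carrier_mat n n" "poly_mat h A \<in> carrier_mat n n"
    using Cons A by (auto intro!: poly_comb_carrier)
  have "poly_mat (h * f) A *\<^sub>v v = poly_mat h A *\<^sub>v (poly_mat f A *\<^sub>v v)"
    unfolding poly_mat_mult[OF A] by (rule assoc_mult_mat_vec[OF c(4,3,2)])
  then show ?case using Cons fg c mult_add_distrib_mat_vec[OF c(4), of "poly_mat f A *\<^sub>v v" "poly_comb A fs' vs"] by simp
qed (use A in auto)

text \<open>Through this reduction, combinations with coefficients of bounded degree are closed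
  under multiplication by arbitrary polynomials.\<close>

lemma poly_comb_mod:
  fixes \<phi> :: "'a::field poly"
  assumes A: "A \<in> ann n \<phi>"
  shows "poly_comb A (map (\<lambda>f. f mod \<phi>) fs) vs = poly_comb A fs vs"
proof -
  note c = annD(1)[OF A]
  have "poly_mat f A = poly_mat (f mod \<phi>) A" for f
  proof -
    have "poly_mat f A = poly_mat ((f div \<phi>) * \<phi> + f mod \<phi>) A" by simp
    also have "\<dots> = poly_mat (f mod \<phi>) A"
      unfolding poly_mat_add[OF c] using annD(2)[OF ann_mult_left[OF A]] c
      by (simp add: poly_mat_carrier[of _ n] left_add_zero_mat[of _ n n])
    finally show ?thesis .
  qed
  then show ?thesis by (induct A fs vs rule: poly_comb.induct) auto
qed

text \<open>Linear independence over the residue field, expressed as injectivity on tuples of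
  representatives; the size of the span follows at once.\<close>

definition poly_indep :: "nat \<Rightarrow> 'a::field mat \<Rightarrow> 'a vec list \<Rightarrow> bool" where
  "poly_indep d A vs \<longleftrightarrow> inj_on (\<lambda>fs. poly_comb A fs vs) (tuples d (length vs))"

definition poly_span :: "nat \<Rightarrow> 'a::field mat \<Rightarrow> 'a vec list \<Rightarrow> 'a vec set" where
  "poly_span d A vs = (\<lambda>fs. poly_comb A fs vs) ` tuples d (length vs)"

lemma tuples_Cons: "f # fs \<in> tuples d (Suc m) \<longleftrightarrow> f \<in> polys_below d \<and> fs \<in> tuples d m"
  by (auto simp: tuples_def)

lemma tuples_SucE:
  assumes "fs \<in> tuples d (Suc m)"
  obtains g gs where "fs = g # gs" "g \<in> polys_below d" "gs \<in> tuples d m"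
  using assms by (cases fs) (auto simp: tuples_def)

text \<open>The usual criterion of linear algebra over the field of polynomials modulo
  \<open>\<phi>\<close>. Division by a nonzero coefficient is Bezout's identity with
  \<open>\<phi>\<close>.\<close>

lemma poly_indep_Cons_iff:
  fixes \<phi> :: "'a::field poly"
  assumes A: "A \<in> ann n \<phi>" and irr: "irreducible \<phi>" and d: "degree \<phi> = d"
    and v: "v \<in> carrier_vec n" and vs: "set vs \<subseteq> carrier_vec n"
  shows "poly_indep d A (v # vs) \<longleftrightarrow> poly_indep d A vs \<and> v \<notin> poly_span d A vs"
proof -
  note c = annD(1)[OF A]
  have d0: "d > 0" using irr d by (auto intro: irreducible_degree_pos)
  note cc = poly_comb_carrier[OF c vs]
  have t0: "0 \<in> polys_below d" and t1: "1 \<in> (polys_below d :: 'a poly set)" using d0 by (auto simp: polys_below_iff)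
  have zero: "poly_comb A (0 # fs) (v # vs) = poly_comb A fs vs" for fs
  proof -
    have "0\<^sub>m n n *\<^sub>v v = 0\<^sub>v n" using v by (auto intro!: eq_vecI)
    then show ?thesis using c v cc[of fs] by simp
  qed
  have one: "poly_comb A (1 # replicate (length vs) 0) (v # vs) = v"
  proof -
    have "poly_comb A (replicate (length vs) 0) vs = 0\<^sub>v n"
      using vs by (induct vs) (use c in auto)
    then show ?thesis using c v by simp
  qed
  show ?thesis
  proof (intro iffI conjI notI)
    assume ind: "poly_indep d A (v # vs)"
    show "poly_indep d A vs" unfolding poly_indep_def
    proof (rule inj_onI)
      fix fs gs assume fg: "fs \<in> tuples d (length vs)" "gs \<in> tuples d (length vs)"
        and eq: "poly_comb A fs vs = poly_comb A gs vs"
      have "0 # fs = 0 # gs"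
        by (rule inj_onD[OF ind[unfolded poly_indep_def]]) (use fg eq t0 zero in \<open>auto simp: tuples_Cons\<close>)
      then show "fs = gs" by simp
    qed
    assume "v \<in> poly_span d A vs"
    then obtain fs where fs: "fs \<in> tuples d (length vs)" "v = poly_comb A fs vs" by (auto simp: poly_span_def)
    \<comment> \<open>Two tuples with the same combination \<open>v\<close>: coefficient 0 followed
      by \<open>fs\<close>, and coefficient 1 followed by zeros.\<close>
    have "0 # fs = 1 # replicate (length vs) 0"
      by (rule inj_onD[OF ind[unfolded poly_indep_def]])
         (use fs t0 t1 zero one in \<open>auto simp: tuples_Cons tuples_def\<close>)
    then show False by simp
  next
    assume "poly_indep d A vs \<and> v \<notin> poly_span d A vs"
    then have ind: "poly_indep d A vs" and nv: "v \<notin> poly_span d A vs" by auto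
    show "poly_indep d A (v # vs)" unfolding poly_indep_def
    proof (rule inj_onI)
      fix fs gs assume fg: "fs \<in> tuples d (length (v # vs))" "gs \<in> tuples d (length (v # vs))"
        and eq: "poly_comb A fs (v # vs) = poly_comb A gs (v # vs)"
      obtain f fs' g gs' where e: "fs = f # fs'" "gs = g # gs'"
        and t: "f \<in> polys_below d" "g \<in> polys_below d" "fs' \<in> tuples d (length vs)" "gs' \<in> tuples d (length vs)"
        using fg by (auto elim!: tuples_SucE)
      have l: "length fs' = length vs" "length gs' = length vs" using t by (auto simp: tuples_def)
      have "poly_comb A (map2 (-) fs gs) (v # vs) = poly_comb A fs (v # vs) - poly_comb A gs (v # vs)"
        by (rule poly_comb_diff[OF c]) (use v vs e l in auto)
      also have "\<dots> = 0\<^sub>v n" unfolding eq using poly_comb_carrier[OF c, of "v # vs" gs] v vs by auto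
      finally have "poly_mat (f - g) A *\<^sub>v v + poly_comb A (map2 (-) fs' gs') vs = 0\<^sub>v n" by (simp add: e)
      moreover have "poly_comb A (map2 (-) gs' fs') vs = - poly_comb A (map2 (-) fs' gs') vs"
        using cc[of fs'] cc[of gs'] by (auto simp: poly_comb_diff[OF c vs] l intro!: eq_vecI)
      moreover have "poly_mat (f - g) A *\<^sub>v v \<in> carrier_vec n" using c v by auto
      ultimately have hv: "poly_mat (f - g) A *\<^sub>v v = poly_comb A (map2 (-) gs' fs') vs"
        using cc[of "map2 (-) fs' gs'"] by (simp add: vec_add_eq_zero)
      show "fs = gs"
      proof (cases "f = g")
        case True
        then have "poly_comb A fs' vs = poly_comb A gs' vs"
          using eq cc[of fs'] cc[of gs'] c v unfolding e
          by (simp add: vec_add_left_cancel[OF poly_mat_mult_vec_carrier[OF c v]])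
        from inj_onD[OF ind[unfolded poly_indep_def] this t(3,4)] True show ?thesis by (simp add: e)
      next
        case False
        have "f - g \<in> polys_below d" using t by (intro polys_below_diff)
        then have "degree (f - g) < degree \<phi>" using d d0 by (simp add: polys_below_iff)
        then have "\<not> \<phi> dvd f - g" using False by (metis dvd_imp_degree_le leD right_minus_eq)
        \<comment> \<open>\<open>a\<close> inverts \<open>f - g\<close> modulo
          \<open>\<phi>\<close>; applying it to \<open>hv\<close> expresses \<open>v\<close> through
          \<open>vs\<close>, which contradicts \<open>nv\<close>.\<close>
        from field_poly_bezout[OF irreducible_imp_coprime_field_poly[OF irr this]]
        obtain b a where ba: "b * \<phi> + a * (f - g) = 1" .
        have cp: "poly_mat a A * poly_mat (f - g) A \<in> carrier_mat n n"
          using c by (intro mult_carrier_mat) auto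
        have "poly_mat (b * \<phi> + a * (f - g)) A = poly_mat a A * poly_mat (f - g) A"
          unfolding poly_mat_add[OF c] annD(2)[OF ann_mult_left[OF A], of b] poly_mat_mult[OF c, of a]
          using cp by (rule left_add_zero_mat)
        then have "1\<^sub>m n = poly_mat a A * poly_mat (f - g) A" using ba c by simp
        from arg_cong[OF this, of "\<lambda>M. M *\<^sub>v v"]
        have "v = (poly_mat a A * poly_mat (f - g) A) *\<^sub>v v" using v by simp
        also have "\<dots> = poly_mat a A *\<^sub>v (poly_mat (f - g) A *\<^sub>v v)" using c v by (intro assoc_mult_mat_vec) auto
        also have "\<dots> = poly_comb A (map ((*) a) (map2 (-) gs' fs')) vs"
          unfolding hv using l by (intro poly_comb_smult[symmetric, OF c vs]) auto
        also have "\<dots> = poly_comb A (map (\<lambda>f. f mod \<phi>) (map ((*) a) (map2 (-) gs' fs'))) vs"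
          by (rule poly_comb_mod[OF A, symmetric])
        finally have "v \<in> poly_span d A vs"
          unfolding poly_span_def
        proof (rule image_eqI)
          have "f mod \<phi> \<in> polys_below d" for f
            using d0 d degree_mod_less'[of \<phi> f] by (cases "\<phi> = 0"; cases "f mod \<phi> = 0") (auto simp: polys_below_iff)
          then show "map (\<lambda>f. f mod \<phi>) (map ((*) a) (map2 (-) gs' fs')) \<in> tuples d (length vs)"
            using l by (auto simp: tuples_def)
        qed
        with nv show ?thesis by simp
      qed
    qed
  qed
qed

section \<open>Counting lists that are independent over the residue field\<close>

definition indep_lists :: "nat \<Rightarrow> nat \<Rightarrow> 'a::field mat \<Rightarrow> nat \<Rightarrow> 'a vec list set" where
  "indep_lists n d A m = {vs. set vs \<subseteq> carrier_vec n \<and> length vs = m \<and> poly_indep d A vs}"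

lemma finite_indep_lists: "finite (indep_lists n d A m :: 'a::{field,finite} vec list set)"
  by (rule finite_subset[OF _ finite_lists_length_eq[OF finite_carrier_vec[of n], of m]])
     (auto simp: indep_lists_def)

lemma card_poly_span:
  fixes A :: "'a::{field,finite} mat"
  assumes "poly_indep d A vs"
  shows "card (poly_span d A vs) = CARD('a) ^ (d * length vs)"
  using assms by (simp add: poly_span_def poly_indep_def card_image card_tuples)

lemma poly_span_subset: "A \<in> carrier_mat n n \<Longrightarrow> set vs \<subseteq> carrier_vec n \<Longrightarrow> poly_span d A vs \<subseteq> carrier_vec n"
  by (auto simp: poly_span_def poly_comb_carrier)

text \<open>Each new vector has to avoid the span of its predecessors, which has q^(d i) elements.
  Once q^(d i) reaches q^n the factor is 0, in agreement with truncated subtraction.\<close>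

lemma card_indep_lists:
  fixes \<phi> :: "'a::{field,finite} poly"
  assumes A: "A \<in> ann n \<phi>" and irr: "irreducible \<phi>" and d: "degree \<phi> = d"
  shows "card (indep_lists n d A m) = (\<Prod>i<m. CARD('a) ^ n - CARD('a) ^ (d * i))"
proof (induct m)
  case 0
  have "indep_lists n d A 0 = {[]}" by (auto simp: indep_lists_def poly_indep_def tuples_def inj_on_def)
  then show ?case by simp
next
  case (Suc m)
  let ?S = "SIGMA vs:indep_lists n d A m. carrier_vec n - poly_span d A vs"
  have eq: "indep_lists n d A (Suc m) = (\<lambda>(vs, v). v # vs) ` ?S"
  proof (intro equalityI subsetI)
    fix ws assume ws: "ws \<in> indep_lists n d A (Suc m)"
    then obtain v vs where e: "ws = v # vs" by (cases ws) (auto simp: indep_lists_def)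
    with ws have "(vs, v) \<in> ?S"
      using poly_indep_Cons_iff[OF A irr d, of v vs] by (auto simp: indep_lists_def)
    then show "ws \<in> (\<lambda>(vs, v). v # vs) ` ?S" unfolding e by force
  next
    fix ws assume "ws \<in> (\<lambda>(vs, v). v # vs) ` ?S"
    then obtain vs v where "ws = v # vs" "(vs, v) \<in> ?S" by auto
    then show "ws \<in> indep_lists n d A (Suc m)"
      using poly_indep_Cons_iff[OF A irr d, of v vs] by (auto simp: indep_lists_def)
  qed
  have "card (indep_lists n d A (Suc m)) = card ?S"
    unfolding eq by (rule card_image) (auto simp: inj_on_def)
  also have "\<dots> = (\<Sum>vs\<in>indep_lists n d A m. card (carrier_vec n - poly_span d A vs))"
    by (intro card_SigmaI) (auto intro: finite_indep_lists finite_carrier_vec)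
  also have "\<dots> = (\<Sum>vs\<in>indep_lists n d A m. CARD('a) ^ n - CARD('a) ^ (d * m))"
  proof (rule sum.cong[OF refl])
    fix vs assume vs: "vs \<in> indep_lists n d A m"
    have sub: "poly_span d A vs \<subseteq> carrier_vec n"
      using vs annD(1)[OF A] by (intro poly_span_subset) (auto simp: indep_lists_def)
    show "card (carrier_vec n - poly_span d A vs) = CARD('a) ^ n - CARD('a) ^ (d * m)"
      using vs card_Diff_subset[OF finite_subset[OF sub finite_carrier_vec] sub]
      by (simp add: card_carrier_vec card_poly_span indep_lists_def)
  qed
  finally show ?case by (simp add: Suc)
qed

text \<open>If the degree d does not divide n, no factor of the count of lists of length
  \<open>n div d + 1\<close> vanishes; but an independent list of that length would span more than
  q^n vectors.\<close>

lemma ann_nonempty_imp_dvd: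
  fixes \<phi> :: "'a::{field,finite} poly"
  assumes A: "A \<in> ann n \<phi>" and irr: "irreducible \<phi>"
  shows "degree \<phi> dvd n"
proof (rule ccontr)
  define d where "d = degree \<phi>"
  assume nd: "\<not> degree \<phi> dvd n"
  have d0: "d > 0" using irr unfolding d_def by (auto intro: irreducible_degree_pos)
  define m where "m = Suc (n div d)"
  have "d * i < n" if "i < m" for i
  proof -
    have "d * i \<le> d * (n div d)" using that by (simp add: m_def)
    also have "\<dots> \<le> n" by simp
    finally have "d * i \<le> n" .
    moreover have "d * i \<noteq> n" using nd by (auto simp: d_def)
    ultimately show ?thesis by simp
  qed
  then have "card (indep_lists n d A m) > 0"
    unfolding card_indep_lists[OF A irr d_def[symmetric]]
    using card_field_gt_1[where 'a='a] by (auto intro!: prod_pos)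
  then obtain vs where vs: "vs \<in> indep_lists n d A m" by (metis all_not_in_conv card.empty less_irrefl)
  then have "card (poly_span d A vs) \<le> card (carrier_vec n :: 'a vec set)"
    using annD(1)[OF A] by (intro card_mono finite_carrier_vec poly_span_subset) (auto simp: indep_lists_def)
  then have "CARD('a) ^ (d * m) \<le> CARD('a) ^ n" using vs
    by (simp add: indep_lists_def card_poly_span card_carrier_vec)
  then have "d * m \<le> n" using card_field_gt_1[where 'a='a] by simp
  moreover have "n < d * m" unfolding m_def using d0 by (simp add: dividend_less_times_div)
  ultimately show False by simp
qed

section \<open>Krylov matrices and the number of annihilated matrices\<close>

abbreviation mat_iter :: "'a::comm_ring_1 mat \<Rightarrow> nat \<Rightarrow> 'a vec \<Rightarrow> 'a vec" where
  "mat_iter A i v \<equiv> ((\<lambda>w. A *\<^sub>v w) ^^ i) v"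

lemma mat_iter_carrier [simp]:
  "A \<in> carrier_mat n n \<Longrightarrow> v \<in> carrier_vec n \<Longrightarrow> mat_iter A i v \<in> carrier_vec n"
  by (induct i) auto

lemma poly_mat_mult_vec_index:
  fixes A :: "'a::comm_ring_1 mat"
  assumes A: "A \<in> carrier_mat n n" and "v \<in> carrier_vec n" "f \<in> polys_below N" and r: "r < n"
  shows "(poly_mat f A *\<^sub>v v) $ r = (\<Sum>l<N. coeff f l * mat_iter A l v $ r)"
  using assms(2,3)
proof (induct N arbitrary: f v)
  case 0
  then have "poly_mat f A *\<^sub>v v = 0\<^sub>v n" using A by (auto simp: polys_below_0 intro!: eq_vecI)
  then show ?case using r by simp
next
  case (Suc N)
  from Suc(3) obtain a g where f: "f = pCons a g" and g: "g \<in> polys_below N"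
    by (auto simp: polys_below_Suc)
  note v = Suc(2)
  have c: "poly_mat g A \<in> carrier_mat n n" using A by simp
  have comm: "A * poly_mat g A = poly_mat g A * A" by (rule poly_mat_commute_gen[OF A A A refl])
  have "poly_mat f A *\<^sub>v v = (a \<cdot>\<^sub>m 1\<^sub>m n) *\<^sub>v v + (poly_mat g A * A) *\<^sub>v v"
    unfolding f poly_mat_pCons[OF A] comm
    by (rule add_mult_distrib_mat_vec[of _ n n]) (use A v c in auto)
  also have "(poly_mat g A * A) *\<^sub>v v = poly_mat g A *\<^sub>v (A *\<^sub>v v)"
    by (rule assoc_mult_mat_vec[OF c A v])
  also have "(a \<cdot>\<^sub>m 1\<^sub>m n) *\<^sub>v v = a \<cdot>\<^sub>v v"
    using v by (auto intro!: eq_vecI)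
  finally have "(poly_mat f A *\<^sub>v v) $ r = a * v $ r + (poly_mat g A *\<^sub>v (A *\<^sub>v v)) $ r"
    using A v r c by simp
  also have "(poly_mat g A *\<^sub>v (A *\<^sub>v v)) $ r = (\<Sum>l<N. coeff g l * mat_iter A l (A *\<^sub>v v) $ r)"
    by (rule Suc(1)) (use A v g in auto)
  finally show ?case
    by (simp add: f sum.lessThan_Suc_shift funpow_swap1 del: sum.lessThan_Suc)
qed

lemma poly_comb_index:
  assumes A: "A \<in> carrier_mat n n" and "set vs \<subseteq> carrier_vec n" "length fs = length vs" and r: "r < n"
  shows "poly_comb A fs vs $ r = (\<Sum>j<length vs. (poly_mat (fs ! j) A *\<^sub>v (vs ! j)) $ r)"
  using assms(2,3)
proof (induct vs arbitrary: fs)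
  case (Cons v vs)
  then obtain f fs' where fs: "fs = f # fs'" "length fs' = length vs" by (cases fs) auto
  have "dim_vec (poly_comb A fs' vs) = n"
    using poly_comb_carrier[OF A, of vs fs'] Cons(2) by auto
  then show ?case using Cons fs A r
    by (simp add: sum.lessThan_Suc_shift del: sum.lessThan_Suc)
qed (use A r in auto)

lemma sum_lessThan_mult:
  fixes F :: "nat \<Rightarrow> 'a::comm_monoid_add"
  shows "(\<Sum>c<m * d. F c) = (\<Sum>j<m. \<Sum>i<d. F (j * d + i))"
proof -
  have "(\<Sum>i<d. F (j * d + i)) = sum F {j * d..<j * d + d}" for j
    by (rule sum.reindex_bij_witness[of _ "\<lambda>c. c - j * d" "\<lambda>i. j * d + i"]) auto
  then show ?thesis by (simp add: sum.nat_group)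
qed

text \<open>Column \<open>j * d + i\<close> is the i-th iterate of \<open>vs ! j\<close> under
  \<open>A\<close>. This is the matrix of \<open>poly_comb\<close> in the coordinates given by the
  coefficients of the polynomials.\<close>

definition krylov :: "nat \<Rightarrow> nat \<Rightarrow> 'a::comm_ring_1 mat \<Rightarrow> 'a vec list \<Rightarrow> 'a mat" where
  "krylov n d A vs = mat n n (\<lambda>(r, c). mat_iter A (c mod d) (vs ! (c div d)) $ r)"

lemma krylov_carrier [simp]: "krylov n d A vs \<in> carrier_mat n n"
  by (simp add: krylov_def)

text \<open>Cuts a coordinate vector into \<open>m\<close> coefficient lists of length
  \<open>d\<close>, in the column order of \<open>krylov\<close>. On vectors of length
  \<open>m * d\<close> it is a bijection onto \<open>tuples d m\<close>.\<close>

definition vec_tuple :: "nat \<Rightarrow> nat \<Rightarrow> 'a::zero vec \<Rightarrow> 'a poly list" where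
  "vec_tuple d m x = map (\<lambda>j. Poly (map (\<lambda>i. x $ (j * d + i)) [0..<d])) [0..<m]"

lemma coeff_vec_tuple:
  "j < m \<Longrightarrow> coeff (vec_tuple d m x ! j) i = (if i < d then x $ (j * d + i) else 0)"
  by (simp add: vec_tuple_def coeff_Poly_eq nth_default_def)

lemma vec_tuple_in_tuples: "vec_tuple d m x \<in> tuples d m"
  by (auto simp: vec_tuple_def tuples_def polys_below_def coeff_Poly_eq nth_default_def)

lemma div_mult_add_less:
  fixes i j d m :: nat
  assumes "i < d" "j < m" shows "j * d + i < m * d"
proof -
  have "j * d + i < Suc j * d" using assms by simp
  also have "\<dots> \<le> m * d" using assms by (intro mult_right_mono) auto
  finally show ?thesis .
qed

lemma vec_tuple_inj:
  assumes "vec_tuple d m x = vec_tuple d m y" "x \<in> carrier_vec (m * d)" "y \<in> carrier_vec (m * d)"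
  shows "x = y"
proof (rule eq_vecI)
  fix c assume "c < dim_vec y"
  then have c: "c < m * d" using assms by simp
  then have d: "d > 0" by (cases d) auto
  have j: "c div d < m" using c d by (simp add: less_mult_imp_div_less)
  show "x $ c = y $ c"
    using coeff_vec_tuple[OF j, of d x "c mod d"] coeff_vec_tuple[OF j, of d y "c mod d"] assms(1) d by simp
qed (use assms in auto)

lemma vec_tuple_surj:
  assumes "fs \<in> tuples d m"
  obtains x where "x \<in> carrier_vec (m * d)" "fs = vec_tuple d m x"
proof (rule that[of "vec (m * d) (\<lambda>c. coeff (fs ! (c div d)) (c mod d))"])
  let ?x = "vec (m * d) (\<lambda>c. coeff (fs ! (c div d)) (c mod d))"
  have l: "length fs = m" using assms by (simp add: tuples_def)
  show "fs = vec_tuple d m ?x"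
  proof (rule nth_equalityI)
    fix j assume "j < length fs"
    then have j: "j < m" using l by simp
    have "fs ! j \<in> polys_below d" using assms j by (auto simp: tuples_def)
    then show "fs ! j = vec_tuple d m ?x ! j"
      using j div_mult_add_less[of _ d j m] by (intro poly_eqI) (auto simp: coeff_vec_tuple polys_below_def)
  qed (simp add: l vec_tuple_def)
qed simp

lemma krylov_mult_vec:
  fixes A :: "'a::comm_ring_1 mat"
  assumes A: "A \<in> carrier_mat n n" and vs: "set vs \<subseteq> carrier_vec n" "length vs = m"
    and n: "n = m * d" and x: "x \<in> carrier_vec n"
  shows "krylov n d A vs *\<^sub>v x = poly_comb A (vec_tuple d m x) vs"
proof (rule eq_vecI)
  show "dim_vec (krylov n d A vs *\<^sub>v x) = dim_vec (poly_comb A (vec_tuple d m x) vs)"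
    using poly_comb_carrier[OF A vs(1), of "vec_tuple d m x"] by (auto simp: krylov_def)
  fix r assume "r < dim_vec (poly_comb A (vec_tuple d m x) vs)"
  then have r: "r < n" using poly_comb_carrier[OF A vs(1), of "vec_tuple d m x"] by auto
  have "(krylov n d A vs *\<^sub>v x) $ r = (\<Sum>c<m * d. mat_iter A (c mod d) (vs ! (c div d)) $ r * x $ c)"
    using r x n by (simp add: krylov_def scalar_prod_def lessThan_atLeast0)
  also have "\<dots> = (\<Sum>j<m. \<Sum>i<d. mat_iter A i (vs ! j) $ r * x $ (j * d + i))"
    unfolding sum_lessThan_mult by (intro sum.cong) auto
  also have "\<dots> = (\<Sum>j<m. (poly_mat (vec_tuple d m x ! j) A *\<^sub>v (vs ! j)) $ r)"
  proof (rule sum.cong[OF refl])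
    fix j assume "j \<in> {..<m}"
    then have j: "j < m" by simp
    have "(poly_mat (vec_tuple d m x ! j) A *\<^sub>v (vs ! j)) $ r =
        (\<Sum>i<d. coeff (vec_tuple d m x ! j) i * mat_iter A i (vs ! j) $ r)"
      using vec_tuple_in_tuples[of d m x] j vs r by (intro poly_mat_mult_vec_index[OF A]) (auto simp: tuples_def)
    then show "(\<Sum>i<d. mat_iter A i (vs ! j) $ r * x $ (j * d + i)) = (poly_mat (vec_tuple d m x ! j) A *\<^sub>v (vs ! j)) $ r"
      by (simp add: coeff_vec_tuple[OF j] mult.commute)
  qed
  also have "\<dots> = poly_comb A (vec_tuple d m x) vs $ r"
    using poly_comb_index[OF A vs(1) _ r] vs(2) by (simp add: vec_tuple_def)
  finally show "(krylov n d A vs *\<^sub>v x) $ r = poly_comb A (vec_tuple d m x) vs $ r" .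
qed

text \<open>The Krylov matrix carries coordinate vectors to combinations, so independence of
  \<open>m\<close> vectors over the residue field becomes invertibility of a single matrix over the
  base field.\<close>

lemma poly_indep_iff_krylov:
  fixes A :: "'a::field mat"
  assumes A: "A \<in> carrier_mat n n" and vs: "set vs \<subseteq> carrier_vec n" "length vs = m" and n: "n = m * d"
  shows "poly_indep d A vs \<longleftrightarrow> krylov n d A vs \<in> GL n"
proof
  let ?K = "krylov n d A vs"
  note K = krylov_mult_vec[OF A vs n]
  assume ind: "poly_indep d A vs"
  show "?K \<in> GL n"
  proof (rule ccontr)
    assume "?K \<notin> GL n"
    then have "det ?K = 0" by (simp add: GL_def)
    then obtain x where x: "x \<in> carrier_vec n" "x \<noteq> 0\<^sub>v n" "?K *\<^sub>v x = 0\<^sub>v n"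
      using det_0_iff_vec_prod_zero_field[OF krylov_carrier] by blast
    have "?K *\<^sub>v x = ?K *\<^sub>v 0\<^sub>v n" using x by (auto intro!: eq_vecI simp: krylov_def)
    then have "poly_comb A (vec_tuple d m x) vs = poly_comb A (vec_tuple d m (0\<^sub>v n)) vs"
      using x(1) by (simp add: K)
    from inj_onD[OF ind[unfolded poly_indep_def] this] have "vec_tuple d m x = vec_tuple d m (0\<^sub>v n)"
      using vec_tuple_in_tuples vs by blast
    from vec_tuple_inj[OF this] x n show False by simp
  qed
next
  let ?K = "krylov n d A vs"
  note K = krylov_mult_vec[OF A vs n]
  assume GL: "?K \<in> GL n"
  note i = mat_inv[OF GL]
  show "poly_indep d A vs" unfolding poly_indep_def vs(2)
  proof (rule inj_onI)
    fix fs gs assume fg: "fs \<in> tuples d m" "gs \<in> tuples d m" and eq: "poly_comb A fs vs = poly_comb A gs vs"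
    from vec_tuple_surj[OF fg(1)] obtain x where x: "x \<in> carrier_vec n" "fs = vec_tuple d m x" unfolding n .
    from vec_tuple_surj[OF fg(2)] obtain y where y: "y \<in> carrier_vec n" "gs = vec_tuple d m y" unfolding n .
    have "?K *\<^sub>v x = ?K *\<^sub>v y" using eq x y by (simp add: K)
    then have "mat_inv ?K *\<^sub>v (?K *\<^sub>v x) = mat_inv ?K *\<^sub>v (?K *\<^sub>v y)" by simp
    then have "(mat_inv ?K * ?K) *\<^sub>v x = (mat_inv ?K * ?K) *\<^sub>v y"
      using assoc_mult_mat_vec[OF i(4) krylov_carrier] x y by simp
    then show "fs = gs" using x y i by simp
  qed
qed

text \<open>For monic \<open>\<phi>\<close> this is \<open>P\<close> times a block diagonal matrix
  of companion matrices: each column moves to the next one of its block, and the last one is reduced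
  by \<open>\<phi>\<close>. It expresses \<open>A * P\<close> through \<open>P\<close> alone, which
  lets \<open>A\<close> be recovered from \<open>P\<close>.\<close>

definition krylov_shift :: "nat \<Rightarrow> 'a::comm_ring_1 poly \<Rightarrow> 'a mat \<Rightarrow> 'a mat" where
  "krylov_shift n \<phi> P = mat n n (\<lambda>(r, c). if Suc (c mod degree \<phi>) < degree \<phi> then P $$ (r, Suc c)
     else - (\<Sum>l<degree \<phi>. coeff \<phi> l * P $$ (r, c div degree \<phi> * degree \<phi> + l)))"

lemma mult_krylov:
  fixes \<phi> :: "'a::field poly"
  assumes A: "A \<in> carrier_mat n n" and vs: "set vs \<subseteq> carrier_vec n" "length vs = m"
    and mon: "coeff \<phi> (degree \<phi>) = 1" and d: "degree \<phi> > 0" and n: "n = m * degree \<phi>"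
    and ann: "\<And>j. j < m \<Longrightarrow> poly_mat \<phi> A *\<^sub>v (vs ! j) = 0\<^sub>v n"
  shows "A * krylov n (degree \<phi>) A vs = krylov_shift n \<phi> (krylov n (degree \<phi>) A vs)"
proof (rule eq_matI)
  let ?d = "degree \<phi>"
  let ?K = "krylov n ?d A vs"
  fix r c assume "r < dim_row (krylov_shift n \<phi> ?K)" "c < dim_col (krylov_shift n \<phi> ?K)"
  then have r: "r < n" and c: "c < n" by (auto simp: krylov_shift_def)
  define j where "j = c div ?d"
  define i where "i = c mod ?d"
  have i: "i < ?d" and j: "j < m" using d c n by (auto simp: i_def j_def less_mult_imp_div_less)
  have ceq: "c = j * ?d + i" by (simp add: i_def j_def)
  have v: "vs ! j \<in> carrier_vec n" using vs j by auto
  have idx: "j * ?d + l < n" if "l < ?d" for l using div_mult_add_less[OF that j] n by simp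
  have K: "?K $$ (r, j * ?d + l) = mat_iter A l (vs ! j) $ r" if "l < ?d" "r < n" for l r
    using that idx[OF that(1)] by (simp add: krylov_def)
  have "col ?K c = mat_iter A i (vs ! j)"
    using c mat_iter_carrier[OF A v, of i] by (intro eq_vecI) (auto simp: krylov_def i_def j_def)
  then have "(A * ?K) $$ (r, c) = mat_iter A (Suc i) (vs ! j) $ r"
    using A r c by (simp add: krylov_def)
  also have "\<dots> = krylov_shift n \<phi> ?K $$ (r, c)"
  proof (cases "Suc i < ?d")
    case True
    then show ?thesis using r c K[OF True r] by (simp add: krylov_shift_def i_def[symmetric]) (simp add: ceq)
  next
    case False
    then have di: "Suc i = ?d" using i by simp
    have "0 = (poly_mat \<phi> A *\<^sub>v (vs ! j)) $ r" using ann[OF j] r by simp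
    also have "\<dots> = (\<Sum>l<Suc ?d. coeff \<phi> l * mat_iter A l (vs ! j) $ r)"
      by (rule poly_mat_mult_vec_index[OF A v _ r]) (auto simp: polys_below_def intro: coeff_eq_0)
    finally have "mat_iter A ?d (vs ! j) $ r = - (\<Sum>l<?d. coeff \<phi> l * mat_iter A l (vs ! j) $ r)"
      using mon by (simp add: eq_neg_iff_add_eq_0 add.commute)
    also have "(\<Sum>l<?d. coeff \<phi> l * mat_iter A l (vs ! j) $ r) = (\<Sum>l<?d. coeff \<phi> l * ?K $$ (r, j * ?d + l))"
      using r by (intro sum.cong) (auto simp: K)
    finally show ?thesis using r c False di
      by (simp add: krylov_shift_def i_def[symmetric] j_def[symmetric] del: funpow.simps)
  qed
  finally show "(A * ?K) $$ (r, c) = krylov_shift n \<phi> ?K $$ (r, c)" .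
qed (use A in \<open>auto simp: krylov_def krylov_shift_def\<close>)

text \<open>A basis of \<open>K\<^sup>n\<close> can be read, in exactly one way, as \<open>A\<^sup>i v\<^sub>j\<close> with \<open>i < degree \<phi>\<close>.\<close>

lemma bij_betw_krylov:
  fixes \<phi> :: "'a::field poly"
  assumes irr: "irreducible \<phi>" and mon: "coeff \<phi> (degree \<phi>) = 1" and n: "n = m * degree \<phi>"
  shows "bij_betw (\<lambda>(A, vs). krylov n (degree \<phi>) A vs)
    (SIGMA A:ann n \<phi>. indep_lists n (degree \<phi>) A m) (GL n)"
proof (rule bij_betwI)
  let ?d = "degree \<phi>"
  have d: "?d > 0" using irr by (rule irreducible_degree_pos)
  let ?G = "\<lambda>P. (krylov_shift n \<phi> P * mat_inv P, map (\<lambda>j. col P (j * ?d)) [0..<m])"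
  let ?S = "SIGMA A:ann n \<phi>. indep_lists n ?d A m"
  show "(\<lambda>(A, vs). krylov n ?d A vs) \<in> ?S \<rightarrow> GL n"
    using poly_indep_iff_krylov[OF annD(1) _ _ n] by (auto simp: indep_lists_def)
  have cs: "krylov_shift n \<phi> P \<in> carrier_mat n n" for P by (simp add: krylov_shift_def)
  show "?G (case x of (A, vs) \<Rightarrow> krylov n ?d A vs) = x" if x: "x \<in> ?S" for x
  proof -
    obtain A vs where e: "x = (A, vs)" and A: "A \<in> ann n \<phi>" and vs: "vs \<in> indep_lists n ?d A m"
      using x by auto
    note cA = annD(1)[OF A]
    have vs': "set vs \<subseteq> carrier_vec n" "length vs = m" "poly_indep ?d A vs" using vs by (auto simp: indep_lists_def)
    let ?K = "krylov n ?d A vs"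
    have K: "?K \<in> GL n" using poly_indep_iff_krylov[OF cA vs'(1,2) n] vs'(3) by simp
    have "A * ?K = krylov_shift n \<phi> ?K"
    proof (rule mult_krylov[OF cA vs'(1,2) mon d n])
      fix j assume "j < m"
      then have "vs ! j \<in> carrier_vec n" using vs' by auto
      then show "poly_mat \<phi> A *\<^sub>v (vs ! j) = 0\<^sub>v n" unfolding annD(2)[OF A] by (auto intro!: eq_vecI)
    qed
    then have "krylov_shift n \<phi> ?K * mat_inv ?K = A * ?K * mat_inv ?K" by simp
    also have "\<dots> = A * (?K * mat_inv ?K)" using cA mat_inv(4)[OF K] by (intro assoc_mult_mat) auto
    also have "\<dots> = A" using cA mat_inv[OF K] by simp
    finally have 1: "krylov_shift n \<phi> ?K * mat_inv ?K = A" .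
    have "map (\<lambda>j. col ?K (j * ?d)) [0..<m] = vs"
    proof (rule nth_equalityI)
      fix j assume "j < length (map (\<lambda>j. col ?K (j * ?d)) [0..<m])"
      then have j: "j < m" by simp
      have "vs ! j \<in> carrier_vec n" using j vs' by auto
      then show "map (\<lambda>j. col ?K (j * ?d)) [0..<m] ! j = vs ! j"
        using j d div_mult_add_less[OF d j] n by (auto simp: krylov_def intro!: eq_vecI)
    qed (simp add: vs')
    with 1 show ?thesis by (simp add: e)
  qed
  \<comment> \<open>An invertible \<open>P\<close> determines \<open>A\<close> through
    \<open>A * P = krylov_shift n \<phi> P\<close>; the columns of each block are then the iterates
    of its first column under \<open>A\<close>.\<close>
  have main: "?G P \<in> ?S \<and> (case ?G P of (A, vs) \<Rightarrow> krylov n ?d A vs) = P" if P: "P \<in> GL n" for P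
  proof -
    note cP = GL_carrier[OF P] and iP = mat_inv[OF P]
    define A where "A = krylov_shift n \<phi> P * mat_inv P"
    define vs where "vs = map (\<lambda>j. col P (j * ?d)) [0..<m]"
    have cA: "A \<in> carrier_mat n n" unfolding A_def by (rule mult_carrier_mat[OF cs iP(4)])
    have vs': "set vs \<subseteq> carrier_vec n" "length vs = m" using cP by (auto simp: vs_def)
    have "A * P = krylov_shift n \<phi> P * (mat_inv P * P)" unfolding A_def using cs iP cP by (intro assoc_mult_mat) auto
    then have AP: "A * P = krylov_shift n \<phi> P" using iP right_mult_one_mat[OF cs[of P]] by simp
    have idx: "j * ?d + l < n" if "l < ?d" "j < m" for l j using div_mult_add_less[OF that] n by simp
    have Acol: "A *\<^sub>v col P c = col (krylov_shift n \<phi> P) c" if "c < n" for c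
      using col_mult2[OF cA cP that] AP by simp
    have iter: "mat_iter A i (vs ! j) = col P (j * ?d + i)" if "i < ?d" "j < m" for i j
      using that(1)
    proof (induct i)
      case 0
      then show ?case using that by (simp add: vs_def)
    next
      case (Suc i)
      then have "mat_iter A (Suc i) (vs ! j) = col (krylov_shift n \<phi> P) (j * ?d + i)"
        using idx[of i j] that(2) by (simp add: Acol)
      also have "\<dots> = col P (j * ?d + Suc i)"
        using Suc(2) idx[of i j] idx[of "Suc i" j] that(2) cP by (intro eq_vecI) (auto simp: krylov_shift_def)
      finally show ?case .
    qed
    have iterd: "mat_iter A ?d (vs ! j) $ r = - (\<Sum>l<?d. coeff \<phi> l * P $$ (r, j * ?d + l))"
      if j: "j < m" and r: "r < n" for j r
    proof -
      let ?e = "?d - 1"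
      have e: "?e < ?d" "Suc ?e = ?d" using d by auto
      have "mat_iter A (Suc ?e) (vs ! j) = A *\<^sub>v col P (j * ?d + ?e)" using iter[OF e(1) j] by simp
      also have "\<dots> = col (krylov_shift n \<phi> P) (j * ?d + ?e)" by (rule Acol[OF idx[OF e(1) j]])
      finally have "mat_iter A ?d (vs ! j) = col (krylov_shift n \<phi> P) (j * ?d + ?e)" unfolding e .
      moreover have "(j * ?d + ?e) mod ?d = ?e"
        unfolding mod_mult_self3 using e(1) by (rule mod_less)
      moreover have "(j * ?d + ?e) div ?d = j"
        using d by (simp only: div_mult_self3 div_less[OF e(1)] add_0_right)
      ultimately show ?thesis using r idx[OF e(1) j] e by (simp add: krylov_shift_def)
    qed
    have annv: "poly_mat \<phi> A *\<^sub>v (vs ! j) = 0\<^sub>v n" if j: "j < m" for j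
    proof (rule eq_vecI)
      fix r assume "r < dim_vec (0\<^sub>v n)"
      then have r: "r < n" by simp
      have v: "vs ! j \<in> carrier_vec n" using vs' j by auto
      have "(poly_mat \<phi> A *\<^sub>v (vs ! j)) $ r = (\<Sum>l<Suc ?d. coeff \<phi> l * mat_iter A l (vs ! j) $ r)"
        by (rule poly_mat_mult_vec_index[OF cA v _ r]) (auto simp: polys_below_def intro: coeff_eq_0)
      also have "\<dots> = (\<Sum>l<?d. coeff \<phi> l * mat_iter A l (vs ! j) $ r) + mat_iter A ?d (vs ! j) $ r"
        using mon by simp
      also have "(\<Sum>l<?d. coeff \<phi> l * mat_iter A l (vs ! j) $ r) = (\<Sum>l<?d. coeff \<phi> l * P $$ (r, j * ?d + l))"
        using r j cP idx[OF _ j] by (intro sum.cong) (auto simp: iter)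
      finally show "(poly_mat \<phi> A *\<^sub>v (vs ! j)) $ r = 0\<^sub>v n $ r" using iterd[OF j r] r by simp
    qed (use cA in simp)
    have KP: "krylov n ?d A vs = P"
    proof (rule eq_matI)
      fix r c assume "r < dim_row P" "c < dim_col P"
      then have rc: "r < n" "c < n" using cP by auto
      have "c div ?d < m" "c mod ?d < ?d" using rc n d by (auto simp: less_mult_imp_div_less)
      from iter[OF this(2,1)] show "krylov n ?d A vs $$ (r, c) = P $$ (r, c)"
        using rc cP by (simp add: krylov_def)
    qed (use cP in \<open>auto simp: krylov_def\<close>)
    have "poly_mat \<phi> A * P = 0\<^sub>m n n"
    proof (rule eq_matI)
      fix r c assume "r < dim_row (0\<^sub>m n n :: 'a mat)" "c < dim_col (0\<^sub>m n n :: 'a mat)"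
      then have rc: "r < n" "c < n" by auto
      define j where "j = c div ?d"
      have j: "j < m" "c mod ?d < ?d" using rc n d by (auto simp: j_def less_mult_imp_div_less)
      have v: "vs ! j \<in> carrier_vec n" using vs' j by auto
      have cm: "poly_mat \<phi> A \<in> carrier_mat n n" using cA by simp
      \<comment> \<open>\<open>poly_mat \<phi> A\<close> commutes with \<open>A\<close>, so it kills
        not only \<open>vs ! j\<close> but all iterates, that is, every column of
        \<open>P\<close>.\<close>
      have "poly_mat \<phi> A *\<^sub>v mat_iter A i (vs ! j) = 0\<^sub>v n" for i
      proof (induct i)
        case 0
        then show ?case using annv[OF j(1)] by simp
      next
        case (Suc i)
        have c: "mat_iter A i (vs ! j) \<in> carrier_vec n" using cA v by simp
        have "poly_mat \<phi> A *\<^sub>v (A *\<^sub>v mat_iter A i (vs ! j)) = (poly_mat \<phi> A * A) *\<^sub>v mat_iter A i (vs ! j)"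
          by (rule assoc_mult_mat_vec[symmetric, OF cm cA c])
        also have "poly_mat \<phi> A * A = A * poly_mat \<phi> A" by (rule poly_mat_commute_gen[OF cA cA cA refl, symmetric])
        also have "(A * poly_mat \<phi> A) *\<^sub>v mat_iter A i (vs ! j) = A *\<^sub>v (poly_mat \<phi> A *\<^sub>v mat_iter A i (vs ! j))"
          by (rule assoc_mult_mat_vec[OF cA cm c])
        also have "\<dots> = 0\<^sub>v n" unfolding Suc using cA by (auto intro!: eq_vecI)
        finally show ?case by simp
      qed
      moreover have "col P c = mat_iter A (c mod ?d) (vs ! j)" using iter[OF j(2,1)] by (simp add: j_def)
      ultimately have "poly_mat \<phi> A *\<^sub>v col P c = 0\<^sub>v n" by simp
      then have "col (poly_mat \<phi> A * P) c = 0\<^sub>v n" using col_mult2[OF cm cP rc(2)] by simp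
      from arg_cong[OF this, of "\<lambda>w. w $ r"] show "(poly_mat \<phi> A * P) $$ (r, c) = 0\<^sub>m n n $$ (r, c)"
        using rc cA cP by simp
    qed (use cA cP in auto)
    then have "poly_mat \<phi> A * P * mat_inv P = 0\<^sub>m n n" using iP by simp
    moreover have "poly_mat \<phi> A * P * mat_inv P = poly_mat \<phi> A * (P * mat_inv P)"
      using cA cP iP by (intro assoc_mult_mat) auto
    ultimately have "poly_mat \<phi> A = 0\<^sub>m n n" using iP right_mult_one_mat[OF poly_mat_carrier[OF cA, of \<phi>]] by simp
    then have A: "A \<in> ann n \<phi>" using cA by (simp add: ann_def)
    have "poly_indep ?d A vs" using poly_indep_iff_krylov[OF cA vs' n] KP P by simp
    then have "vs \<in> indep_lists n ?d A m" using vs' by (simp add: indep_lists_def)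
    with A KP show ?thesis by (simp add: A_def[symmetric] vs_def[symmetric])
  qed
  show "?G \<in> GL n \<rightarrow> ?S" using main by (intro Pi_I) blast
  show "(case ?G P of (A, vs) \<Rightarrow> krylov n ?d A vs) = P" if "P \<in> GL n" for P using main[OF that] by blast
qed

lemma card_ann_irreducible_mult:
  fixes \<phi> :: "'a::{field,finite} poly"
  assumes irr: "irreducible \<phi>" and mon: "coeff \<phi> (degree \<phi>) = 1" and n: "n = m * degree \<phi>"
  shows "card (ann n \<phi>) * (\<Prod>i<m. CARD('a) ^ n - CARD('a) ^ (degree \<phi> * i)) = card (GL n :: 'a mat set)"
proof -
  have "card (GL n :: 'a mat set) = card (SIGMA A:ann n \<phi>. indep_lists n (degree \<phi>) A m)"
    by (rule bij_betw_same_card[OF bij_betw_krylov[OF assms], symmetric])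
  also have "\<dots> = (\<Sum>A\<in>ann n \<phi>. card (indep_lists n (degree \<phi>) A m))"
    by (intro card_SigmaI) (auto intro: finite_ann finite_indep_lists)
  also have "\<dots> = card (ann n \<phi>) * (\<Prod>i<m. CARD('a) ^ n - CARD('a) ^ (degree \<phi> * i))"
    by (simp add: card_indep_lists[OF _ irr refl])
  finally show ?thesis by simp
qed

text \<open>The order of the general linear group of rank \<open>m\<close> over a field with
  \<open>Q\<close> elements. Since \<open>Q\<close> is a number, the residue field with q^d elements
  enters only through its size.\<close>

definition gl_order :: "nat \<Rightarrow> nat \<Rightarrow> nat" where
  "gl_order Q m = (\<Prod>i<m. Q ^ m - Q ^ i)"

text \<open>The case \<open>\<phi>\<close> = X of the preceding count: only the zero matrix is
  annihilated by X.\<close>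

lemma card_GL: "card (GL n :: 'a::{field,finite} mat set) = gl_order CARD('a) n"
proof -
  let ?x = "[:0, 1:] :: 'a poly"
  have "irreducible ?x" by (rule irreducible_linear_field_poly) simp
  moreover have "ann n ?x = {0\<^sub>m n n}"
  proof -
    have "poly_mat ?x A = A" if "A \<in> carrier_mat n n" for A :: "'a mat"
      using that by (auto simp: poly_mat_pCons intro!: eq_matI)
    then show ?thesis by (auto simp: ann_def)
  qed
  ultimately show ?thesis
    using card_ann_irreducible_mult[of ?x n n] by (simp add: gl_order_def)
qed

lemma card_ann_irreducible:
  fixes \<phi> :: "'a::{field,finite} poly"
  assumes irr: "irreducible \<phi>" and mon: "coeff \<phi> (degree \<phi>) = 1"
  shows "real (card (ann n \<phi>)) / card (GL n :: 'a mat set) =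
    (if degree \<phi> dvd n then 1 / real (gl_order (CARD('a) ^ degree \<phi>) (n div degree \<phi>)) else 0)"
proof (cases "degree \<phi> dvd n")
  case True
  then obtain m where n: "n = m * degree \<phi>" by (metis dvdE mult.commute)
  have d: "degree \<phi> > 0" using irr by (rule irreducible_degree_pos)
  have "card (ann n \<phi>) * gl_order (CARD('a) ^ degree \<phi>) m = card (GL n :: 'a mat set)"
    using card_ann_irreducible_mult[OF assms n] by (simp add: gl_order_def n power_mult[symmetric] mult.commute)
  moreover from this have "gl_order (CARD('a) ^ degree \<phi>) m > 0"
    using card_GL_pos[where 'a='a and n=n] by (metis mult_is_0 not_gr0)
  ultimately show ?thesis
    using True d card_GL_pos[where 'a='a and n=n]
    by (simp add: n field_simps flip: of_nat_mult)
next
  case False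
  then have "ann n \<phi> = {}" using ann_nonempty_imp_dvd[OF _ irr] by blast
  then show ?thesis using False by simp
qed

subsection \<open>Semisimplicity and squarefree annihilators\<close>

definition monic_irreducible :: "'a::field poly \<Rightarrow> bool" where
  "monic_irreducible \<phi> \<longleftrightarrow> irreducible \<phi> \<and> lead_coeff \<phi> = 1"

lemma monic_irreducible_dvd_imp_eq:
  assumes "monic_irreducible \<phi>" "monic_irreducible \<psi>" "\<phi> dvd \<psi>"
  shows "\<phi> = \<psi>"
proof -
  from assms(3) obtain c where c: "\<psi> = \<phi> * c" by (rule dvdE)
  have "\<not> is_unit \<phi>" using assms(1) unfolding monic_irreducible_def by (intro irreducible_not_unit) blast
  then have "is_unit c" using assms(2) c Factorial_Ring.irreducibleD[of \<psi> \<phi> c] by (auto simp: monic_irreducible_def)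
  then have "degree c = 0" by auto
  then obtain k where k: "c = [:k:]" by (rule degree_eq_zeroE)
  have "lead_coeff \<psi> = lead_coeff \<phi> * lead_coeff c" unfolding c by (rule lead_coeff_mult)
  then have "k = 1" using assms k by (simp add: monic_irreducible_def)
  then show ?thesis using c k by (simp add: one_pCons[symmetric])
qed

lemma prod_monic_irreducible_not_dvd:
  assumes "finite S" "\<forall>\<psi>\<in>S. monic_irreducible \<psi>" "monic_irreducible \<phi>" "\<phi> \<notin> S"
  shows "\<not> \<phi> dvd \<Prod>S"
  using assms(1,2,4)
proof (induct S rule: finite_induct)
  case empty
  have "\<not> is_unit \<phi>" using assms(3) unfolding monic_irreducible_def by (intro irreducible_not_unit) blast
  then show ?case unfolding prod.empty .
next
  case (insert \<psi> S)
  have "prime_elem \<phi>" using assms(3) by (auto simp: monic_irreducible_def intro: field_poly_irreducible_imp_prime)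
  moreover have "\<not> \<phi> dvd \<psi>" using insert monic_irreducible_dvd_imp_eq[OF assms(3), of \<psi>] by auto
  ultimately show ?case using insert by (auto dest: prime_elem_dvd_multD)
qed

lemma prod_monic_irreducible_dvd:
  assumes "finite S" "\<forall>\<psi>\<in>S. monic_irreducible \<psi>" "\<forall>\<psi>\<in>S. \<psi> dvd f"
  shows "\<Prod>S dvd f"
  using assms
proof (induct S rule: finite_induct)
  case (insert \<psi> S)
  then obtain g where g: "f = \<Prod>S * g" by auto
  have "prime_elem \<psi>" using insert by (auto simp: monic_irreducible_def intro: field_poly_irreducible_imp_prime)
  moreover have "\<psi> dvd \<Prod>S * g" using insert g by auto
  ultimately have "\<psi> dvd g"
    using prod_monic_irreducible_not_dvd[of S \<psi>] insert by (auto dest: prime_elem_dvd_multD)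
  then show ?case using insert g by (simp add: mult.commute mult_dvd_mono)
qed auto

lemma prod_monic_irreducible_dvd_power:
  assumes "finite S" "\<forall>\<psi>\<in>S. monic_irreducible \<psi>" "\<Prod>S dvd f ^ k"
  shows "\<Prod>S dvd f"
proof (rule prod_monic_irreducible_dvd[OF assms(1,2)], rule ballI)
  fix \<psi> assume psi: "\<psi> \<in> S"
  then have "\<psi> dvd f ^ k" using assms(1,3) by (meson dvd_prod_eqI comm_monoid_mult_class.dvd_trans)
  moreover have "prime_elem \<psi>" using psi assms by (auto simp: monic_irreducible_def intro: field_poly_irreducible_imp_prime)
  ultimately show "\<psi> dvd f" using prime_elem_dvd_power by blast
qed

lemma coprime_prod_monic_irreducible:
  assumes "finite S" "\<forall>\<psi>\<in>S. monic_irreducible \<psi>" "monic_irreducible \<phi>" "\<phi> \<notin> S"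
  shows "coprime (\<Prod>S) \<phi>"
  using irreducible_imp_coprime_field_poly[of \<phi> "\<Prod>S"] prod_monic_irreducible_not_dvd[OF assms] assms(3)
  by (simp add: monic_irreducible_def coprime_commute)

text \<open>Pigeonhole on the powers \<open>X\<^bsup>p\<^sup>i\<^esup>\<close> modulo \<open>m\<close>; two of them agree, and the iterated
  Frobenius map can be undone because \<open>m\<close> is squarefree.\<close>

lemma squarefree_dvd_power_CHAR_minus:
  fixes m :: "'a::{field,finite} poly"
  assumes m: "m \<noteq> 0" and sqf: "\<And>f k. m dvd f ^ k \<Longrightarrow> m dvd f"
  obtains K where "K > 0" "m dvd monom 1 (CHAR('a) ^ K) - monom 1 1"
proof -
  let ?p = "CHAR('a)"
  have p: "prime ?p" using finite_imp_CHAR_pos[where 'a='a] by (intro prime_CHAR_semidom) auto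
  have pp: "prime CHAR('a poly)" using p by (simp add: semiring_char_poly)
  define g where "g i = monom (1::'a) (?p ^ i) mod m" for i
  have "g i \<in> polys_below (Suc (degree m))" for i
    using degree_mod_less[OF m, of "monom 1 (?p ^ i)"] by (auto simp: g_def polys_below_iff)
  then have "finite (range g)" by (intro finite_subset[OF _ finite_polys_below]) auto
  then have "\<not> inj g" using finite_imageD by blast
  then obtain i j where "i \<noteq> j" "g i = g j" unfolding inj_def by blast
  then obtain i j where ij: "i < j" "g i = g j" by (cases i j rule: linorder_cases) auto
  define K where "K = j - i"
  have K: "K > 0" "?p ^ j = ?p ^ K * ?p ^ i" using ij by (auto simp: K_def power_add[symmetric])
  let ?x = "monom (1::'a) 1"
  let ?f = "monom (1::'a) (?p ^ K) - ?x"
  have "m dvd monom 1 (?p ^ j) - monom 1 (?p ^ i)"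
    using ij(2) by (simp add: g_def mod_eq_dvd_iff[symmetric])
  also have "monom (1::'a) (?p ^ j) = (?f + ?x) ^ (?p ^ i)"
    by (simp add: monom_power K(2) mult.commute)
  also have "\<dots> = ?f ^ (?p ^ i) + ?x ^ (?p ^ i)"
    by (rule freshmans_dream'[OF pp]) (simp add: semiring_char_poly)
  also have "?x ^ (?p ^ i) = monom 1 (?p ^ i)" by (simp add: monom_power)
  finally have "m dvd ?f ^ (?p ^ i)" by simp
  from sqf[OF this] K(1) that show thesis by blast
qed

text \<open>Induction on the set of roots: splitting off X - a leaves one block equal to the scalar
  \<open>a\<close> and another covered by the induction hypothesis.\<close>

lemma diagonalizable_of_annihilator:
  fixes A :: "'a::field mat"
  assumes "finite R" "A \<in> carrier_mat n n" "poly_mat (\<Prod>a\<in>R. [:-a, 1:]) A = 0\<^sub>m n n"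
  shows "diagonalizable_mat A"
  using assms
proof (induct R arbitrary: n A rule: finite_induct)
  case empty
  then have "1\<^sub>m n = (0\<^sub>m n n :: 'a mat)" by simp
  from arg_cong[OF this, of "\<lambda>M. M $$ (0, 0)"] have "n = 0" by (cases n) auto
  then have "diagonal_mat A" using empty by (auto simp: diagonal_mat_def)
  then show ?case using similar_mat_refl[OF empty(1)] by (auto simp: diagonalizable_mat_def)
next
  case (insert a R)
  have mi: "monic_irreducible [:-b, 1:]" for b :: 'a
    by (simp add: monic_irreducible_def irreducible_linear_field_poly)
  have inj: "inj_on (\<lambda>b. [:-b, 1:]) R" by (auto simp: inj_on_def)
  have "coprime (\<Prod>((\<lambda>b. [:-b, 1:]) ` R)) [:-a, 1:]"
    by (rule coprime_prod_monic_irreducible) (use insert mi in auto)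
  then have cop: "coprime (\<Prod>b\<in>R. [:-b, 1:]) [:-a, 1:]" by (simp add: prod.reindex[OF inj])
  obtain u v where bez: "u * (\<Prod>b\<in>R. [:-b, 1:]) + v * [:-a, 1:] = 1" using field_poly_bezout[OF cop] .
  have "poly_mat ((\<Prod>b\<in>R. [:-b, 1:]) * [:-a, 1:]) A = 0\<^sub>m n n"
    using insert by (simp add: mult.commute)
  from coprime_annihilator_split[OF insert(4) bez this] obtain m k B C where
    n: "n = m + k" and c: "B \<in> carrier_mat m m" "C \<in> carrier_mat k k"
    and sim: "similar_mat A (block_diag m k B C)"
    and B: "poly_mat (\<Prod>b\<in>R. [:-b, 1:]) B = 0\<^sub>m m m" and C: "poly_mat [:-a, 1:] C = 0\<^sub>m k k" .
  from insert(3)[OF c(1) B] obtain D where D: "diagonal_mat D" "similar_mat B D"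
    by (auto simp: diagonalizable_mat_def)
  have cD: "D \<in> carrier_mat m m" using similar_matD[OF D(2)] c by auto
  have "poly_mat [:-a, 1:] C = C - a \<cdot>\<^sub>m 1\<^sub>m k"
    using c by (auto simp: poly_mat_pCons intro!: eq_matI)
  with C have "C - a \<cdot>\<^sub>m 1\<^sub>m k = 0\<^sub>m k k" by simp
  have "C = a \<cdot>\<^sub>m 1\<^sub>m k"
  proof (rule eq_matI)
    fix i j assume "i < dim_row (a \<cdot>\<^sub>m 1\<^sub>m k)" "j < dim_col (a \<cdot>\<^sub>m 1\<^sub>m k)"
    then show "C $$ (i, j) = (a \<cdot>\<^sub>m 1\<^sub>m k) $$ (i, j)"
      using arg_cong[OF \<open>C - a \<cdot>\<^sub>m 1\<^sub>m k = 0\<^sub>m k k\<close>, of "\<lambda>M. M $$ (i, j)"] c by simp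
  qed (use c in auto)
  then have "diagonal_mat (block_diag m k D C)"
    using D(1) cD by (auto simp: diagonal_mat_def)
  moreover have "similar_mat A (block_diag m k D C)"
    by (rule similar_mat_trans[OF sim similar_mat_four_block_0_0[OF D(2) similar_mat_refl[OF c(2)] c]])
  ultimately show ?case by (auto simp: diagonalizable_mat_def)
qed

section \<open>Extension of scalars to the algebraic closure\<close>

interpretation to_ac: inj_idom_hom "to_ac :: 'a::field \<Rightarrow> 'a alg_closure"
  by unfold_locales auto

interpretation to_ac_poly: map_poly_inj_idom_hom "to_ac :: 'a::field \<Rightarrow> 'a alg_closure" ..

lemma poly_mat_map_to_ac:
  fixes A :: "'a::field mat"
  assumes A: "A \<in> carrier_mat n n"
  shows "poly_mat (map_poly to_ac f) (map_mat to_ac A) = map_mat to_ac (poly_mat f A)"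
proof (induct f)
  case 0
  show ?case using A by (auto simp: poly_mat_0[of _ n] intro!: eq_matI)
next
  case (pCons a f)
  have A': "map_mat to_ac A \<in> carrier_mat n n" using A by simp
  have "map_mat to_ac (A * poly_mat f A) = map_mat to_ac A * map_mat to_ac (poly_mat f A)"
    by (rule to_ac.mat_hom_mult[OF A poly_mat_carrier[OF A]])
  moreover have "map_mat to_ac (a \<cdot>\<^sub>m 1\<^sub>m n + M) = to_ac a \<cdot>\<^sub>m 1\<^sub>m n + map_mat to_ac M"
    if "M \<in> carrier_mat n n" for M
    using that by (auto intro!: eq_matI)
  ultimately show ?case
    using mult_carrier_mat[OF A poly_mat_carrier[OF A, of f]]
    by (simp add: to_ac.map_poly_pCons_hom poly_mat_pCons[OF A] poly_mat_pCons[OF A'] pCons(2))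
qed

lemma poly_mat_diagonal:
  fixes D :: "'a::comm_ring_1 mat"
  assumes D: "D \<in> carrier_mat n n" "diagonal_mat D"
  shows "poly_mat f D = mat n n (\<lambda>(i, j). if i = j then poly f (D $$ (i, i)) else 0)"
proof (induct f)
  case 0
  show ?case using D by (auto intro!: eq_matI)
next
  case (pCons a f)
  have "D * poly_mat f D = mat n n (\<lambda>(i, j). if i = j then D $$ (i, i) * poly f (D $$ (i, i)) else 0)"
  proof (rule eq_matI)
    fix i j assume "i < dim_row (mat n n (\<lambda>(i, j). if i = j then D $$ (i, i) * poly f (D $$ (i, i)) else 0))"
      "j < dim_col (mat n n (\<lambda>(i, j). if i = j then D $$ (i, i) * poly f (D $$ (i, i)) else 0))"
    then have ij: "i < n" "j < n" by auto
    have "(D * poly_mat f D) $$ (i, j) = (\<Sum>l\<in>{0..<n}. D $$ (i, l) * (if l = j then poly f (D $$ (l, l)) else 0))"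
      unfolding pCons(2) using ij D by (auto simp: scalar_prod_def intro!: sum.cong)
    also have "\<dots> = (\<Sum>l\<in>{0..<n}. if l = j then D $$ (i, j) * poly f (D $$ (j, j)) else 0)"
      by (intro sum.cong) auto
    also have "\<dots> = D $$ (i, j) * poly f (D $$ (j, j))" using ij by simp
    finally show "(D * poly_mat f D) $$ (i, j) = mat n n (\<lambda>(i, j). if i = j then D $$ (i, i) * poly f (D $$ (i, i)) else 0) $$ (i, j)"
      using ij D by (auto simp: diagonal_mat_def)
  qed (use D in auto)
  then show ?case unfolding poly_mat_pCons[OF D(1)] using D by (auto intro!: eq_matI)
qed

text \<open>This is the minimal polynomial of \<open>x\<close>, obtained as a nonzero polynomial of
  least degree with root \<open>x\<close> and made monic.\<close>

lemma alg_closure_monic_irreducible: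
  fixes x :: "'a::field alg_closure"
  obtains \<phi> :: "'a poly" where "monic_irreducible \<phi>" "poly (map_poly to_ac \<phi>) x = 0"
proof -
  define P where "P = (\<lambda>f :: 'a poly. f \<noteq> 0 \<and> poly (map_poly to_ac f) x = 0)"
  obtain f0 :: "'a poly" where "f0 \<noteq> 0" "poly (map_poly to_ac f0) x = 0" by (rule alg_closure_algebraic)
  then have "P f0" by (simp add: P_def)
  from ex_has_least_nat[of P, OF this, of degree] obtain f where f: "P f"
    and min: "\<And>g. P g \<Longrightarrow> degree f \<le> degree g" by blast
  define \<phi> where "\<phi> = Polynomial.smult (inverse (lead_coeff f)) f"
  have f0: "f \<noteq> 0" and fx: "poly (map_poly to_ac f) x = 0" using f by (auto simp: P_def)
  have phi: "degree \<phi> = degree f" "lead_coeff \<phi> = 1" "\<phi> \<noteq> 0" using f0 by (auto simp: \<phi>_def)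
  have phix: "poly (map_poly to_ac \<phi>) x = 0" using fx by (simp add: \<phi>_def to_ac.map_poly_hom_smult)
  have "irreducible \<phi>"
  proof (rule Factorial_Ring.irreducibleI)
    show "\<not> is_unit \<phi>"
    proof
      assume "is_unit \<phi>"
      then have "degree \<phi> = 0" by auto
      then obtain c where "\<phi> = [:c:]" by (rule degree_eq_zeroE)
      then show False using phix phi(3) by simp
    qed
    fix a b assume ab: "\<phi> = a * b"
    then have nz: "a \<noteq> 0" "b \<noteq> 0" using phi by auto
    then have deg: "degree f = degree a + degree b" using ab phi(1) degree_mult_eq[OF nz] by simp
    have "poly (map_poly to_ac a) x * poly (map_poly to_ac b) x = 0"
      using phix unfolding ab by (simp add: to_ac_poly.hom_mult)
    then have "P a \<or> P b" using nz by (auto simp: P_def)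
    then have "degree a = 0 \<or> degree b = 0" using min deg by fastforce
    then show "is_unit a \<or> is_unit b" using nz by (auto simp: is_unit_iff_degree)
  qed (use phi in auto)
  then have "monic_irreducible \<phi>" unfolding monic_irreducible_def using phi(2) by blast
  from that[OF this phix] show thesis .
qed

text \<open>From left to right, the annihilator collects the minimal polynomials of the eigenvalues.
  From right to left, the product of the irreducibles could have repeated roots in the closure; this
  is excluded because it divides X^N - X for a power N of the characteristic.\<close>

theorem semisimple_iff_annihilated:
  fixes A :: "'a::{field,finite} mat"
  assumes A: "A \<in> carrier_mat n n"
  shows "semisimple_mat A \<longleftrightarrow>
    (\<exists>S. finite S \<and> (\<forall>\<phi>\<in>S. monic_irreducible \<phi>) \<and> A \<in> ann n (\<Prod>S))"
proof
  let ?A = "map_mat to_ac A"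
  have A': "?A \<in> carrier_mat n n" using A by simp
  assume "semisimple_mat A"
  then obtain D where D: "diagonal_mat D" "similar_mat ?A D" by (auto simp: semisimple_mat_def diagonalizable_mat_def)
  then obtain P Q where wit: "similar_mat_wit ?A D P Q" by (auto simp: similar_mat_def)
  note w = similar_mat_witD2[OF A' wit]
  have "\<exists>\<phi>. monic_irreducible \<phi> \<and> poly (map_poly to_ac \<phi>) (D $$ (i, i)) = 0" for i
    by (rule alg_closure_monic_irreducible[of "D $$ (i, i)"]) blast
  then obtain \<phi> where phi: "\<And>i. monic_irreducible (\<phi> i)" "\<And>i. poly (map_poly to_ac (\<phi> i)) (D $$ (i, i)) = 0"
    by metis
  \<comment> \<open>As a set, the image contains a minimal polynomial shared by several eigenvalues
    only once, so no factor of the product is repeated.\<close>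
  define S where "S = \<phi> ` {..<n}"
  have "poly (map_poly to_ac (\<Prod>S)) (D $$ (i, i)) = 0" if "i < n" for i
  proof -
    have "\<phi> i dvd \<Prod>S" using that by (intro dvd_prodI) (auto simp: S_def)
    then obtain g where "\<Prod>S = \<phi> i * g" by (rule dvdE)
    then show ?thesis using phi(2)[of i] by (simp add: to_ac_poly.hom_mult)
  qed
  then have "poly_mat (map_poly to_ac (\<Prod>S)) D = 0\<^sub>m n n"
    unfolding poly_mat_diagonal[OF w(5) D(1)] by (auto intro!: eq_matI)
  then have "poly_mat (map_poly to_ac (\<Prod>S)) ?A = 0\<^sub>m n n"
    unfolding w(3) using poly_mat_similar[OF w(5,6,7,1,2), of "map_poly to_ac (\<Prod>S)"] w by simp
  then have z: "map_mat to_ac (poly_mat (\<Prod>S) A) = 0\<^sub>m n n" by (simp add: poly_mat_map_to_ac[OF A])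
  have "poly_mat (\<Prod>S) A = 0\<^sub>m n n"
  proof (rule eq_matI)
    fix i j assume "i < dim_row (0\<^sub>m n n :: 'a mat)" "j < dim_col (0\<^sub>m n n :: 'a mat)"
    then show "poly_mat (\<Prod>S) A $$ (i, j) = 0\<^sub>m n n $$ (i, j)"
      using arg_cong[OF z, of "\<lambda>M. M $$ (i, j)"] A by simp
  qed (use A in auto)
  then show "\<exists>S. finite S \<and> (\<forall>\<phi>\<in>S. monic_irreducible \<phi>) \<and> A \<in> ann n (\<Prod>S)"
    using A phi(1) by (intro exI[of _ S]) (auto simp: S_def ann_def)
next
  let ?A = "map_mat to_ac A"
  have A': "?A \<in> carrier_mat n n" using A by simp
  assume "\<exists>S. finite S \<and> (\<forall>\<phi>\<in>S. monic_irreducible \<phi>) \<and> A \<in> ann n (\<Prod>S)"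
  then obtain S where S: "finite S" "\<forall>\<phi>\<in>S. monic_irreducible \<phi>" and SA: "A \<in> ann n (\<Prod>S)" by blast
  obtain K where K: "K > 0" "\<Prod>S dvd monom 1 (CHAR('a) ^ K) - monom 1 1"
  proof (rule squarefree_dvd_power_CHAR_minus)
    show "\<Prod>S \<noteq> 0" using S by (auto simp: monic_irreducible_def)
  qed (rule prod_monic_irreducible_dvd_power[OF S])
  define N where "N = CHAR('a) ^ K"
  have p: "prime CHAR('a)" using finite_imp_CHAR_pos[where 'a='a] by (intro prime_CHAR_semidom) auto
  have N: "N > 1" "of_nat N = (0 :: 'a alg_closure)"
    using K(1) one_less_power[OF prime_gt_1_nat[OF p] K(1)] by (auto simp: N_def of_nat_eq_0_iff_char_dvd)
  from K(2) obtain g where "monom 1 N - monom 1 1 = \<Prod>S * g" unfolding N_def by (rule dvdE)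
  then have g: "monom 1 N - monom 1 1 = g * \<Prod>S" by (simp add: mult.commute)
  have "A \<in> ann n (monom 1 N - monom 1 1)" unfolding g using SA by (rule ann_mult_left)
  define f where "f = (monom 1 N - monom 1 1 :: 'a alg_closure poly)"
  have "f = map_poly to_ac (monom 1 N - monom 1 1)"
    by (rule poly_eqI) (simp add: f_def coeff_map_poly)
  then have fA: "poly_mat f ?A = 0\<^sub>m n n"
    using annD(2)[OF \<open>A \<in> ann n (monom 1 N - monom 1 1)\<close>]
    by (auto simp: poly_mat_map_to_ac[OF A] intro!: eq_matI)
  have df: "degree f = N" unfolding f_def diff_conv_add_uminus
    using N(1) by (subst degree_add_eq_left) (auto simp: degree_monom_eq)
  have lf: "lead_coeff f = 1" unfolding df using N(1) by (simp add: f_def)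
  have f0: "f \<noteq> 0" using lf by auto
  obtain M where M: "f = Polynomial.smult (lead_coeff f) (\<Prod>x\<in>#M. [:-x, 1:])"
    using alg_closed_imp_factorization[OF f0] by blast
  \<comment> \<open>A repeated root would be a root of the derivative, which is -1 because N is 0 in
    the field.\<close>
  have "count M x \<le> 1" for x
  proof (rule ccontr)
    assume "\<not> count M x \<le> 1"
    then have "{#x, x#} \<subseteq># M" by (simp add: subseteq_mset_def)
    then obtain M' where "M = {#x, x#} + M'" by (auto simp: subset_mset.le_iff_add)
    moreover have "f = (\<Prod>x\<in>#M. [:-x, 1:])" using M lf by simp
    ultimately have f: "f = [:-x, 1:] * ([:-x, 1:] * (\<Prod>x\<in>#M'. [:-x, 1:]))"
      by (simp del: mult_pCons_left mult_pCons_right)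
    have "poly (pderiv f) x = 0" unfolding f pderiv_mult by simp
    moreover have "pderiv f = - 1"
      using N by (simp add: f_def pderiv_diff pderiv_monom one_pCons monom_0)
    ultimately show False by simp
  qed
  then have "M = mset_set (set_mset M)"
    by (intro multiset_eqI) (auto simp: count_mset_set' le_Suc_eq count_eq_zero_iff)
  moreover have "f = (\<Prod>x\<in>#M. [:-x, 1:])" using M lf by simp
  ultimately have "f = (\<Prod>x\<in>set_mset M. [:-x, 1:])"
    by (simp add: prod_unfold_prod_mset)
  with fA have "poly_mat (\<Prod>x\<in>set_mset M. [:-x, 1:]) ?A = 0\<^sub>m n n" by simp
  from diagonalizable_of_annihilator[OF _ A' this] show "semisimple_mat A"
    by (simp add: semisimple_mat_def)
qed

subsection \<open>The first Rogers-Ramanujan identity\<close>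

text \<open>Dominated convergence for sums whose length grows with \<open>n\<close>. The bound is
  required only for \<open>k\<close> up to \<open>n\<close>; padding with zeros extends it to the
  whole array.\<close>

lemma tannery_sum:
  fixes a :: "nat \<Rightarrow> nat \<Rightarrow> real"
  assumes lim: "\<And>k. (\<lambda>n. a k n) \<longlonglongrightarrow> b k"
    and bound: "\<And>k n. k \<le> n \<Longrightarrow> \<bar>a k n\<bar> \<le> M k" and M: "summable M"
  shows "summable b" "(\<lambda>n. \<Sum>k\<le>n. a k n) \<longlonglongrightarrow> suminf b"
proof -
  define a' where "a' k n = (if k \<le> n then a k n else 0)" for k n
  have M0: "M k \<ge> 0" for k using bound[of k k] by simp
  have "(\<lambda>n. a' k n) \<longlonglongrightarrow> b k" for k
    by (rule Lim_transform_eventually[OF lim[of k]])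
       (auto simp: a'_def eventually_at_top_linorder intro!: exI[of _ k])
  moreover have "eventually (\<lambda>(k, n). norm (a' k n) \<le> M k) (at_top \<times>\<^sub>F at_top)"
    using bound M0 by (intro always_eventually) (auto simp: a'_def)
  ultimately have t: "summable (\<lambda>k. norm (b k)) \<and> (\<lambda>n. suminf (\<lambda>k. a' k n)) \<longlonglongrightarrow> suminf b"
    using tannerys_theorem[of a' b at_top M] M by auto
  then show "summable b" using summable_norm_cancel by blast
  have "suminf (\<lambda>k. a' k n) = (\<Sum>k\<le>n. a k n)" for n
    by (subst suminf_finite[of "{..n}"]) (auto simp: a'_def)
  with t show "(\<lambda>n. \<Sum>k\<le>n. a k n) \<longlonglongrightarrow> suminf b" by simp
qed

text \<open>The finite q-Pochhammer symbol (x; x)_n.\<close>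

definition qpoch :: "real \<Rightarrow> nat \<Rightarrow> real" where
  "qpoch x n = (\<Prod>i<n. 1 - x ^ Suc i)"

lemma qpoch_0 [simp]: "qpoch x 0 = 1" and qpoch_Suc: "qpoch x (Suc n) = qpoch x n * (1 - x ^ Suc n)"
  by (simp_all add: qpoch_def)

text \<open>The binomial coefficient j over 2, the exponent in theta series.\<close>

definition tri :: "nat \<Rightarrow> nat" where "tri j = j * (j - 1) div 2"

lemma tri_Suc: "tri (Suc j) = tri j + j"
proof -
  have "even (j * (j - 1))" by auto
  moreover have "Suc j * (Suc j - 1) = j * (j - 1) + 2 * j" by (cases j) auto
  ultimately show ?thesis unfolding tri_def by simp
qed

lemma tri_0 [simp]: "tri 0 = 0" by (simp add: tri_def)

lemma tri_square: "tri j + tri j + j = j * j"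
  by (induct j) (auto simp: tri_Suc)

lemma tri_add: "tri (a + b) = tri a + tri b + a * b"
  by (induct b) (auto simp: tri_Suc)

section \<open>Finite q-series identities\<close>

context
  fixes x :: real
  assumes x: "0 < x" "x < 1"
begin

lemma one_minus_power_pos: "n > 0 \<Longrightarrow> 1 - x ^ n > 0"
  using x power_strict_decreasing[of 0 n x] by (simp add: power_less_one_iff)

lemma qpoch_pos: "qpoch x n > 0"
  unfolding qpoch_def by (intro prod_pos ballI one_minus_power_pos) simp

lemma qpoch_nonzero [simp]: "qpoch x n \<noteq> 0"
  using qpoch_pos[of n] by simp

lemma qpoch_decseq: "decseq (qpoch x)"
proof (rule decseq_SucI)
  fix n
  have "1 - x ^ Suc n \<le> 1" using x by simp
  with qpoch_pos[of n] show "qpoch x (Suc n) \<le> qpoch x n"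
    unfolding qpoch_Suc by (intro mult_left_le) auto
qed

text \<open>Positivity of Euler's infinite product yields one lower bound for all
  \<open>qpoch x n\<close>; it supplies the dominating constants in the passages to the
  limit.\<close>

lemma qpoch_limit: obtains L where "L > 0" "qpoch x \<longlonglongrightarrow> L" "\<And>n. L \<le> qpoch x n"
proof -
  have "summable (\<lambda>i. norm ((1 - x ^ Suc i) - 1))"
    using x by (simp add: summable_mult summable_geometric)
  then have cp: "convergent_prod (\<lambda>i. 1 - x ^ Suc i)"
    by (intro abs_convergent_prod_imp_convergent_prod summable_imp_abs_convergent_prod)
  then have "(\<lambda>n. \<Prod>i\<le>n. 1 - x ^ Suc i) \<longlonglongrightarrow> prodinf (\<lambda>i. 1 - x ^ Suc i)"
    by (rule convergent_prod_LIMSEQ)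
  then have "(\<lambda>n. qpoch x (Suc n)) \<longlonglongrightarrow> prodinf (\<lambda>i. 1 - x ^ Suc i)"
    by (simp add: qpoch_def lessThan_Suc_atMost)
  then have lim: "qpoch x \<longlonglongrightarrow> prodinf (\<lambda>i. 1 - x ^ Suc i)"
    by (rule LIMSEQ_imp_Suc)
  have ne: "prodinf (\<lambda>i. 1 - x ^ Suc i) \<noteq> 0"
  proof (rule prodinf_nonzero[OF cp])
    show "1 - x ^ Suc i \<noteq> 0" for i using one_minus_power_pos[of "Suc i"] by auto
  qed
  have "prodinf (\<lambda>i. 1 - x ^ Suc i) \<ge> 0"
    by (rule LIMSEQ_le_const[OF lim]) (auto intro!: less_imp_le[OF qpoch_pos])
  with ne have "prodinf (\<lambda>i. 1 - x ^ Suc i) > 0" by simp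
  from that[OF this lim decseq_ge[OF qpoch_decseq lim]] show thesis .
qed

text \<open>Splitting off the factor 1 - y leaves the product for \<open>y * x\<close>, so
  \<open>y\<close> varies in the induction; the coefficients recombine by the q-Pascal rule
  \<open>split\<close>.\<close>

lemma q_binomial_theorem:
  "(\<Sum>j\<le>n. (- 1) ^ j * x ^ (j * (j - 1) div 2) * y ^ j * (qpoch x n / (qpoch x j * qpoch x (n - j))))
    = (\<Prod>i<n. 1 - y * x ^ i)"
proof (induct n arbitrary: y)
  case (Suc n)
  define e where "e j = j * (j - 1) div 2" for j :: nat
  have e: "e (Suc j) = e j + j" for j
  proof -
    have "even (j * (j - 1))" by auto
    moreover have "Suc j * (Suc j - 1) = j * (j - 1) + 2 * j" by (cases j) auto
    ultimately show ?thesis unfolding e_def by simp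
  qed
  define f where "f n y j = (- 1) ^ j * x ^ e j * y ^ j * (qpoch x n / (qpoch x j * qpoch x (n - j)))" for n y j
  have split: "f (Suc n) y j = (if j \<le> n then f n (y * x) j else 0) + (if j = 0 then 0 else - y * f n (y * x) (j - 1))"
    if "j \<le> Suc n" for j
  proof -
    have "j = 0 \<or> j = Suc n \<or> (j = Suc (j - 1) \<and> j \<le> n)" using that by linarith
    then consider "j = 0" | "j = Suc n" | i where "j = Suc i" "j \<le> n" by blast
    then show ?thesis
    proof cases
      case 1
      then show ?thesis by (simp add: f_def)
    next
      case 2
      then show ?thesis by (simp add: f_def e power_add power_mult_distrib mult_ac)
    next
      case 3
      then have d: "n - i = Suc (n - Suc i)" "Suc n - Suc i = Suc (n - Suc i)" by auto
      have ne: "1 - x ^ Suc i \<noteq> 0" "1 - x ^ Suc (n - Suc i) \<noteq> 0"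
        using one_minus_power_pos[of "Suc i"] one_minus_power_pos[of "Suc (n - Suc i)"] by auto
      have "Suc n = Suc i + Suc (n - Suc i)" using 3 by simp
      then have p: "x ^ Suc n = x ^ Suc i * x ^ Suc (n - Suc i)" by (simp only: power_add[symmetric])
      define a where "a = x ^ Suc i"
      define b where "b = x ^ Suc (n - Suc i)"
      define C where "C = (- 1) ^ i * x ^ e i * x ^ i * y ^ i"
      have "f (Suc n) y j = - C * y * (qpoch x n * (1 - a * b) / (qpoch x i * (1 - a) * (qpoch x (n - Suc i) * (1 - b))))"
        unfolding f_def 3 d(2) qpoch_Suc e p a_def b_def C_def by (simp add: power_add mult_ac)
      moreover have "f n (y * x) j = - C * y * a * (qpoch x n / (qpoch x i * (1 - a) * qpoch x (n - Suc i)))"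
        unfolding f_def 3 qpoch_Suc e a_def C_def by (simp add: power_add power_mult_distrib mult_ac)
      moreover have "- y * f n (y * x) (j - 1) = - C * y * (qpoch x n / (qpoch x i * (qpoch x (n - Suc i) * (1 - b))))"
        unfolding f_def 3 d b_def C_def by (simp add: d qpoch_Suc power_mult_distrib mult_ac)
      \<comment> \<open>Behind the q-Pascal rule stands 1 - a b = a (1 - b) + (1 - a).\<close>
      moreover have "- C * y * (P * (1 - a * b) / (Q * (1 - a) * (R * (1 - b)))) =
        - C * y * a * (P / (Q * (1 - a) * R)) + - C * y * (P / (Q * (R * (1 - b))))"
        if "Q \<noteq> 0" "R \<noteq> 0" for P Q R
        using that ne unfolding a_def[symmetric] b_def[symmetric] by (simp add: divide_simps) (simp add: algebra_simps)
      ultimately show ?thesis using 3 by simp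
    qed
  qed
  have "(\<Sum>j\<le>Suc n. f (Suc n) y j) = (\<Sum>j\<le>Suc n. if j \<le> n then f n (y * x) j else 0)
      + (\<Sum>j\<le>Suc n. if j = 0 then 0 else - y * f n (y * x) (j - 1))"
    by (simp only: sum.distrib[symmetric]) (intro sum.cong refl split, simp)
  also have "(\<Sum>j\<le>Suc n. if j \<le> n then f n (y * x) j else 0) = (\<Sum>j\<le>n. f n (y * x) j)"
    by simp
  also have "(\<Sum>j\<le>Suc n. if j = 0 then 0 else - y * f n (y * x) (j - 1)) = - y * (\<Sum>j\<le>n. f n (y * x) j)"
    by (simp add: sum.atMost_Suc_shift sum_distrib_left sum_negf del: sum.atMost_Suc)
  also have "(\<Sum>j\<le>n. f n (y * x) j) + - y * (\<Sum>j\<le>n. f n (y * x) j) = (1 - y) * (\<Sum>j\<le>n. f n (y * x) j)"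
    by (simp add: algebra_simps)
  also have "(\<Sum>j\<le>n. f n (y * x) j) = (\<Prod>i<n. 1 - y * x * x ^ i)"
    using Suc[of "y * x"] by (simp add: f_def e_def)
  also have "(1 - y) * \<dots> = (\<Prod>i<Suc n. 1 - y * x ^ i)"
    by (simp add: prod.lessThan_Suc_shift mult_ac del: prod.lessThan_Suc)
  finally show ?case by (simp only: f_def e_def)
qed simp

text \<open>Induction on \<open>M\<close> with \<open>a\<close> free. Write 1 - x^(M+1) as x^j (1 -
  x^(M+1-j)) + (1 - x^j): the first part lowers \<open>Suc M - j\<close>, the second lowers
  \<open>j\<close>, and both lead to the sum for \<open>M\<close> and \<open>Suc a\<close>, with
  weights that add up to 1.\<close>

lemma q_vandermonde:
  "(\<Sum>j\<le>M. x ^ (j * (j + a)) / (qpoch x (M - j) * qpoch x j * qpoch x (j + a)))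
    = 1 / (qpoch x M * qpoch x (M + a))"
proof (induct M arbitrary: a)
  case (Suc M)
  let ?t = "\<lambda>M a j. x ^ (j * (j + a)) / (qpoch x (M - j) * qpoch x j * qpoch x (j + a))"
  have ne: "1 - x ^ Suc k \<noteq> 0" for k using one_minus_power_pos[of "Suc k"] by auto
  have one_minus_mult_split: "(1 - u * v) * t = u * (1 - v) * t + (1 - u) * t" for u v t :: real
    by (simp add: algebra_simps)
  have A: "x ^ j * (1 - x ^ (Suc M - j)) * ?t (Suc M) a j = (1 - x ^ Suc (j + a)) * ?t M (Suc a) j"
    if "j \<le> M" for j
  proof -
    have d: "Suc M - j = Suc (M - j)" using that by simp
    have p: "x ^ (j * (j + Suc a)) = x ^ j * x ^ (j * (j + a))" by (simp flip: power_add)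
    show ?thesis unfolding d qpoch_Suc add_Suc_right p using ne[of "M - j"] ne[of "j + a"]
      by (simp add: divide_simps power_add)
  qed
  have B: "(1 - x ^ Suc j) * ?t (Suc M) a (Suc j) = x ^ Suc (j + a) * ?t M (Suc a) j" for j
  proof -
    have p: "x ^ (Suc j * (Suc j + a)) = x ^ Suc (j + a) * x ^ (j * (j + Suc a))"
      by (simp add: algebra_simps flip: power_add)
    show ?thesis unfolding diff_Suc_Suc p qpoch_Suc[of x j] using ne[of j]
      by (simp add: divide_simps)
  qed
  have "(1 - x ^ Suc M) * (\<Sum>j\<le>Suc M. ?t (Suc M) a j) =
      (\<Sum>j\<le>Suc M. x ^ j * (1 - x ^ (Suc M - j)) * ?t (Suc M) a j) + (\<Sum>j\<le>Suc M. (1 - x ^ j) * ?t (Suc M) a j)"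
    unfolding sum_distrib_left sum.distrib[symmetric]
  proof (rule sum.cong[OF refl])
    fix j assume "j \<in> {..Suc M}"
    then have "x ^ Suc M = x ^ j * x ^ (Suc M - j)" by (simp flip: power_add)
    then show "(1 - x ^ Suc M) * ?t (Suc M) a j =
      x ^ j * (1 - x ^ (Suc M - j)) * ?t (Suc M) a j + (1 - x ^ j) * ?t (Suc M) a j"
      using one_minus_mult_split[of "x ^ j" "x ^ (Suc M - j)" "?t (Suc M) a j"] by (simp only:)
  qed
  also have "(\<Sum>j\<le>Suc M. x ^ j * (1 - x ^ (Suc M - j)) * ?t (Suc M) a j) =
      (\<Sum>j\<le>M. (1 - x ^ Suc (j + a)) * ?t M (Suc a) j)"
    unfolding sum.atMost_Suc by (subst sum.cong[OF refl A]) auto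
  also have "(\<Sum>j\<le>Suc M. (1 - x ^ j) * ?t (Suc M) a j) = (\<Sum>j\<le>M. x ^ Suc (j + a) * ?t M (Suc a) j)"
    unfolding sum.atMost_Suc_shift B by simp
  also have "(\<Sum>j\<le>M. (1 - x ^ Suc (j + a)) * ?t M (Suc a) j) + (\<Sum>j\<le>M. x ^ Suc (j + a) * ?t M (Suc a) j)
      = (\<Sum>j\<le>M. ?t M (Suc a) j)"
    unfolding sum.distrib[symmetric] distrib_right[symmetric] by simp
  also have "\<dots> = 1 / (qpoch x M * qpoch x (M + Suc a))" by (rule Suc)
  finally have "(1 - x ^ Suc M) * (\<Sum>j\<le>Suc M. ?t (Suc M) a j) = \<dots>" .
  moreover have "S = 1 / (P * u * Q)" if "u * S = 1 / (P * Q)" "u \<noteq> 0" for u S P Q :: real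
    using that nonzero_mult_div_cancel_left[of u S] by (simp add: mult_ac)
  ultimately show ?case using ne[of M] unfolding qpoch_Suc[of x M] add_Suc_shift by blast
qed simp

text \<open>The Bailey transform: \<open>\<alpha>\<close> and \<open>bailey \<alpha>\<close> form a
  Bailey pair relative to 1.\<close>

definition bailey :: "(nat \<Rightarrow> real) \<Rightarrow> nat \<Rightarrow> real" where
  "bailey \<alpha> N = (\<Sum>m\<le>N. \<alpha> m / (qpoch x (N - m) * qpoch x (N + m)))"

text \<open>Bailey's lemma with both parameters sent to infinity. After the sums are exchanged and s
  = m + j is substituted, s^2 = m^2 + j (j + 2 m) makes the inner sum a q-Vandermonde sum with
  \<open>a = 2 * m\<close>.\<close>

lemma bailey_step:
  "(\<Sum>s\<le>N. x ^ (s * s) / qpoch x (N - s) * bailey \<alpha> s) = bailey (\<lambda>m. x ^ (m * m) * \<alpha> m) N"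
proof -
  have "(\<Sum>s\<le>N. x ^ (s * s) / qpoch x (N - s) * bailey \<alpha> s) =
      (\<Sum>s\<le>N. \<Sum>m\<le>s. x ^ (s * s) / qpoch x (N - s) * (\<alpha> m / (qpoch x (s - m) * qpoch x (s + m))))"
    by (simp add: bailey_def sum_distrib_left)
  also have "\<dots> = (\<Sum>m\<le>N. \<Sum>s\<in>{m..N}. x ^ (s * s) / qpoch x (N - s) * (\<alpha> m / (qpoch x (s - m) * qpoch x (s + m))))"
    unfolding sum.Sigma[OF finite_atMost ballI[OF finite_atMost]] sum.Sigma[OF finite_atMost ballI[OF finite_atLeastAtMost]]
    by (rule sum.reindex_bij_witness[of _ "\<lambda>(m, s). (s, m)" "\<lambda>(s, m). (m, s)"]) auto
  also have "\<dots> = bailey (\<lambda>m. x ^ (m * m) * \<alpha> m) N"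
    unfolding bailey_def
  proof (rule sum.cong[OF refl])
    fix m assume m: "m \<in> {..N}"
    have "(\<Sum>s\<in>{m..N}. x ^ (s * s) / qpoch x (N - s) * (\<alpha> m / (qpoch x (s - m) * qpoch x (s + m)))) =
      (\<Sum>j\<le>N - m. x ^ (m * m) * \<alpha> m * (x ^ (j * (j + 2 * m)) / (qpoch x (N - m - j) * qpoch x j * qpoch x (j + 2 * m))))"
    proof (rule sum.reindex_bij_witness[of _ "\<lambda>j. m + j" "\<lambda>s. s - m"])
      fix s assume "s \<in> {m..N}"
      then obtain j where s: "s = m + j" using le_Suc_ex by auto
      have "s * s = m * m + j * (j + 2 * m)" by (simp add: s algebra_simps)
      then show "x ^ (m * m) * \<alpha> m * (x ^ ((s - m) * ((s - m) + 2 * m)) / (qpoch x (N - m - (s - m)) * qpoch x (s - m) * qpoch x ((s - m) + 2 * m)))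
        = x ^ (s * s) / qpoch x (N - s) * (\<alpha> m / (qpoch x (s - m) * qpoch x (s + m)))"
        by (simp add: power_add s mult_2 mult_2_right add_ac mult_ac)
    qed (use m in auto)
    also have "\<dots> = x ^ (m * m) * \<alpha> m * (1 / (qpoch x (N - m) * qpoch x (N - m + 2 * m)))"
      by (simp only: sum_distrib_left[symmetric] q_vandermonde)
    also have "N - m + 2 * m = N + m" using m by simp
    finally show "(\<Sum>s\<in>{m..N}. x ^ (s * s) / qpoch x (N - s) * (\<alpha> m / (qpoch x (s - m) * qpoch x (s + m))))
      = x ^ (m * m) * \<alpha> m / (qpoch x (N - m) * qpoch x (N + m))" by simp
  qed
  finally show ?thesis .
qed

text \<open>Both Pochhammer symbols in the denominator tend to \<open>L\<close> from above, so
  \<open>1 / (L * L)\<close> dominates.\<close>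

lemma bailey_limit:
  assumes L: "L > 0" "qpoch x \<longlonglongrightarrow> L" "\<And>n. L \<le> qpoch x n" and sm: "summable (\<lambda>m. \<bar>\<alpha> m\<bar>)"
  shows "bailey \<alpha> \<longlonglongrightarrow> suminf \<alpha> / (L * L)"
proof -
  have lim: "(\<lambda>N. \<alpha> m / (qpoch x (N - m) * qpoch x (N + m))) \<longlonglongrightarrow> \<alpha> m / (L * L)" for m
  proof (intro tendsto_intros)
    show "(\<lambda>N. qpoch x (N - m)) \<longlonglongrightarrow> L" by (rule LIMSEQ_offset[of _ m]) (simp add: L)
    show "(\<lambda>N. qpoch x (N + m)) \<longlonglongrightarrow> L" by (rule LIMSEQ_ignore_initial_segment[OF L(2)])
  qed (use L in auto)
  have "(\<lambda>N. \<Sum>m\<le>N. \<alpha> m / (qpoch x (N - m) * qpoch x (N + m))) \<longlonglongrightarrow> (\<Sum>m. \<alpha> m / (L * L))"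
  proof (rule tannery_sum(2)[OF lim])
    show "\<bar>\<alpha> m / (qpoch x (N - m) * qpoch x (N + m))\<bar> \<le> \<bar>\<alpha> m\<bar> * (1 / (L * L))" for m N
    proof -
      have "L * L \<le> qpoch x (N - m) * qpoch x (N + m)" using L by (intro mult_mono) (auto intro: less_imp_le qpoch_pos)
      then have "1 / (qpoch x (N - m) * qpoch x (N + m)) \<le> 1 / (L * L)" using L by (intro divide_left_mono) (auto intro!: mult_pos_pos qpoch_pos)
      from mult_left_mono[OF this, of "\<bar>\<alpha> m\<bar>"] show ?thesis
        using qpoch_pos[of "N - m"] qpoch_pos[of "N + m"] by (simp add: abs_divide abs_mult)
    qed
    show "summable (\<lambda>m. \<bar>\<alpha> m\<bar> * (1 / (L * L)))" by (rule summable_mult2[OF sm])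
  qed
  moreover have "(\<Sum>m. \<alpha> m / (L * L)) = suminf \<alpha> / (L * L)"
    by (rule suminf_divide[OF summable_rabs_cancel[OF sm]])
  ultimately show ?thesis by (simp add: bailey_def[abs_def])
qed

text \<open>The exponents m and -m of the bilateral theta series are taken together because
  \<open>bailey\<close> sums over nonnegative indices; the exponent 0 must be counted only
  once.\<close>

definition theta_term :: "real \<Rightarrow> nat \<Rightarrow> real" where
  "theta_term z m = (if m = 0 then 1 else (- 1) ^ m * (z ^ m * x ^ tri m + x ^ (tri m + m) / z ^ m))"

text \<open>The finite form of the Jacobi triple product, with the terms for \<open>m\<close> and \<open>-m\<close> collected.\<close>

lemma finite_triple_product:
  assumes z: "z > 0"
  shows "qpoch x (2 * N) * bailey (theta_term z) N = (\<Prod>i<N. 1 - z * x ^ i) * (\<Prod>i<N. 1 - x ^ Suc i / z)"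
proof -
  \<comment> \<open>Summand of the q-binomial theorem of order 2 N at y = z / x^N. The shift by x^N
    makes j = N the central term, so that j = N + m and j = N - m pair up.\<close>
  define f where "f j = (- 1) ^ j * x ^ tri j * (z / x ^ N) ^ j * (qpoch x (2 * N) / (qpoch x j * qpoch x (2 * N - j)))" for j
  \<comment> \<open>The central summand without its q-binomial coefficient. The same constant comes
    out of the product below and cancels.\<close>
  define K where "K = (- 1) ^ N * z ^ N * x ^ tri N / x ^ (N * N)"
  have xn: "x ^ k \<noteq> 0" for k using x by simp
  have plus: "f (N + m) = K * qpoch x (2 * N) * ((- 1) ^ m * (z ^ m * x ^ tri m) / (qpoch x (N - m) * qpoch x (N + m)))"
    if "m \<le> N" for m
  proof -
    have "(x ^ N) ^ N = x ^ (N * N)" "(x ^ N) ^ m = x ^ (N * m)" by (simp_all add: power_mult)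
    moreover have "2 * N - (N + m) = N - m" by simp
    ultimately show ?thesis unfolding f_def K_def tri_add power_add
      using xn x by (simp add: power_divide divide_simps mult_ac)
  qed
  have minus: "f (N - m) = K * qpoch x (2 * N) * ((- 1) ^ m * (x ^ (tri m + m) / z ^ m) / (qpoch x (N - m) * qpoch x (N + m)))"
    if "m \<le> N" for m
  proof -
    define k where "k = N - m"
    have N: "N = k + m" using that by (simp add: k_def)
    have s: "((- 1 :: real) ^ k) = (- 1) ^ N * (- 1) ^ m" unfolding N by (simp add: power_add flip: power_mult_distrib)
    have mm: "m * m = tri m + tri m + m" by (rule tri_square[symmetric])
    have p: "x ^ tri k * x ^ (N * N) = x ^ tri N * x ^ (tri m + m) * x ^ (N * k)"
    proof -
      have "tri k + N * N = tri N + (tri m + m) + N * k"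
        unfolding N tri_add using mm by (simp add: algebra_simps)
      then show ?thesis by (simp flip: power_add)
    qed
    have zz: "z ^ N = z ^ k * z ^ m" unfolding N by (rule power_add)
    have zx: "x ^ tri k * (z / x ^ N) ^ k = (z ^ N * x ^ tri N / x ^ (N * N)) * (x ^ (tri m + m) / z ^ m)"
      using xn z p by (simp add: power_divide zz divide_simps flip: power_mult)
    have "(- 1) ^ k * (x ^ tri k * (z / x ^ N) ^ k) = (- 1) ^ k * ((z ^ N * x ^ tri N / x ^ (N * N)) * (x ^ (tri m + m) / z ^ m))"
      unfolding zx ..
    then have "(- 1) ^ k * x ^ tri k * (z / x ^ N) ^ k = K * ((- 1) ^ m * (x ^ (tri m + m) / z ^ m))"
      unfolding K_def s by (simp add: mult_ac)
    moreover have "N - m = k" "2 * N - k = N + m" using N by auto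
    ultimately show ?thesis unfolding f_def by (simp add: mult_ac)
  qed
  have "(\<Sum>j\<le>2 * N. f j) = (\<Sum>j<N. f j) + (\<Sum>j\<in>{N..2 * N}. f j)"
    by (subst sum.union_disjoint[symmetric]) (auto intro!: sum.cong)
  also have "(\<Sum>j<N. f j) = (\<Sum>m\<in>{1..N}. f (N - m))"
    by (rule sum.reindex_bij_witness[of _ "\<lambda>m. N - m" "\<lambda>j. N - j"]) auto
  also have "(\<Sum>j\<in>{N..2 * N}. f j) = (\<Sum>m\<in>{0..N}. f (N + m))"
    by (rule sum.reindex_bij_witness[of _ "\<lambda>m. N + m" "\<lambda>j. j - N"]) auto
  also have "(\<Sum>m\<in>{0..N}. f (N + m)) = f N + (\<Sum>m\<in>{1..N}. f (N + m))"
    by (simp add: sum.atLeast_Suc_atMost)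
  also have "(\<Sum>m\<in>{1..N}. f (N - m)) + (f N + (\<Sum>m\<in>{1..N}. f (N + m))) = f N + (\<Sum>m\<in>{1..N}. f (N - m) + f (N + m))"
    by (simp add: sum.distrib)
  also have "f N = K * qpoch x (2 * N) * (theta_term z 0 / (qpoch x (N - 0) * qpoch x (N + 0)))"
    using plus[of 0] by (simp add: theta_term_def)
  also have "(\<Sum>m\<in>{1..N}. f (N - m) + f (N + m)) =
      (\<Sum>m\<in>{1..N}. K * qpoch x (2 * N) * (theta_term z m / (qpoch x (N - m) * qpoch x (N + m))))"
    by (intro sum.cong refl) (auto simp: plus minus theta_term_def add_divide_distrib distrib_left)
  also have "K * qpoch x (2 * N) * (theta_term z 0 / (qpoch x (N - 0) * qpoch x (N + 0))) + \<dots> =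
      K * qpoch x (2 * N) * bailey (theta_term z) N"
    unfolding bailey_def sum_distrib_left atMost_atLeast0 by (simp add: sum.atLeast_Suc_atMost)
  finally have sum: "(\<Sum>j\<le>2 * N. f j) = K * qpoch x (2 * N) * bailey (theta_term z) N" .
  have "(\<Prod>i<N. x ^ Suc i) = x ^ (tri N + N)"
    by (induct N) (auto simp: tri_Suc power_add)
  also have "x ^ (tri N + N) = x ^ (N * N) / x ^ tri N"
    using xn by (simp add: tri_square[symmetric] power_add)
  finally have px: "(\<Prod>i<N. x ^ Suc i) = x ^ (N * N) / x ^ tri N" .
  have "(\<Prod>i<2 * N. 1 - z / x ^ N * x ^ i) = (\<Prod>i<N. 1 - z / x ^ N * x ^ i) * (\<Prod>i\<in>{N..<2 * N}. 1 - z / x ^ N * x ^ i)"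
    by (subst prod.union_disjoint[symmetric]) (auto intro!: prod.cong)
  also have "(\<Prod>i\<in>{N..<2 * N}. 1 - z / x ^ N * x ^ i) = (\<Prod>i<N. 1 - z * x ^ i)"
    by (rule prod.reindex_bij_witness[of _ "\<lambda>m. N + m" "\<lambda>j. j - N"]) (use x in \<open>auto simp: power_diff\<close>)
  also have "(\<Prod>i<N. 1 - z / x ^ N * x ^ i) = (\<Prod>i<N. 1 - z / x ^ Suc i)"
  proof (rule prod.reindex_bij_witness[of _ "\<lambda>i. N - Suc i" "\<lambda>i. N - Suc i"])
    fix i assume "i \<in> {..<N}"
    then have "N = Suc (N - Suc i) + i" by auto
    then have "x ^ N = x ^ (Suc (N - Suc i) + i)" by (rule arg_cong)
    then have "x ^ N = x ^ Suc (N - Suc i) * x ^ i" unfolding power_add .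
    then show "1 - z / x ^ Suc (N - Suc i) = 1 - z / x ^ N * x ^ i" using xn by (simp add: field_simps)
  qed auto
  \<comment> \<open>Factors with negative powers of \<open>x\<close> are turned round; the monomials
    pulled out multiply to \<open>K\<close>.\<close>
  also have "\<dots> = (\<Prod>i<N. (- z / x ^ Suc i) * (1 - x ^ Suc i / z))"
    using xn z x by (intro prod.cong refl) (simp add: field_simps)
  also have "\<dots> = (- z) ^ N / (\<Prod>i<N. x ^ Suc i) * (\<Prod>i<N. 1 - x ^ Suc i / z)"
    unfolding prod.distrib prod_dividef by simp
  also have "(- z) ^ N / (\<Prod>i<N. x ^ Suc i) = K"
    unfolding px K_def power_minus[of z] by simp
  finally have prod: "(\<Prod>i<2 * N. 1 - z / x ^ N * x ^ i) = K * (\<Prod>i<N. 1 - x ^ Suc i / z) * (\<Prod>i<N. 1 - z * x ^ i)" .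
  have "K \<noteq> 0" using z xn by (simp add: K_def)
  moreover have "K * (qpoch x (2 * N) * bailey (theta_term z) N) = K * ((\<Prod>i<N. 1 - z * x ^ i) * (\<Prod>i<N. 1 - x ^ Suc i / z))"
    using q_binomial_theorem[where n="2 * N" and y="z / x ^ N"] sum prod by (simp add: f_def tri_def mult_ac)
  ultimately show ?thesis by simp
qed

end

lemma qpoch_5: "qpoch x (5 * N) = (\<Prod>i<N. (1 - x ^ (5 * i + 1)) * (1 - x ^ (5 * i + 4))) *
    (\<Prod>i<N. (1 - x ^ (5 * i + 2)) * (1 - x ^ (5 * i + 3))) * qpoch (x ^ 5) N"
proof (induct N)
  case (Suc N)
  have "5 * Suc N = Suc (Suc (Suc (Suc (Suc (5 * N)))))" by simp
  then have "qpoch x (5 * Suc N) = qpoch x (5 * N) * (1 - x ^ (5 * N + 1)) * (1 - x ^ (5 * N + 2)) *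
      (1 - x ^ (5 * N + 3)) * (1 - x ^ (5 * N + 4)) * (1 - (x ^ 5) ^ Suc N)"
    by (simp only: qpoch_Suc power_mult[symmetric]) (simp add: eval_nat_numeral)
  then show ?case unfolding Suc qpoch_Suc by (simp add: mult_ac)
qed simp

text \<open>Applying the Bailey transform twice to the unit pair.\<close>

theorem rogers_ramanujan:
  fixes x :: real
  assumes x: "0 < x" "x < 1"
  shows "summable (\<lambda>s. x ^ (s * s) / qpoch x s)"
    and "(\<lambda>N. \<Prod>i<N. 1 / ((1 - x ^ (5 * i + 1)) * (1 - x ^ (5 * i + 4)))) \<longlonglongrightarrow> (\<Sum>s. x ^ (s * s) / qpoch x s)"
proof -
  obtain L where L: "L > 0" "qpoch x \<longlonglongrightarrow> L" "\<And>n. L \<le> qpoch x n" by (rule qpoch_limit[OF x]) blast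
  define y where "y = x ^ 5"
  have y: "0 < y" "y < 1" using x by (auto simp: y_def power_less_one_iff)
  obtain L' where L': "L' > 0" "qpoch y \<longlonglongrightarrow> L'" "\<And>n. L' \<le> qpoch y n" by (rule qpoch_limit[OF y]) blast
  define \<alpha> where "\<alpha> m = x ^ (m * m) * (x ^ (m * m) * theta_term x 1 m)" for m
  \<comment> \<open>At z = 1 the triple product contains the factor 1 - x^0 = 0 as soon as N > 0.
    This is the unit Bailey pair.\<close>
  have unit: "bailey x (theta_term x 1) N = (if N = 0 then 1 else 0)" for N
  proof (cases N)
    case 0
    then show ?thesis by (simp add: bailey_def[OF x] theta_term_def[OF x])
  next
    case (Suc k)
    have "(\<Prod>i<N. 1 - 1 * x ^ i) = 0" using Suc by (intro prod_zero bexI[of _ 0]) auto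
    then have "qpoch x (2 * N) * bailey x (theta_term x 1) N = 0"
      using finite_triple_product[OF x, of 1 N] by simp
    then show ?thesis using qpoch_nonzero[OF x, of "2 * N"] Suc by simp
  qed
  have b1: "bailey x (\<lambda>m. x ^ (m * m) * theta_term x 1 m) N = 1 / qpoch x N" for N
    unfolding bailey_step[OF x, symmetric] unit
    by (subst sum.mono_neutral_cong_right[where S="{0}" and h="\<lambda>_. 1 / qpoch x N"]) auto
  \<comment> \<open>As N tends to infinity the left side becomes the Rogers-Ramanujan sum divided by
    \<open>L\<close>.\<close>
  have b2: "(\<Sum>s\<le>N. x ^ (s * s) / qpoch x (N - s) * (1 / qpoch x s)) = bailey x \<alpha> N" for N
    using bailey_step[OF x, of N "\<lambda>m. x ^ (m * m) * theta_term x 1 m"]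
    unfolding b1 \<alpha>_def[abs_def] .
  have sq: "x ^ (s * s) \<le> x ^ s" for s using x by (intro power_decreasing) auto
  have lim: "(\<lambda>N. x ^ (s * s) / qpoch x (N - s) * (1 / qpoch x s)) \<longlonglongrightarrow> x ^ (s * s) / L * (1 / qpoch x s)" for s
  proof (intro tendsto_intros)
    show "(\<lambda>N. qpoch x (N - s)) \<longlonglongrightarrow> L" by (rule LIMSEQ_offset[of _ s]) (simp add: L)
  qed (use L in auto)
  have bound: "\<bar>x ^ (s * s) / qpoch x (N - s) * (1 / qpoch x s)\<bar> \<le> x ^ s * (1 / (L * L))" for s N
  proof -
    have "L * L \<le> qpoch x (N - s) * qpoch x s" using L by (intro mult_mono) (auto intro: less_imp_le qpoch_pos[OF x])
    then have "1 / (qpoch x (N - s) * qpoch x s) \<le> 1 / (L * L)" using L by (intro divide_left_mono) (auto intro!: mult_pos_pos qpoch_pos[OF x])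
    from mult_mono[OF sq[of s] this] show ?thesis
      using qpoch_pos[OF x, of "N - s"] qpoch_pos[OF x, of s] x by (simp add: abs_divide abs_mult)
  qed
  have sm: "summable (\<lambda>s. x ^ s * (1 / (L * L)))" using x by (intro summable_mult2 summable_geometric) auto
  note T = tannery_sum[OF lim bound sm]
  have "summable (\<lambda>s. L * (x ^ (s * s) / L * (1 / qpoch x s)))" by (rule summable_mult[OF T(1)])
  then show sum: "summable (\<lambda>s. x ^ (s * s) / qpoch x s)" using L by simp
  have "(\<Sum>s. x ^ (s * s) / L * (1 / qpoch x s)) = (\<Sum>s. x ^ (s * s) / qpoch x s / L)"
    by (simp add: mult.commute)
  also have "\<dots> = (\<Sum>s. x ^ (s * s) / qpoch x s) / L" by (rule suminf_divide[OF sum])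
  finally have e: "(\<Sum>s. x ^ (s * s) / L * (1 / qpoch x s)) = (\<Sum>s. x ^ (s * s) / qpoch x s) / L" .
  have lim1: "bailey x \<alpha> \<longlonglongrightarrow> (\<Sum>s. x ^ (s * s) / qpoch x s) / L"
    using T(2) unfolding b2 e .
  have sa: "summable (\<lambda>m. \<bar>\<alpha> m\<bar>)"
  proof (rule summable_comparison_test')
    show "summable (\<lambda>m. 2 * x ^ m)" using x by (intro summable_mult summable_geometric) auto
    fix m :: nat
    have t: "\<bar>theta_term x 1 m\<bar> \<le> 2"
    proof -
      have "x ^ k \<le> 1" "x ^ k \<ge> 0" for k using x by (auto simp: power_le_one)
      from this[of "tri m"] this[of "tri m + m"] show ?thesis
        by (auto simp: theta_term_def[OF x] abs_mult power_abs)
    qed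
    have x1: "x ^ (m * m) \<le> 1" "0 \<le> x ^ (m * m)" using x by (auto simp: power_le_one)
    have "\<bar>\<alpha> m\<bar> = x ^ (m * m) * (x ^ (m * m) * \<bar>theta_term x 1 m\<bar>)"
      using x by (simp add: \<alpha>_def abs_mult)
    also have "\<dots> \<le> x ^ m * (1 * 2)"
      using sq[of m] t x1 x by (intro mult_mono) auto
    finally show "norm \<bar>\<alpha> m\<bar> \<le> 2 * x ^ m" by simp
  qed
  have lim2: "bailey x \<alpha> \<longlonglongrightarrow> suminf \<alpha> / (L * L)" by (rule bailey_limit[OF x L sa])
  have rr: "(\<Sum>s. x ^ (s * s) / qpoch x s) = suminf \<alpha> / L"
    using LIMSEQ_unique[OF lim1 lim2] L by (simp add: field_simps)
  \<comment> \<open>The same sequence is the theta sequence to base x^5 at z = x^2, by 2 m + 5 tri m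
    = 2 m^2 + tri m. The triple product can therefore be used a second time, now to evaluate its
    sum.\<close>
  have "theta_term y (x ^ 2) = \<alpha>"
  proof
    fix m
    have mm: "m * m = tri m + tri m + m" by (rule tri_square[symmetric])
    then have "2 * m + 5 * tri m = m * m + m * m + tri m" by linarith
    then have "x ^ (2 * m) * x ^ (5 * tri m) = x ^ (m * m) * x ^ (m * m) * x ^ tri m"
      by (simp only: power_add[symmetric])
    moreover have "5 * (tri m + m) = m * m + m * m + (tri m + m) + 2 * m" unfolding mm by simp
    then have "x ^ (5 * (tri m + m)) = x ^ (m * m) * x ^ (m * m) * x ^ (tri m + m) * x ^ (2 * m)"
      by (simp only: power_add[symmetric])
    moreover have "y ^ k = x ^ (5 * k)" for k by (simp add: y_def power_mult)
    moreover have "(x ^ 2) ^ m = x ^ (2 * m)" by (simp add: power_mult)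
    ultimately have "(x ^ 2) ^ m * y ^ tri m = x ^ (m * m) * x ^ (m * m) * x ^ tri m"
      "y ^ (tri m + m) / (x ^ 2) ^ m = x ^ (m * m) * x ^ (m * m) * x ^ (tri m + m)"
      using x by (simp_all only: nonzero_mult_div_cancel_right power_not_zero less_irrefl) simp
    then show "theta_term y (x ^ 2) m = \<alpha> m"
      unfolding theta_term_def[OF x] theta_term_def[OF y] \<alpha>_def by (simp only: split: if_splits) (simp add: algebra_simps)
  qed
  then have fin: "qpoch y (2 * N) * bailey y \<alpha> N = (\<Prod>i<N. (1 - x ^ (5 * i + 2)) * (1 - x ^ (5 * i + 3)))" for N
  proof -
    have "(\<Prod>i<N. 1 - x ^ 2 * y ^ i) = (\<Prod>i<N. 1 - x ^ (5 * i + 2))"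
      by (simp add: y_def power2_eq_square power_add mult_ac flip: power_mult)
    moreover have "y ^ Suc i / x ^ 2 = x ^ (5 * i + 3)" for i
    proof -
      have "y ^ Suc i = x ^ ((5 * i + 3) + 2)" unfolding y_def power_mult[symmetric] by simp
      then show ?thesis using x by (simp only: power_add) simp
    qed
    ultimately show ?thesis using finite_triple_product[OF y, of "x ^ 2" N] x \<open>theta_term y (x ^ 2) = \<alpha>\<close>
      by (simp only: prod.distrib) simp
  qed
  have "(\<lambda>N. qpoch y (2 * N) * bailey y \<alpha> N) \<longlonglongrightarrow> L' * (suminf \<alpha> / (L' * L'))"
  proof (intro tendsto_mult bailey_limit[OF y L' sa])
    show "(\<lambda>N. qpoch y (2 * N)) \<longlonglongrightarrow> L'"
      by (rule filterlim_compose[OF L'(2)]) (auto intro!: filterlim_subseq simp: strict_mono_def)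
  qed
  then have lim3: "(\<lambda>N. \<Prod>i<N. (1 - x ^ (5 * i + 2)) * (1 - x ^ (5 * i + 3))) \<longlonglongrightarrow> suminf \<alpha> / L'"
    using L' by (simp add: fin)
  have lim5: "(\<lambda>N. qpoch x (5 * N)) \<longlonglongrightarrow> L"
    by (rule filterlim_compose[OF L(2)]) (auto intro!: filterlim_subseq simp: strict_mono_def)
  have "(\<lambda>N. (\<Prod>i<N. (1 - x ^ (5 * i + 2)) * (1 - x ^ (5 * i + 3))) * qpoch y N / qpoch x (5 * N)) \<longlonglongrightarrow> suminf \<alpha> / L' * L' / L"
    using L by (intro tendsto_divide tendsto_mult lim3 L'(2) lim5) auto
  \<comment> \<open>By \<open>qpoch_5\<close> the residues 0, 2 and 3 modulo 5 cancel, and 1 and 4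
    stay in the denominator.\<close>
  moreover have "(\<Prod>i<N. (1 - x ^ (5 * i + 2)) * (1 - x ^ (5 * i + 3))) * qpoch y N / qpoch x (5 * N) =
      (\<Prod>i<N. 1 / ((1 - x ^ (5 * i + 1)) * (1 - x ^ (5 * i + 4))))" for N
  proof -
    have "qpoch y N \<noteq> 0" using y by simp
    moreover have "(\<Prod>i<N. (1 - x ^ (5 * i + 2)) * (1 - x ^ (5 * i + 3))) > 0"
      by (intro prod_pos ballI mult_pos_pos one_minus_power_pos[OF x]) auto
    moreover have "b * c / (a * b * c) = 1 / a" if "c \<noteq> 0" "b > 0" for a b c :: real
      using that by simp
    ultimately show ?thesis
      unfolding qpoch_5[of x N] y_def[symmetric] prod_dividef prod.neutral_const by blast
  qed
  ultimately show "(\<lambda>N. \<Prod>i<N. 1 / ((1 - x ^ (5 * i + 1)) * (1 - x ^ (5 * i + 4)))) \<longlonglongrightarrow> (\<Sum>s. x ^ (s * s) / qpoch x s)"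
    using L' by (simp add: rr)
qed

subsection \<open>Generating functions\<close>

definition irr_upto :: "nat \<Rightarrow> 'a::field poly set" where
  "irr_upto D = {\<phi>. monic_irreducible \<phi> \<and> degree \<phi> \<le> D}"

lemma finite_irr_upto: "finite (irr_upto D :: 'a::{field,finite} poly set)"
  by (rule finite_subset[OF _ finite_polys_below[of "Suc D"]]) (auto simp: irr_upto_def polys_below_iff)

lemma irr_upto_mono: "D \<le> D' \<Longrightarrow> irr_upto D \<subseteq> irr_upto D'"
  by (auto simp: irr_upto_def)

lemma monic_irreducible_degree_pos: "monic_irreducible \<phi> \<Longrightarrow> degree \<phi> > 0"
  by (simp add: monic_irreducible_def irreducible_degree_pos)

definition gl_fps :: "nat \<Rightarrow> nat \<Rightarrow> real fps" where
  "gl_fps q d = Abs_fps (\<lambda>n. if d dvd n then 1 / real (gl_order (q ^ d) (n div d)) else 0)"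

lemma fps_nth_prod_gl_fps:
  fixes S :: "'a::{field,finite} poly set"
  assumes "finite S" "\<forall>\<phi>\<in>S. monic_irreducible \<phi>"
  shows "fps_nth (\<Prod>\<phi>\<in>S. gl_fps CARD('a) (degree \<phi>)) n = card (ann n (\<Prod>S)) / card (GL n :: 'a mat set)"
  using assms
proof (induct S arbitrary: n rule: finite_induct)
  case empty
  show ?case
  proof (cases "n = 0")
    case True
    have "ann 0 1 = {0\<^sub>m 0 0 :: 'a mat}" by (auto simp: ann_def intro!: eq_matI)
    then show ?thesis using True by (simp add: card_GL gl_order_def)
  next
    case False
    have "(1\<^sub>m n :: 'a mat) \<noteq> 0\<^sub>m n n"
    proof
      assume "(1\<^sub>m n :: 'a mat) = 0\<^sub>m n n"
      from arg_cong[OF this, of "\<lambda>M. M $$ (0, 0)"] False show False by simp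
    qed
    then have "ann n (1 :: 'a poly) = {}" by (auto simp: ann_def)
    then show ?thesis using False by simp
  qed
next
  case (insert \<phi> S)
  have phi: "irreducible \<phi>" "coeff \<phi> (degree \<phi>) = 1" using insert by (auto simp: monic_irreducible_def)
  have cop: "coprime (\<Prod>S) \<phi>" by (rule coprime_prod_monic_irreducible) (use insert in auto)
  have "fps_nth (\<Prod>\<phi>\<in>insert \<phi> S. gl_fps CARD('a) (degree \<phi>)) n =
      (\<Sum>k\<le>n. fps_nth (gl_fps CARD('a) (degree \<phi>)) k * fps_nth (\<Prod>\<phi>\<in>S. gl_fps CARD('a) (degree \<phi>)) (n - k))"
    using insert by (simp add: fps_mult_nth atMost_atLeast0)
  also have "\<dots> = (\<Sum>k\<le>n. (card (ann (n - k) (\<Prod>S)) / card (GL (n - k) :: 'a mat set)) * (card (ann k \<phi>) / card (GL k :: 'a mat set)))"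
    using insert by (intro sum.cong refl) (simp add: gl_fps_def card_ann_irreducible[OF phi])
  also have "\<dots> = card (ann n (\<Prod>S * \<phi>)) / card (GL n :: 'a mat set)"
    by (rule card_ann_mult[OF cop, symmetric])
  finally show ?case using insert by (simp add: mult.commute)
qed

text \<open>Congruence to 1 modulo u^(n+1): such factors do not affect coefficients up to
  \<open>n\<close>.\<close>

definition fps_one_upto :: "nat \<Rightarrow> real fps \<Rightarrow> bool" where
  "fps_one_upto n G \<longleftrightarrow> fps_nth G 0 = 1 \<and> (\<forall>i. 0 < i \<and> i \<le> n \<longrightarrow> fps_nth G i = 0)"

lemma fps_nth_mult_one_upto:
  assumes "fps_one_upto n G" "j \<le> n"
  shows "fps_nth (F * G) j = fps_nth F j"
proof -
  have "fps_nth (F * G) j = (\<Sum>i=0..j. if i = j then fps_nth F j else 0)"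
    unfolding fps_mult_nth using assms by (intro sum.cong refl) (auto simp: fps_one_upto_def)
  then show ?thesis by simp
qed

lemma fps_one_upto_prod:
  assumes "\<And>x. x \<in> S \<Longrightarrow> fps_one_upto n (f x)"
  shows "fps_one_upto n (\<Prod>x\<in>S. f x)"
  using assms
proof (induct S rule: infinite_finite_induct)
  case (insert x S)
  have "fps_nth (prod f S * f x) j = fps_nth (prod f S) j" if "j \<le> n" for j
    using insert that by (intro fps_nth_mult_one_upto) auto
  then show ?case using insert by (auto simp: fps_one_upto_def mult.commute)
qed (auto simp: fps_one_upto_def)

lemma fps_nth_prod_subset:
  assumes "finite S" "T \<subseteq> S" "\<And>x. x \<in> S - T \<Longrightarrow> fps_one_upto n (f x)" "j \<le> n"
  shows "fps_nth (\<Prod>x\<in>S. f x) j = fps_nth (\<Prod>x\<in>T. f x) j"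
proof -
  have "(\<Prod>x\<in>S. f x) = (\<Prod>x\<in>T. f x) * (\<Prod>x\<in>S - T. f x)"
    using assms(1,2) by (metis mult.commute prod.subset_diff)
  then show ?thesis using fps_nth_mult_one_upto[OF fps_one_upto_prod[of "S - T" n f] assms(4)] assms(3) by simp
qed

lemma gl_order_0 [simp]: "gl_order Q 0 = 1" by (simp add: gl_order_def)

lemma fps_one_upto_gl_fps:
  assumes "n < d" shows "fps_one_upto n (gl_fps q d)"
proof -
  have "\<not> d dvd i" if "0 < i" "i \<le> n" for i using that assms by (auto dest: dvd_imp_le)
  then show ?thesis by (simp add: fps_one_upto_def gl_fps_def)
qed

text \<open>An annihilating set may be enlarged by all irreducibles of degree at most n. Members of
  degree above n do not change the number of annihilated matrices, and an inclusion between finite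
  sets of equal size is an equality; so one product annihilates every semisimple matrix.\<close>

theorem card_semisimple:
  "card {A \<in> carrier_mat n n. semisimple_mat (A :: 'a::{field,finite} mat)} =
    card (ann n (\<Prod>(irr_upto n :: 'a poly set)))"
proof -
  let ?I = "irr_upto n :: 'a poly set"
  have I: "\<forall>\<phi>\<in>?I. monic_irreducible \<phi>" by (auto simp: irr_upto_def)
  have "{A \<in> carrier_mat n n. semisimple_mat (A :: 'a mat)} = ann n (\<Prod>?I)"
  proof (intro equalityI subsetI)
    fix A :: "'a mat" assume "A \<in> {A \<in> carrier_mat n n. semisimple_mat A}"
    then obtain S where S: "finite S" "\<forall>\<phi>\<in>S. monic_irreducible \<phi>" and A: "A \<in> ann n (\<Prod>S)"
      using semisimple_iff_annihilated by blast
    let ?S = "S \<union> ?I"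
    have fin: "finite ?S" using S finite_irr_upto by auto
    have mi: "\<forall>\<phi>\<in>?S. monic_irreducible \<phi>" using S I by auto
    have mono: "ann n (\<Prod>T) \<subseteq> ann n (\<Prod>?S)" if "T \<subseteq> ?S" for T
    proof -
      have "\<Prod>?S = \<Prod>(?S - T) * \<Prod>T" by (rule prod.subset_diff[OF that fin])
      then show ?thesis by (auto intro: ann_mult_left)
    qed
    have "fps_nth (\<Prod>\<phi>\<in>?S. gl_fps CARD('a) (degree \<phi>)) n = fps_nth (\<Prod>\<phi>\<in>?I. gl_fps CARD('a) (degree \<phi>)) n"
    proof (rule fps_nth_prod_subset[OF fin _ _ order_refl])
      fix \<phi> assume "\<phi> \<in> ?S - ?I"
      then have "n < degree \<phi>" using S(2) by (auto simp: irr_upto_def not_le)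
      then show "fps_one_upto n (gl_fps CARD('a) (degree \<phi>))" by (rule fps_one_upto_gl_fps)
    qed simp
    then have "card (ann n (\<Prod>?S)) = card (ann n (\<Prod>?I))"
      unfolding fps_nth_prod_gl_fps[OF fin mi] fps_nth_prod_gl_fps[OF finite_irr_upto I]
      using card_GL_pos[where 'a='a and n=n] by simp
    then have "ann n (\<Prod>?I) = ann n (\<Prod>?S)"
      by (intro card_subset_eq finite_ann mono) auto
    moreover have "A \<in> ann n (\<Prod>?S)" using A mono[of S] by auto
    ultimately show "A \<in> ann n (\<Prod>?I)" by simp
  next
    fix A :: "'a mat" assume A: "A \<in> ann n (\<Prod>?I)"
    then show "A \<in> {A \<in> carrier_mat n n. semisimple_mat A}"
      using semisimple_iff_annihilated[OF annD(1)[OF A]] annD(1)[OF A] I finite_irr_upto by blast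
  qed
  then show ?thesis by simp
qed

section \<open>Monic polynomials with prescribed irreducible divisors and the Euler product\<close>

lemma monic_irreducible_divisor_exists:
  fixes f :: "'a::field poly"
  assumes "degree f > 0"
  shows "\<exists>\<psi>. monic_irreducible \<psi> \<and> \<psi> dvd f"
proof -
  define P where "P = (\<lambda>g. g dvd f \<and> degree g > 0)"
  have "P f" using assms by (simp add: P_def)
  from ex_has_least_nat[of P, OF this, of degree] obtain g where g: "P g"
    and min: "\<And>h. P h \<Longrightarrow> degree g \<le> degree h" by blast
  have dg: "degree g > 0" "g dvd f" using g by (auto simp: P_def)
  then have g0: "g \<noteq> 0" by auto
  define \<psi> where "\<psi> = Polynomial.smult (inverse (lead_coeff g)) g"
  have psi: "degree \<psi> = degree g" "lead_coeff \<psi> = 1" "\<psi> \<noteq> 0" using g0 by (auto simp: \<psi>_def)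
  have pd: "\<psi> dvd f" using dg(2) g0 by (simp add: \<psi>_def smult_dvd)
  have "irreducible \<psi>"
  proof (rule Factorial_Ring.irreducibleI)
    show "\<not> is_unit \<psi>" using psi dg by (simp add: is_unit_iff_degree)
    fix a b assume ab: "\<psi> = a * b"
    then have nz: "a \<noteq> 0" "b \<noteq> 0" using psi by auto
    then have deg: "degree g = degree a + degree b" using ab psi(1) degree_mult_eq[OF nz] by simp
    have "a dvd f" "b dvd f" using pd unfolding ab by (auto dest: dvd_mult_left dvd_mult_right)
    then have "degree a = 0 \<or> degree b = 0" using min[of a] min[of b] deg by (fastforce simp: P_def)
    then show "is_unit a \<or> is_unit b" using nz by (auto simp: is_unit_iff_degree)
  qed (use psi in auto)
  with psi pd show ?thesis unfolding monic_irreducible_def by blast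
qed

definition monics :: "'a::field poly set \<Rightarrow> nat \<Rightarrow> 'a poly set" where
  "monics S j = {f. lead_coeff f = 1 \<and> degree f = j \<and> (\<forall>\<psi>. monic_irreducible \<psi> \<longrightarrow> \<psi> dvd f \<longrightarrow> \<psi> \<in> S)}"

lemma finite_monics: "finite (monics S j :: 'a::{field,finite} poly set)"
  by (rule finite_subset[OF _ finite_polys_below[of "Suc j"]]) (auto simp: monics_def polys_below_iff)

lemma monics_empty: "monics {} j = (if j = 0 then {1} else {})"
proof -
  have 1: "f = 1" if "f \<in> monics {} j" for f
  proof -
    have "degree f = 0" using that monic_irreducible_divisor_exists[of f] by (auto simp: monics_def)
    then obtain c where "f = [:c:]" by (rule degree_eq_zeroE)
    then show ?thesis using that by (simp add: monics_def one_pCons)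
  qed
  have 2: "1 \<in> monics {} 0"
  proof -
    show ?thesis by (auto simp: monics_def dest: monic_irreducible_degree_pos)
  qed
  show ?thesis
  proof (cases "j = 0")
    case True
    then show ?thesis using 1 2 by auto
  next
    case False
    have "f \<notin> monics {} j" for f
    proof
      assume f: "f \<in> monics {} j"
      then have "degree f = j" by (simp add: monics_def)
      with 1[OF f] False show False by simp
    qed
    then show ?thesis using False by auto
  qed
qed

text \<open>Sorting by divisibility by \<open>\<phi>\<close> and removing one factor at a time
  expresses unique factorization as a recursion; in generating functions it is multiplication by the
  Euler factor of \<open>\<phi>\<close>.\<close>

lemma monics_insert:
  assumes phi: "monic_irreducible \<phi>" "\<phi> \<notin> S" and S: "\<forall>\<psi>\<in>S. monic_irreducible \<psi>"
  shows "monics (insert \<phi> S) j = monics S j \<union> (if degree \<phi> \<le> j then (*) \<phi> ` monics (insert \<phi> S) (j - degree \<phi>) else {})"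
    and "monics S j \<inter> (*) \<phi> ` B = {}"
proof -
  have prime: "prime_elem \<phi>" "\<And>\<psi>. monic_irreducible \<psi> \<Longrightarrow> prime_elem \<psi>"
    using phi by (auto simp: monic_irreducible_def intro: field_poly_irreducible_imp_prime)
  have lc: "lead_coeff \<phi> = 1" and phi0: "\<phi> \<noteq> 0" using phi by (auto simp: monic_irreducible_def)
  have nd: "\<not> \<phi> dvd f" if "f \<in> monics S j" for f j using that phi by (auto simp: monics_def)
  then show "monics S j \<inter> (*) \<phi> ` B = {}" by fastforce
  show "monics (insert \<phi> S) j = monics S j \<union> (if degree \<phi> \<le> j then (*) \<phi> ` monics (insert \<phi> S) (j - degree \<phi>) else {})"
  proof (intro equalityI subsetI)
    fix f assume f: "f \<in> monics (insert \<phi> S) j"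
    show "f \<in> monics S j \<union> (if degree \<phi> \<le> j then (*) \<phi> ` monics (insert \<phi> S) (j - degree \<phi>) else {})"
    proof (cases "\<phi> dvd f")
      case False
      then have "f \<in> monics S j" using f by (auto simp: monics_def)
      then show ?thesis by simp
    next
      case True
      then obtain g where g: "f = \<phi> * g" by (rule dvdE)
      have g0: "g \<noteq> 0" using f g by (auto simp: monics_def)
      have d: "degree f = degree \<phi> + degree g" unfolding g by (rule degree_mult_eq[OF phi0 g0])
      have "lead_coeff f = lead_coeff \<phi> * lead_coeff g" unfolding g by (rule lead_coeff_mult)
      then have "g \<in> monics (insert \<phi> S) (j - degree \<phi>)"
        using f d lc unfolding monics_def g by (auto intro: dvd_mult)
      with g have "f \<in> (*) \<phi> ` monics (insert \<phi> S) (j - degree \<phi>)" by (rule image_eqI)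
      moreover have "degree \<phi> \<le> j" using d f by (simp add: monics_def)
      ultimately show ?thesis by simp
    qed
  next
    fix f assume "f \<in> monics S j \<union> (if degree \<phi> \<le> j then (*) \<phi> ` monics (insert \<phi> S) (j - degree \<phi>) else {})"
    then consider "f \<in> monics S j" | g where "degree \<phi> \<le> j" "f = \<phi> * g" "g \<in> monics (insert \<phi> S) (j - degree \<phi>)"
      by (auto split: if_splits)
    then show "f \<in> monics (insert \<phi> S) j"
    proof cases
      case 1
      then show ?thesis by (auto simp: monics_def)
    next
      case 2
      have g0: "g \<noteq> 0" using 2 by (auto simp: monics_def)
      have "degree f = j" using 2 degree_mult_eq[OF phi0 g0] by (auto simp: monics_def)
      moreover have "lead_coeff f = 1" using 2 lc lead_coeff_mult[of \<phi> g] by (auto simp: monics_def)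
      moreover have "\<psi> \<in> insert \<phi> S" if "monic_irreducible \<psi>" "\<psi> dvd f" for \<psi>
      proof -
        have "\<psi> dvd \<phi> \<or> \<psi> dvd g" using prime(2)[OF that(1)] that(2) 2 by (auto dest: prime_elem_dvd_multD)
        then show ?thesis using monic_irreducible_dvd_imp_eq[OF that(1) phi(1)] 2 that by (auto simp: monics_def)
      qed
      ultimately show ?thesis by (simp add: monics_def)
    qed
  qed
qed

definition euler_fps :: "nat \<Rightarrow> nat \<Rightarrow> real fps" where
  "euler_fps q d = 1 - fps_const (1 / real q ^ d) * fps_X ^ d"

text \<open>The Euler product over \<open>S\<close>, a partial zeta function of the affine line. The
  argument is u / q instead of u, so that the full series is 1 / (1 - u).\<close>

definition monics_fps :: "'a::{field,finite} poly set \<Rightarrow> real fps" where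
  "monics_fps S = Abs_fps (\<lambda>j. card (monics S j) / real CARD('a) ^ j)"

lemma euler_mult_monics_insert:
  fixes \<phi> :: "'a::{field,finite} poly"
  assumes phi: "monic_irreducible \<phi>" "\<phi> \<notin> S" and S: "\<forall>\<psi>\<in>S. monic_irreducible \<psi>"
  shows "euler_fps CARD('a) (degree \<phi>) * monics_fps (insert \<phi> S) = monics_fps S"
proof (rule fps_ext)
  fix j
  let ?d = "degree \<phi>"
  have "card (monics (insert \<phi> S) j) = card (monics S j) +
      card (if ?d \<le> j then (*) \<phi> ` monics (insert \<phi> S) (j - ?d) else {})"
    by (subst monics_insert(1)[OF assms], subst card_Un_disjoint)
      (use monics_insert(2)[OF assms] finite_monics in \<open>auto intro!: finite_imageI\<close>)
  also have "card (if ?d \<le> j then (*) \<phi> ` monics (insert \<phi> S) (j - ?d) else {}) =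
      (if ?d \<le> j then card (monics (insert \<phi> S) (j - ?d)) else 0)"
    using phi by (auto intro!: card_image inj_onI simp: monic_irreducible_def)
  finally have card: "card (monics (insert \<phi> S) j) = card (monics S j) +
      (if ?d \<le> j then card (monics (insert \<phi> S) (j - ?d)) else 0)" .
  have q: "real CARD('a) > 0" using card_field_gt_1[where 'a='a] by simp
  have "fps_nth (euler_fps CARD('a) ?d * monics_fps (insert \<phi> S)) j =
    fps_nth (monics_fps (insert \<phi> S)) j - 1 / real CARD('a) ^ ?d * (if j < ?d then 0 else fps_nth (monics_fps (insert \<phi> S)) (j - ?d))"
    by (simp add: euler_fps_def left_diff_distrib mult.assoc fps_X_power_mult_nth)
  also have "\<dots> = fps_nth (monics_fps S) j"
  proof (cases "j < ?d")
    case True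
    then show ?thesis by (simp add: monics_fps_def card)
  next
    case False
    then have "real CARD('a) ^ ?d * real CARD('a) ^ (j - ?d) = real CARD('a) ^ j" by (simp flip: power_add)
    then show ?thesis using False by (simp add: monics_fps_def card add_divide_distrib)
  qed
  finally show "fps_nth (euler_fps CARD('a) ?d * monics_fps (insert \<phi> S)) j = fps_nth (monics_fps S) j" .
qed

lemma prod_euler_mult_monics:
  fixes S :: "'a::{field,finite} poly set"
  assumes "finite S" "\<forall>\<psi>\<in>S. monic_irreducible \<psi>"
  shows "(\<Prod>\<phi>\<in>S. euler_fps CARD('a) (degree \<phi>)) * monics_fps S = 1"
  using assms
proof (induct S rule: finite_induct)
  case empty
  show ?case by (rule fps_ext) (simp add: monics_fps_def monics_empty)
next
  case (insert \<phi> S)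
  have "(\<Prod>\<phi>\<in>insert \<phi> S. euler_fps CARD('a) (degree \<phi>)) * monics_fps (insert \<phi> S) =
    (\<Prod>\<phi>\<in>S. euler_fps CARD('a) (degree \<phi>)) * (euler_fps CARD('a) (degree \<phi>) * monics_fps (insert \<phi> S))"
    using insert by (simp add: mult_ac)
  also have "\<dots> = 1" using insert by (subst euler_mult_monics_insert) auto
  finally show ?case .
qed

lemma card_monic_of_degree:
  "card {f :: 'a::{field,finite} poly. lead_coeff f = 1 \<and> degree f = j} = CARD('a) ^ j"
proof -
  have "bij_betw (\<lambda>f. monom 1 j + f) (polys_below j) {f :: 'a poly. lead_coeff f = 1 \<and> degree f = j}"
  proof (rule bij_betwI[of _ _ _ "\<lambda>f. f - monom 1 j"])
    show "(\<lambda>f. monom 1 j + f) \<in> polys_below j \<rightarrow> {f :: 'a poly. lead_coeff f = 1 \<and> degree f = j}"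
    proof
      fix f :: "'a poly" assume f: "f \<in> polys_below j"
      have d: "degree (monom 1 j + f) = j"
      proof (rule antisym)
        show "degree (monom 1 j + f) \<le> j" using f by (intro degree_le) (auto simp: polys_below_def)
        show "j \<le> degree (monom 1 j + f)" using f by (intro le_degree) (auto simp: polys_below_def)
      qed
      with f show "monom 1 j + f \<in> {f. lead_coeff f = 1 \<and> degree f = j}" by (auto simp: polys_below_def)
    qed
    show "(\<lambda>f. f - monom 1 j) \<in> {f :: 'a poly. lead_coeff f = 1 \<and> degree f = j} \<rightarrow> polys_below j"
      by (auto simp: polys_below_def le_less coeff_eq_0)
  qed auto
  from bij_betw_same_card[OF this] show ?thesis by (simp add: card_polys_below)
qed

lemma monics_fps_le_1:
  fixes S :: "'a::{field,finite} poly set"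
  shows "fps_nth (monics_fps S) j \<le> 1" "0 \<le> fps_nth (monics_fps S) j"
proof -
  have fin: "finite {f :: 'a poly. lead_coeff f = 1 \<and> degree f = j}"
    by (rule card_ge_0_finite) (simp add: card_monic_of_degree)
  have "card (monics S j) \<le> card {f :: 'a poly. lead_coeff f = 1 \<and> degree f = j}"
    by (rule card_mono[OF fin]) (auto simp: monics_def)
  then have "real (card (monics S j)) \<le> real CARD('a) ^ j" by (simp add: card_monic_of_degree flip: of_nat_power)
  then show "fps_nth (monics_fps S) j \<le> 1" "0 \<le> fps_nth (monics_fps S) j"
    using card_field_gt_1[where 'a='a] by (simp_all add: monics_fps_def)
qed

text \<open>Up to degree \<open>D\<close> every monic polynomial qualifies, so the partial zeta
  function agrees with 1 / (1 - u) through the coefficient of u^D.\<close>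

lemma monics_fps_irr_upto:
  assumes "j \<le> D"
  shows "fps_nth (monics_fps (irr_upto D :: 'a::{field,finite} poly set)) j = 1"
proof -
  have "monics (irr_upto D) j = {f :: 'a poly. lead_coeff f = 1 \<and> degree f = j}"
  proof -
    have "degree \<psi> \<le> D" if "lead_coeff f = 1" "degree f = j" "\<psi> dvd f" for f \<psi> :: "'a poly"
    proof -
      have "f \<noteq> 0" using that by auto
      with that assms show ?thesis using dvd_imp_degree_le[of \<psi> f] by simp
    qed
    then show ?thesis by (auto simp: monics_def irr_upto_def)
  qed
  then show ?thesis using card_field_gt_1[where 'a='a] by (simp add: monics_fps_def card_monic_of_degree)
qed

section \<open>Local factors\<close>

definition local_fps :: "nat \<Rightarrow> nat \<Rightarrow> real fps" where
  "local_fps q d = euler_fps q d * gl_fps q d"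

text \<open>Multiplication by the partial zeta function, whose coefficients up to \<open>n\<close>
  are all 1, is summation of coefficients. A limit of coefficients thus becomes the sum of a
  series.\<close>

lemma fps_nth_prod_gl_irr_upto:
  "fps_nth (\<Prod>\<phi>\<in>(irr_upto n :: 'a::{field,finite} poly set). gl_fps CARD('a) (degree \<phi>)) n =
    (\<Sum>j\<le>n. fps_nth (\<Prod>\<phi>\<in>(irr_upto n :: 'a poly set). local_fps CARD('a) (degree \<phi>)) j)"
proof -
  let ?I = "irr_upto n :: 'a poly set"
  have "(\<Prod>\<phi>\<in>?I. gl_fps CARD('a) (degree \<phi>)) =
    (\<Prod>\<phi>\<in>?I. gl_fps CARD('a) (degree \<phi>)) * ((\<Prod>\<phi>\<in>?I. euler_fps CARD('a) (degree \<phi>)) * monics_fps ?I)"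
    by (subst prod_euler_mult_monics[OF finite_irr_upto]) (simp_all add: irr_upto_def)
  also have "\<dots> = (\<Prod>\<phi>\<in>?I. local_fps CARD('a) (degree \<phi>)) * monics_fps ?I"
    by (simp add: local_fps_def prod.distrib mult_ac)
  finally show ?thesis
    by (simp add: fps_mult_nth monics_fps_irr_upto atMost_atLeast0)
qed

lemma fps_nth_local_fps:
  assumes d: "d > 0"
  shows "fps_nth (local_fps q d) n = (if n = 0 then 1 else if d dvd n then
    1 / real (gl_order (q ^ d) (n div d)) - 1 / real q ^ d * (1 / real (gl_order (q ^ d) (n div d - 1))) else 0)"
proof -
  have e: "fps_nth (local_fps q d) n = fps_nth (gl_fps q d) n - 1 / real q ^ d * (if n < d then 0 else fps_nth (gl_fps q d) (n - d))"
    by (simp add: local_fps_def euler_fps_def left_diff_distrib mult.assoc fps_X_power_mult_nth)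
  show ?thesis
  proof (cases "n < d")
    case True
    then show ?thesis unfolding e using d by (auto simp: gl_fps_def dest: dvd_imp_le)
  next
    case False
    then have "d dvd n - d \<longleftrightarrow> d dvd n" "(n - d) div d = n div d - 1"
      using d by (auto simp: dvd_minus_self le_div_geq[of d n])
    with False show ?thesis unfolding e using d by (auto simp: gl_fps_def)
  qed
qed

lemma fps_one_upto_local_fps:
  assumes "n < d" shows "fps_one_upto n (local_fps q d)"
proof -
  have "\<not> d dvd i" if "0 < i" "i \<le> n" for i using that assms by (auto dest: dvd_imp_le)
  moreover have "d > 0" using assms by simp
  ultimately show ?thesis by (simp add: fps_one_upto_def fps_nth_local_fps)
qed

subsection \<open>The limit\<close>

definition fps_abs_summable :: "real \<Rightarrow> real fps \<Rightarrow> bool" where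
  "fps_abs_summable u F \<longleftrightarrow> summable (\<lambda>n. \<bar>fps_nth F n * u ^ n\<bar>)"

definition fps_value :: "real \<Rightarrow> real fps \<Rightarrow> real" where
  "fps_value u F = (\<Sum>n. fps_nth F n * u ^ n)"

lemma fps_abs_summable_mult:
  assumes F: "fps_abs_summable u F" and G: "fps_abs_summable u G"
  shows "fps_abs_summable u (F * G)" "fps_value u (F * G) = fps_value u F * fps_value u G"
proof -
  define a where "a n = fps_nth F n * u ^ n" for n
  define b where "b n = fps_nth G n * u ^ n" for n
  have ab: "summable (\<lambda>n. norm (a n))" "summable (\<lambda>n. norm (b n))"
    using F G by (simp_all add: fps_abs_summable_def a_def b_def)
  have nth: "fps_nth (F * G) n * u ^ n = (\<Sum>i\<le>n. a i * b (n - i))" for n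
    unfolding fps_mult_nth sum_distrib_right atMost_atLeast0
  proof (rule sum.cong[OF refl])
    fix i assume "i \<in> {0..n}"
    then have "u ^ n = u ^ i * u ^ (n - i)" by (simp flip: power_add)
    then show "fps_nth F i * fps_nth G (n - i) * u ^ n = a i * b (n - i)" by (simp add: a_def b_def)
  qed
  have "summable (\<lambda>n. \<Sum>i\<le>n. norm (a i) * norm (b (n - i)))"
    using ab by (intro summable_Cauchy_product) auto
  then show "fps_abs_summable u (F * G)"
    unfolding fps_abs_summable_def nth
    by (rule summable_comparison_test[rotated])
      (auto intro!: exI[of _ 0] sum_norm_le order_trans[OF sum_abs] sum_mono simp: abs_mult)
  show "fps_value u (F * G) = fps_value u F * fps_value u G"
    unfolding fps_value_def nth using Cauchy_product[OF ab] by (simp add: a_def b_def)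
qed

lemma fps_value_1: "fps_abs_summable u 1" "fps_value u 1 = 1"
proof -
  have "(\<lambda>n. fps_nth 1 n * u ^ n) sums 1"
    using sums_single[of 0 "\<lambda>_. 1 :: real"] by (rule sums_cong[THEN iffD1, rotated]) auto
  then show "fps_value u 1 = 1" unfolding fps_value_def by (rule sums_unique[symmetric])
  show "fps_abs_summable u 1" unfolding fps_abs_summable_def
    by (rule summable_finite[of "{0}"]) auto
qed

lemma fps_value_prod:
  assumes "\<And>x. x \<in> S \<Longrightarrow> fps_abs_summable u (f x)"
  shows "fps_abs_summable u (\<Prod>x\<in>S. f x) \<and> fps_value u (\<Prod>x\<in>S. f x) = (\<Prod>x\<in>S. fps_value u (f x))"
  using assms
  by (induct S rule: infinite_finite_induct) (auto simp: fps_value_1 fps_abs_summable_mult)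

text \<open>The majorant series. Its value at 1 is the sum of the absolute coefficients, a norm that
  is multiplicative on products of majorants.\<close>

definition fps_abs :: "real fps \<Rightarrow> real fps" where
  "fps_abs F = Abs_fps (\<lambda>n. \<bar>fps_nth F n\<bar>)"

lemma fps_nth_prod_abs:
  "\<bar>fps_nth (\<Prod>x\<in>S. f x) j\<bar> \<le> fps_nth (\<Prod>x\<in>S. fps_abs (f x)) j"
proof (induct S arbitrary: j rule: infinite_finite_induct)
  case (insert x S)
  have "\<bar>fps_nth (prod f S * f x) j\<bar> \<le> (\<Sum>i=0..j. \<bar>fps_nth (prod f S) i\<bar> * \<bar>fps_nth (f x) (j - i)\<bar>)"
    unfolding fps_mult_nth by (rule order_trans[OF sum_abs]) (simp add: abs_mult)
  also have "\<dots> \<le> (\<Sum>i=0..j. fps_nth (\<Prod>x\<in>S. fps_abs (f x)) i * fps_nth (fps_abs (f x)) (j - i))"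
    using insert by (intro sum_mono mult_mono) (auto simp: fps_abs_def intro: order_trans[OF abs_ge_zero])
  also have "\<dots> = fps_nth ((\<Prod>x\<in>S. fps_abs (f x)) * fps_abs (f x)) j" by (simp add: fps_mult_nth)
  finally show ?case using insert by (simp add: mult.commute)
qed auto

lemma fps_nth_prod_abs_nonneg: "0 \<le> fps_nth (\<Prod>x\<in>S. fps_abs (f x)) j"
  using fps_nth_prod_abs[of f S j] by (rule order_trans[OF abs_ge_zero])

lemma fps_nth_prod_at_0: "fps_nth (\<Prod>x\<in>S. f x) 0 = (\<Prod>x\<in>S. fps_nth (f x) 0)"
  by (induct S rule: infinite_finite_induct) auto

text \<open>The additional factors have nonnegative coefficients and constant term 1, so multiplying
  by them can only increase a coefficient.\<close>

lemma fps_nth_prod_abs_mono: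
  assumes "finite T" "S \<subseteq> T" "\<And>x. x \<in> T \<Longrightarrow> fps_nth (f x) 0 = 1"
  shows "fps_nth (\<Prod>x\<in>S. fps_abs (f x)) j \<le> fps_nth (\<Prod>x\<in>T. fps_abs (f x)) j"
proof -
  let ?G = "\<Prod>x\<in>T - S. fps_abs (f x)"
  have "fps_nth ?G 0 = (\<Prod>x\<in>T - S. fps_nth (fps_abs (f x)) 0)"
    by (rule fps_nth_prod_at_0)
  also have "\<dots> = 1" using assms(3) by (intro prod.neutral) (auto simp: fps_abs_def)
  finally have G0: "fps_nth ?G 0 = 1" .
  have "fps_nth (\<Prod>x\<in>S. fps_abs (f x)) j = (\<Sum>i\<in>{j}. fps_nth (\<Prod>x\<in>S. fps_abs (f x)) i * fps_nth ?G (j - i))"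
    using G0 by simp
  also have "\<dots> \<le> (\<Sum>i=0..j. fps_nth (\<Prod>x\<in>S. fps_abs (f x)) i * fps_nth ?G (j - i))"
    by (intro sum_mono2) (auto intro!: mult_nonneg_nonneg fps_nth_prod_abs_nonneg)
  also have "\<dots> = fps_nth ((\<Prod>x\<in>S. fps_abs (f x)) * ?G) j" by (simp add: fps_mult_nth)
  also have "(\<Prod>x\<in>S. fps_abs (f x)) * ?G = (\<Prod>x\<in>T. fps_abs (f x))"
    using assms(1,2) prod.subset_diff[of S T "\<lambda>x. fps_abs (f x)"] by (simp add: mult.commute)
  finally show ?thesis .
qed

lemma fps_abs_summable_fps_abs: "fps_abs_summable u (fps_abs F) \<longleftrightarrow> fps_abs_summable u F"
  by (simp add: fps_abs_summable_def fps_abs_def abs_mult)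

lemma fps_one_upto_abs: "fps_one_upto n F \<Longrightarrow> fps_one_upto n (fps_abs F)"
  by (auto simp: fps_one_upto_def fps_abs_def)

section \<open>Size of the local factors\<close>

lemma gl_order_eq_qpoch:
  assumes "Q > 0"
  shows "real (gl_order Q m) = real Q ^ (m * m) * qpoch (1 / real Q) m"
proof -
  have "real (gl_order Q m) = (\<Prod>i<m. real Q ^ m - real Q ^ i)"
    unfolding gl_order_def of_nat_prod using assms by (intro prod.cong refl) (simp add: of_nat_diff power_increasing)
  also have "\<dots> = (\<Prod>i<m. real Q ^ m * (1 - (1 / real Q) ^ Suc i))"
  proof (rule prod.reindex_bij_witness[of _ "\<lambda>i. m - Suc i" "\<lambda>i. m - Suc i"])
    fix i assume "i \<in> {..<m}"
    then have "real Q ^ m = real Q ^ (Suc (m - Suc i) + i)" by simp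
    then have "real Q ^ m = real Q ^ Suc (m - Suc i) * real Q ^ i" unfolding power_add .
    then have "real Q ^ m * (1 / real Q) ^ Suc (m - Suc i) = real Q ^ i"
      using assms by (simp only: power_one_over) simp
    then show "real Q ^ m * (1 - (1 / real Q) ^ Suc (m - Suc i)) = real Q ^ m - real Q ^ i"
      by (simp only: right_diff_distrib mult_1_right)
  qed auto
  also have "\<dots> = real Q ^ (m * m) * qpoch (1 / real Q) m"
    by (simp add: prod.distrib qpoch_def power_mult)
  finally show ?thesis .
qed

text \<open>The right-hand side is the summand of the Rogers-Ramanujan series at x = 1 / Q.\<close>

lemma inverse_gl_order:
  assumes "Q > 0"
  shows "1 / real (gl_order Q m) = (1 / real Q) ^ (m * m) / qpoch (1 / real Q) m"
  using assms by (simp add: gl_order_eq_qpoch power_one_over)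

text \<open>Every factor of the order is at least Q^m, which is enough for m > 0. The 2 absorbs the
  case m = 0, where the order is Q - 1.\<close>

lemma gl_order_Suc_ge:
  assumes "Q \<ge> 2"
  shows "2 * gl_order Q (Suc m) \<ge> Q ^ Suc m"
proof (cases m)
  case 0
  then show ?thesis using assms by (simp add: gl_order_def)
next
  case (Suc k)
  have "Q ^ m \<le> Q ^ Suc m - Q ^ i" if "i < Suc m" for i
  proof -
    have "Q ^ i \<le> Q ^ m" using that assms by (intro power_increasing) auto
    moreover have "2 * Q ^ m \<le> Q ^ Suc m" using assms by simp
    ultimately show ?thesis by linarith
  qed
  then have "(\<Prod>i<Suc m. Q ^ m) \<le> gl_order Q (Suc m)" unfolding gl_order_def by (intro prod_mono) auto
  then have "Q ^ (m * Suc m) \<le> gl_order Q (Suc m)" by (simp add: power_mult power_add mult.commute)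
  moreover have "Q ^ Suc m \<le> Q ^ (m * Suc m)" using assms Suc by (intro power_increasing) auto
  ultimately show ?thesis by linarith
qed

lemma inverse_gl_order_le:
  assumes "Q \<ge> 2"
  shows "1 / real (gl_order Q (Suc m)) \<le> 2 * (1 / real Q) ^ Suc m"
proof -
  have g: "real Q ^ Suc m \<le> 2 * real (gl_order Q (Suc m))"
    using of_nat_mono[OF gl_order_Suc_ge[OF assms, of m], where 'a=real] by simp
  have "real Q ^ Suc m > 0" using assms by simp
  moreover from this g have "real (gl_order Q (Suc m)) > 0" by linarith
  ultimately have "1 / real (gl_order Q (Suc m)) \<le> 2 / real Q ^ Suc m"
    using g by (simp add: field_simps)
  then show ?thesis by (simp add: power_one_over)
qed

text \<open>The Euler factor cancels the leading term of 1 / (Q - 1) and leaves order Q^-2, as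
  summation over the up to q^d irreducibles of degree d requires. For m > 0 both terms lie between 0
  and 2 Q^(-m-1), and Q^(-m-1) <= Q^-2 2^(1-m) gives the constant 4.\<close>

lemma local_coeff_bound:
  assumes Q: "Q \<ge> 2"
  shows "\<bar>1 / real (gl_order Q (Suc m)) - 1 / real Q * (1 / real (gl_order Q m))\<bar> \<le> 4 * (1 / real Q)\<^sup>2 * (1 / 2) ^ m"
proof (cases m)
  case 0
  have "1 / (real Q - 1) - 1 / real Q = 1 / (real Q * (real Q - 1))" using Q by (simp add: field_simps)
  moreover have "real Q * real Q \<le> 4 * (real Q * (real Q - 1))" using Q by (simp add: algebra_simps)
  then have "1 / (real Q * (real Q - 1)) \<le> 4 / (real Q * real Q)" using Q by (simp add: field_simps)
  moreover have "1 / (real Q * (real Q - 1)) \<ge> 0" using Q by simp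
  ultimately show ?thesis using 0 Q by (simp add: gl_order_def power2_eq_square of_nat_diff)
next
  case (Suc k)
  let ?x = "1 / real Q"
  have x: "0 \<le> ?x" "?x \<le> 1 / 2" using Q by (auto simp: field_simps)
  have p: "?x ^ k \<le> (1 / 2) ^ k" using x by (intro power_mono)
  have e: "?x ^ Suc (Suc k) = ?x\<^sup>2 * ?x ^ k" by (simp add: power2_eq_square)
  have b: "2 * ?x ^ Suc (Suc k) \<le> 2 * (?x\<^sup>2 * (1 / 2) ^ k)"
    unfolding e using p by (intro mult_left_mono) auto
  have a1: "1 / real (gl_order Q (Suc m)) \<le> 2 * ?x ^ Suc (Suc k)"
    using inverse_gl_order_le[OF Q, of m] Suc by simp
  have "?x * (1 / real (gl_order Q m)) \<le> ?x * (2 * ?x ^ Suc k)"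
    using inverse_gl_order_le[OF Q, of k] Suc x by (intro mult_left_mono) auto
  also have "\<dots> = 2 * ?x ^ Suc (Suc k)" by simp
  finally have a2: "?x * (1 / real (gl_order Q m)) \<le> 2 * ?x ^ Suc (Suc k)" .
  have "\<bar>1 / real (gl_order Q (Suc m)) - ?x * (1 / real (gl_order Q m))\<bar> \<le> 2 * ?x ^ Suc (Suc k)"
    using a1 a2 x by (intro abs_leI) (auto intro: order_trans[rotated])
  also note b
  also have "2 * (?x\<^sup>2 * (1 / 2) ^ k) = 4 * ?x\<^sup>2 * (1 / 2) ^ m" using Suc by simp
  finally show ?thesis .
qed

lemma sums_multiples:
  fixes f :: "nat \<Rightarrow> real"
  assumes d: "d > 0" and "\<And>n. \<not> d dvd n \<Longrightarrow> f n = 0"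
  shows "(\<lambda>m. f (d * m)) sums c \<longleftrightarrow> f sums c" "summable (\<lambda>m. f (d * m)) \<longleftrightarrow> summable f"
proof -
  have "strict_mono (\<lambda>m. d * m)" using d by (auto simp: strict_mono_def)
  then have s: "(\<lambda>m. f (d * m)) sums c \<longleftrightarrow> f sums c" for c
    by (rule sums_mono_reindex) (use assms(2) in \<open>auto elim!: dvdE\<close>)
  then show "(\<lambda>m. f (d * m)) sums c \<longleftrightarrow> f sums c" "summable (\<lambda>m. f (d * m)) \<longleftrightarrow> summable f"
    by (auto simp: summable_def)
qed

text \<open>The 8 is the 4 of \<open>local_coeff_bound\<close> times the sum 2 of the geometric
  series.\<close>

lemma local_fps_norm:
  assumes q: "q \<ge> 2" and d: "d > 0"
  shows "fps_abs_summable 1 (local_fps q d)"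
    and "fps_value 1 (fps_abs (local_fps q d)) \<le> 1 + 8 * (1 / real (q ^ d))\<^sup>2"
proof -
  define Q where "Q = q ^ d"
  have Q: "Q \<ge> 2" using q d self_le_power[of q d] by (simp add: Q_def)
  define f where "f n = \<bar>fps_nth (local_fps q d) n\<bar>" for n
  have f: "f (d * Suc m) = \<bar>1 / real (gl_order Q (Suc m)) - 1 / real Q * (1 / real (gl_order Q m))\<bar>" for m
    using d by (simp add: f_def fps_nth_local_fps Q_def)
  have f0: "f 0 = 1" using d by (simp add: f_def fps_nth_local_fps)
  have nd: "f n = 0" if "\<not> d dvd n" for n using that d by (cases "n = 0") (auto simp: f_def fps_nth_local_fps)
  have g: "summable (\<lambda>m. 4 * (1 / real Q)\<^sup>2 * (1 / 2) ^ m)"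
    by (intro summable_mult summable_geometric) simp
  have s: "summable (\<lambda>m. f (d * Suc m))"
    by (rule summable_comparison_test'[OF g]) (simp only: f real_norm_def abs_abs local_coeff_bound[OF Q])
  then have s': "summable (\<lambda>m. f (d * m))" by (subst summable_Suc_iff[symmetric])
  then have sf: "summable f" using sums_multiples(2)[where f=f, OF d nd] by simp
  then show "fps_abs_summable 1 (local_fps q d)" by (simp add: fps_abs_summable_def f_def[abs_def])
  have "(\<Sum>m. f (d * Suc m)) \<le> (\<Sum>m. 4 * (1 / real Q)\<^sup>2 * (1 / 2) ^ m)"
    by (rule suminf_le[OF _ s g]) (simp only: f local_coeff_bound[OF Q])
  also have "\<dots> = 4 * (1 / real Q)\<^sup>2 * (\<Sum>m. (1 / 2) ^ m)"
    by (intro suminf_mult summable_geometric) simp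
  also have "\<dots> = 8 * (1 / real Q)\<^sup>2" by (simp add: suminf_geometric)
  finally have le: "(\<Sum>m. f (d * Suc m)) \<le> 8 * (1 / real Q)\<^sup>2" .
  have "suminf f = (\<Sum>m. f (d * m))"
    using sums_multiples(1)[where f=f, OF d nd, of "\<Sum>m. f (d * m)"] summable_sums[OF s'] sums_unique by metis
  also have "\<dots> = 1 + (\<Sum>m. f (d * Suc m))" using suminf_split_head[OF s'] f0 by simp
  finally have "suminf f \<le> 1 + 8 * (1 / real Q)\<^sup>2" using le by simp
  moreover have "fps_value 1 (fps_abs (local_fps q d)) = suminf f"
    by (simp add: fps_value_def fps_abs_def f_def[abs_def])
  ultimately show "fps_value 1 (fps_abs (local_fps q d)) \<le> 1 + 8 * (1 / real (q ^ d))\<^sup>2"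
    by (simp add: Q_def)
qed

lemma fps_value_euler:
  assumes "d > 0"
  shows "fps_abs_summable u (euler_fps q d)" "fps_value u (euler_fps q d) = 1 - (u / real q) ^ d"
proof -
  have nth: "fps_nth (euler_fps q d) n = (if n = 0 then 1 else if n = d then - 1 / real q ^ d else 0)" for n
    using assms by (auto simp: euler_fps_def fps_X_power_nth)
  show "fps_abs_summable u (euler_fps q d)"
    unfolding fps_abs_summable_def by (rule summable_finite[of "{0, d}"]) (auto simp: nth)
  have "fps_value u (euler_fps q d) = (\<Sum>n\<in>{0, d}. fps_nth (euler_fps q d) n * u ^ n)"
    unfolding fps_value_def by (rule suminf_finite) (auto simp: nth)
  also have "\<dots> = 1 - (u / real q) ^ d" using assms by (simp add: nth power_divide)
  finally show "fps_value u (euler_fps q d) = 1 - (u / real q) ^ d" .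
qed

lemma fps_value_local:
  assumes q: "q \<ge> 2" and d: "d > 0"
  shows "fps_value 1 (local_fps q d) = (1 - 1 / real (q ^ d)) * (\<Sum>m. (1 / real (q ^ d)) ^ (m * m) / qpoch (1 / real (q ^ d)) m)"
proof -
  define Q where "Q = q ^ d"
  have Q: "Q \<ge> 2" using q d self_le_power[of q d] by (simp add: Q_def)
  let ?x = "1 / real Q"
  have x: "0 < ?x" "?x < 1" using Q by (auto simp: field_simps)
  define f where "f n = fps_nth (gl_fps q d) n" for n
  have f: "f (d * m) = ?x ^ (m * m) / qpoch ?x m" for m
    using d Q inverse_gl_order[of Q m] by (simp add: f_def gl_fps_def flip: Q_def)
  have nd: "f n = 0" if "\<not> d dvd n" for n using that by (simp add: f_def gl_fps_def)
  have sm: "(\<lambda>m. f (d * m)) sums (\<Sum>m. ?x ^ (m * m) / qpoch ?x m)"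
    unfolding f by (rule summable_sums[OF rogers_ramanujan(1)[OF x]])
  have "f sums (\<Sum>m. ?x ^ (m * m) / qpoch ?x m)" using sums_multiples(1)[where f=f, OF d nd] sm by blast
  moreover have "f n \<ge> 0" for n by (simp add: f_def gl_fps_def)
  ultimately have "fps_abs_summable 1 (gl_fps q d)" "fps_value 1 (gl_fps q d) = (\<Sum>m. ?x ^ (m * m) / qpoch ?x m)"
    by (auto simp: fps_abs_summable_def fps_value_def f_def[abs_def] sums_iff)
  then show ?thesis
    using fps_abs_summable_mult(2)[OF fps_value_euler(1)[OF d] \<open>fps_abs_summable 1 (gl_fps q d)\<close>, of q]
      fps_value_euler(2)[OF d, of 1 q]
    by (simp add: local_fps_def Q_def power_one_over)
qed

section \<open>Partial zeta values at real arguments\<close>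

lemma card_ge_2: "CARD('a::{field,finite}) \<ge> 2"
  using card_field_gt_1[where 'a='a] by simp

text \<open>The distribution of irreducibles enters the analysis here, through the number q^j of
  monic polynomials of degree j. The last two bounds are uniform in \<open>D\<close>, so they can
  serve for domination.\<close>

lemma monics_value:
  fixes u :: real
  assumes u: "0 \<le> u" "u < 1"
  shows "fps_abs_summable u (monics_fps (irr_upto D :: 'a::{field,finite} poly set))"
    and "(\<Prod>\<phi>\<in>(irr_upto D :: 'a poly set). 1 - (u / CARD('a)) ^ degree \<phi>) * fps_value u (monics_fps (irr_upto D :: 'a poly set)) = 1"
    and "fps_value u (monics_fps (irr_upto D :: 'a poly set)) \<le> 1 / (1 - u)"
    and "1 \<le> fps_value u (monics_fps (irr_upto D :: 'a poly set))"
proof -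
  let ?I = "irr_upto D :: 'a poly set"
  have g: "summable (\<lambda>n. u ^ n)" using u by (intro summable_geometric) simp
  have le: "\<bar>fps_nth (monics_fps ?I) n * u ^ n\<bar> \<le> u ^ n" for n
    using monics_fps_le_1[of ?I n] u by (simp add: abs_mult mult_left_le_one_le)
  show abs: "fps_abs_summable u (monics_fps ?I)"
    unfolding fps_abs_summable_def by (rule summable_comparison_test'[OF g]) (use le in simp)
  then have sm: "summable (\<lambda>n. fps_nth (monics_fps ?I) n * u ^ n)"
    unfolding fps_abs_summable_def by (rule summable_rabs_cancel)
  have "fps_value u (monics_fps ?I) \<le> (\<Sum>n. u ^ n)"
    unfolding fps_value_def by (rule suminf_le[OF _ sm g]) (use le abs_le_D1 in blast)
  then show "fps_value u (monics_fps ?I) \<le> 1 / (1 - u)" using u by (simp add: suminf_geometric)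
  have "(\<Sum>n\<in>{0}. fps_nth (monics_fps ?I) n * u ^ n) \<le> fps_value u (monics_fps ?I)"
    unfolding fps_value_def by (rule sum_le_suminf[OF sm]) (auto intro!: mult_nonneg_nonneg monics_fps_le_1 zero_le_power u)
  then show "1 \<le> fps_value u (monics_fps ?I)" by (simp add: monics_fps_irr_upto)
  have E: "fps_abs_summable u (\<Prod>\<phi>\<in>?I. euler_fps CARD('a) (degree \<phi>)) \<and>
    fps_value u (\<Prod>\<phi>\<in>?I. euler_fps CARD('a) (degree \<phi>)) = (\<Prod>\<phi>\<in>?I. fps_value u (euler_fps CARD('a) (degree \<phi>)))"
    by (rule fps_value_prod) (auto simp: irr_upto_def intro!: fps_value_euler monic_irreducible_degree_pos)
  have "fps_value u ((\<Prod>\<phi>\<in>?I. euler_fps CARD('a) (degree \<phi>)) * monics_fps ?I) = 1"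
    by (subst prod_euler_mult_monics[OF finite_irr_upto]) (simp_all add: irr_upto_def fps_value_1)
  then have "(\<Prod>\<phi>\<in>?I. fps_value u (euler_fps CARD('a) (degree \<phi>))) * fps_value u (monics_fps ?I) = 1"
    using fps_abs_summable_mult(2)[OF conjunct1[OF E] abs] E by simp
  moreover have "(\<Prod>\<phi>\<in>?I. fps_value u (euler_fps CARD('a) (degree \<phi>))) = (\<Prod>\<phi>\<in>?I. 1 - (u / CARD('a)) ^ degree \<phi>)"
    by (intro prod.cong refl fps_value_euler) (auto simp: irr_upto_def intro: monic_irreducible_degree_pos)
  ultimately show "(\<Prod>\<phi>\<in>?I. 1 - (u / CARD('a)) ^ degree \<phi>) * fps_value u (monics_fps ?I) = 1" by simp
qed

lemma monics_value_tendsto: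
  fixes u :: real
  assumes u: "0 \<le> u" "u < 1"
  shows "(\<lambda>D. fps_value u (monics_fps (irr_upto D :: 'a::{field,finite} poly set))) \<longlonglongrightarrow> 1 / (1 - u)"
proof -
  have "(\<lambda>D. \<Sum>n. fps_nth (monics_fps (irr_upto D :: 'a poly set)) n * u ^ n) \<longlonglongrightarrow> (\<Sum>n. u ^ n)"
  proof (rule conjunct2[OF conjunct2[OF tannerys_theorem[where M="\<lambda>n. u ^ n"]]])
    show "(\<lambda>D. fps_nth (monics_fps (irr_upto D :: 'a poly set)) n * u ^ n) \<longlonglongrightarrow> u ^ n" for n
      by (rule tendsto_eventually) (auto simp: eventually_at_top_linorder monics_fps_irr_upto intro!: exI[of _ n])
    show "eventually (\<lambda>(n, D). norm (fps_nth (monics_fps (irr_upto D :: 'a poly set)) n * u ^ n) \<le> u ^ n) (at_top \<times>\<^sub>F at_top)"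
      using u monics_fps_le_1[where 'a='a] by (intro always_eventually) (auto simp: abs_mult intro!: mult_left_le_one_le)
    show "summable (\<lambda>n. u ^ n)" using u by (intro summable_geometric) simp
  qed simp
  then show ?thesis using u by (simp add: fps_value_def suminf_geometric)
qed

text \<open>With t = q^(-2 d) a factor is at most 1 + 8 t, hence at most (1 / (1 - t))^8 by
  Bernoulli. The product of the 1 / (1 - t) is the partial zeta value at u = 1 / q, which is at most
  2.\<close>

lemma prod_local_norm_le:
  "(\<Prod>\<phi>\<in>(irr_upto D :: 'a::{field,finite} poly set). fps_value 1 (fps_abs (local_fps CARD('a) (degree \<phi>)))) \<le> 2 ^ 8"
proof -
  let ?I = "irr_upto D :: 'a poly set"
  define q where "q = real CARD('a)"
  have q: "q \<ge> 2" using card_ge_2[where 'a='a] by (simp add: q_def)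
  define u where "u = 1 / q"
  have u: "0 \<le> u" "u < 1" "u \<le> 1 / 2" using q by (auto simp: u_def field_simps)
  have le: "fps_value 1 (fps_abs (local_fps CARD('a) (degree \<phi>))) \<le> (1 / (1 - (u / q) ^ degree \<phi>)) ^ 8"
    and ge: "0 \<le> fps_value 1 (fps_abs (local_fps CARD('a) (degree \<phi>)))"
    if "\<phi> \<in> ?I" for \<phi>
  proof -
    have d: "degree \<phi> > 0" using that by (auto simp: irr_upto_def intro: monic_irreducible_degree_pos)
    define t where "t = (u / q) ^ degree \<phi>"
    have t: "(1 / real (CARD('a) ^ degree \<phi>))\<^sup>2 = t"
      by (simp add: t_def u_def q_def power_divide power2_eq_square power_mult_distrib)
    have "u / q < 1" "0 < u / q" using q less_1_mult[of q q] by (auto simp: u_def field_simps)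
    then have t01: "0 < t" "t < 1" using d by (auto simp: t_def power_less_one_iff)
    have "fps_value 1 (fps_abs (local_fps CARD('a) (degree \<phi>))) \<le> 1 + 8 * t"
      using local_fps_norm(2)[OF card_ge_2[where 'a='a] d] unfolding t .
    also have "\<dots> \<le> 1 + real 8 * (t / (1 - t))" using t01 by (simp add: field_simps)
    also have "\<dots> \<le> (1 + t / (1 - t)) ^ 8" using t01 by (intro Bernoulli_inequality) (auto intro: order_trans[of _ 0])
    also have "1 + t / (1 - t) = 1 / (1 - t)" using t01 by (simp add: field_simps)
    finally show "fps_value 1 (fps_abs (local_fps CARD('a) (degree \<phi>))) \<le> (1 / (1 - (u / q) ^ degree \<phi>)) ^ 8"
      by (simp add: t_def)
    have "summable (\<lambda>n. fps_nth (fps_abs (local_fps CARD('a) (degree \<phi>))) n * 1 ^ n)"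
      using local_fps_norm(1)[OF card_ge_2[where 'a='a] d] by (simp add: fps_abs_summable_def fps_abs_def)
    then show "0 \<le> fps_value 1 (fps_abs (local_fps CARD('a) (degree \<phi>)))"
      unfolding fps_value_def by (rule suminf_nonneg) (simp add: fps_abs_def)
  qed
  have "(\<Prod>\<phi>\<in>?I. fps_value 1 (fps_abs (local_fps CARD('a) (degree \<phi>)))) \<le> (\<Prod>\<phi>\<in>?I. (1 / (1 - (u / q) ^ degree \<phi>)) ^ 8)"
    by (intro prod_mono) (use le ge in auto)
  also have "\<dots> = (1 / (\<Prod>\<phi>\<in>?I. 1 - (u / q) ^ degree \<phi>)) ^ 8"
    by (simp only: prod_power_distrib[symmetric] prod_dividef prod.neutral_const)
  also have "1 / (\<Prod>\<phi>\<in>?I. 1 - (u / q) ^ degree \<phi>) = fps_value u (monics_fps ?I)"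
    using inverse_unique[OF monics_value(2)[OF u(1,2), of D, where 'a='a]]
    by (simp only: q_def inverse_eq_divide)
  also have "\<dots> ^ 8 \<le> 2 ^ 8"
  proof (rule power_mono)
    have "1 / (1 - u) \<le> 2" using u by (simp add: field_simps)
    with monics_value(3)[OF u(1,2), of D, where 'a='a] show "fps_value u (monics_fps ?I) \<le> 2" by linarith
    show "0 \<le> fps_value u (monics_fps ?I)" using monics_value(4)[OF u(1,2), of D, where 'a='a] by linarith
  qed
  finally show ?thesis .
qed

text \<open>Factors of degree above \<open>j\<close> do not affect the coefficient of \<open>u\<^sup>j\<close>, so this is the coefficient of
  the infinite product.\<close>

definition limit_coeff :: "'a::{field,finite} itself \<Rightarrow> nat \<Rightarrow> real" where
  "limit_coeff _ j = fps_nth (\<Prod>\<phi>\<in>(irr_upto j :: 'a poly set). local_fps CARD('a) (degree \<phi>)) j"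

lemma fps_nth_prod_irr_upto_stable:
  assumes "\<And>\<phi> :: 'a::{field,finite} poly. j < degree \<phi> \<Longrightarrow> fps_one_upto j (f \<phi>)" "j \<le> D"
  shows "fps_nth (\<Prod>\<phi>\<in>irr_upto D. f \<phi>) j = fps_nth (\<Prod>\<phi>\<in>irr_upto j. f \<phi>) j"
proof (rule fps_nth_prod_subset[OF finite_irr_upto irr_upto_mono[OF assms(2)] _ order_refl])
  fix \<phi> :: "'a poly" assume "\<phi> \<in> irr_upto D - irr_upto j"
  then show "fps_one_upto j (f \<phi>)" by (intro assms(1)) (auto simp: irr_upto_def)
qed

text \<open>The limit over \<open>D\<close> is taken coefficient by coefficient under the majorant
  \<open>c' j j\<close>. The latter is summable because its partial sums are bounded by values of
  finite products, uniformly by \<open>prod_local_norm_le\<close>.\<close>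

lemma limit_coeff_sums:
  "(\<lambda>D. \<Prod>\<phi>\<in>(irr_upto D :: 'a::{field,finite} poly set). fps_value 1 (local_fps CARD('a) (degree \<phi>)))
    \<longlonglongrightarrow> suminf (limit_coeff TYPE('a)) \<and> summable (limit_coeff TYPE('a))"
proof -
  let ?H = "\<lambda>\<phi> :: 'a poly. local_fps CARD('a) (degree \<phi>)"
  define c where "c j D = fps_nth (\<Prod>\<phi>\<in>irr_upto D. ?H \<phi>) j" for j D
  define c' where "c' j D = fps_nth (\<Prod>\<phi>\<in>irr_upto D. fps_abs (?H \<phi>)) j" for j D
  have H: "fps_abs_summable 1 (?H \<phi>)" if "\<phi> \<in> irr_upto D" for \<phi> D
    using that by (intro local_fps_norm(1) card_ge_2) (auto simp: irr_upto_def intro: monic_irreducible_degree_pos)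
  have H0: "fps_nth (?H \<phi>) 0 = 1" if "\<phi> \<in> irr_upto D" for \<phi> D
    using that by (subst fps_nth_local_fps) (auto simp: irr_upto_def intro: monic_irreducible_degree_pos)
  have cstab: "c j D = c j j" "c' j D = c' j j" if "j \<le> D" for j D
    unfolding c_def c'_def using that
    by (auto intro!: fps_nth_prod_irr_upto_stable fps_one_upto_local_fps fps_one_upto_abs)
  have c'0: "c' j D \<ge> 0" for j D by (simp add: c'_def fps_nth_prod_abs_nonneg)
  have bound: "\<bar>c j D\<bar> \<le> c' j j" for j D
  proof -
    have "\<bar>c j D\<bar> \<le> c' j D" unfolding c_def c'_def by (rule fps_nth_prod_abs)
    \<comment> \<open>\<open>D\<close> may be smaller than \<open>j\<close>; it is first enlarged to
      the maximum, where the coefficient is already stable.\<close>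
    also have "\<dots> \<le> c' j (max j D)" unfolding c'_def
      by (rule fps_nth_prod_abs_mono[OF finite_irr_upto irr_upto_mono H0]) auto
    also have "\<dots> = c' j j" by (rule cstab(2)) simp
    finally show ?thesis .
  qed
  have A: "fps_abs_summable 1 (\<Prod>\<phi>\<in>irr_upto D. fps_abs (?H \<phi>)) \<and>
    fps_value 1 (\<Prod>\<phi>\<in>irr_upto D. fps_abs (?H \<phi>)) = (\<Prod>\<phi>\<in>irr_upto D. fps_value 1 (fps_abs (?H \<phi>)))" for D
    by (rule fps_value_prod) (simp add: fps_abs_summable_fps_abs H)
  have M: "summable (\<lambda>j. c' j j)"
  proof (rule summableI_nonneg_bounded)
    fix n
    have "(\<Sum>j<n. c' j j) = (\<Sum>j<n. fps_nth (\<Prod>\<phi>\<in>irr_upto n. fps_abs (?H \<phi>)) j * 1 ^ j)"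
      by (intro sum.cong refl) (use cstab(2)[symmetric] in \<open>auto simp: c'_def\<close>)
    also have "\<dots> \<le> fps_value 1 (\<Prod>\<phi>\<in>irr_upto n. fps_abs (?H \<phi>))"
      unfolding fps_value_def
    proof (rule sum_le_suminf)
      show "summable (\<lambda>j. fps_nth (\<Prod>\<phi>\<in>irr_upto n. fps_abs (?H \<phi>)) j * 1 ^ j)"
        using conjunct1[OF A[of n]] unfolding fps_abs_summable_def by (rule summable_rabs_cancel)
    qed (auto simp: fps_nth_prod_abs_nonneg)
    also have "\<dots> \<le> 2 ^ 8" using A[of n] prod_local_norm_le[of n, where 'a='a] by simp
    finally show "(\<Sum>j<n. c' j j) \<le> 2 ^ 8" .
  qed (rule c'0)
  have t: "eventually (\<lambda>D. summable (\<lambda>j. norm (c j D))) sequentially \<and> summable (\<lambda>j. norm (c j j)) \<and>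
    (\<lambda>D. \<Sum>j. c j D) \<longlonglongrightarrow> (\<Sum>j. c j j)"
  proof (rule tannerys_theorem[OF _ _ M])
    show "(\<lambda>D. c j D) \<longlonglongrightarrow> c j j" for j
      by (rule tendsto_eventually, unfold eventually_sequentially) (use cstab(1) in blast)
    show "eventually (\<lambda>(j, D). norm (c j D) \<le> c' j j) (at_top \<times>\<^sub>F sequentially)"
      using bound by (intro always_eventually) auto
  qed simp
  have lim: "summable (\<lambda>j. c j j)" "(\<lambda>D. \<Sum>j. c j D) \<longlonglongrightarrow> (\<Sum>j. c j j)"
    by (rule summable_norm_cancel[OF conjunct1[OF conjunct2[OF t]]], rule conjunct2[OF conjunct2[OF t]])
  have "(\<Sum>j. c j D) = (\<Prod>\<phi>\<in>irr_upto D. fps_value 1 (?H \<phi>))" for D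
    using fps_value_prod[of "irr_upto D" 1 ?H] H by (simp add: fps_value_def c_def)
  moreover have "(\<lambda>j. c j j) = limit_coeff TYPE('a)" by (simp add: c_def limit_coeff_def fun_eq_iff)
  ultimately show ?thesis using lim by simp
qed

section \<open>The Rogers-Ramanujan product and the product over all irreducibles\<close>

definition rr_index :: "nat \<Rightarrow> bool" where
  "rr_index r \<longleftrightarrow> r \<ge> 2 \<and> r mod 5 \<in> {1, 4}"

text \<open>Partial sums of nonnegative terms are monotone, so convergence along multiples of 5 is
  enough; the product in \<open>rogers_ramanujan\<close> advances by whole blocks of residues modulo
  5.\<close>

lemma sums_of_blocks:
  fixes f :: "nat \<Rightarrow> real"
  assumes f: "\<And>n. 0 \<le> f n" and lim: "(\<lambda>N. \<Sum>r<5 * N. f r) \<longlonglongrightarrow> S"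
  shows "f sums S"
proof -
  have mono: "(\<Sum>r<m. f r) \<le> (\<Sum>r<n. f r)" if "m \<le> n" for m n
    using that f by (intro sum_mono2) auto
  have "incseq (\<lambda>N. \<Sum>r<5 * N. f r)" by (intro incseq_SucI mono) simp
  then have le: "(\<Sum>r<5 * n. f r) \<le> S" for n using lim by (rule incseq_le)
  have "(\<Sum>r<n. f r) \<le> S" for n by (rule order_trans[OF mono le[of n]]) simp
  then have "summable f" using f by (intro summableI_nonneg_bounded)
  then have "(\<lambda>n. \<Sum>r<n. f r) \<longlonglongrightarrow> suminf f" by (rule summable_LIMSEQ)
  then have "(\<lambda>N. \<Sum>r<5 * N. f r) \<longlonglongrightarrow> suminf f"
    by (rule filterlim_compose) (auto intro!: filterlim_subseq simp: strict_mono_def)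
  then have "suminf f = S" using lim by (rule LIMSEQ_unique)
  with \<open>summable f\<close> show ?thesis by (simp add: sums_iff)
qed

text \<open>Logarithms turn the product over r into a series that can be exchanged with the product
  over irreducibles. The factor 1 - x removes the index r = 1, whence the bound r >= 2 in
  \<open>rr_index\<close>.\<close>

lemma ln_rogers_ramanujan:
  fixes x :: real
  assumes x: "0 < x" "x < 1"
  shows "(\<Sum>s. x ^ (s * s) / qpoch x s) \<ge> 1"
    and "(\<lambda>r. if rr_index r then - ln (1 - x ^ r) else 0) sums ln ((1 - x) * (\<Sum>s. x ^ (s * s) / qpoch x s))"
proof -
  let ?S = "\<Sum>s. x ^ (s * s) / qpoch x s"
  define f where "f i = 1 / ((1 - x ^ (5 * i + 1)) * (1 - x ^ (5 * i + 4)))" for i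
  note pos = one_minus_power_pos[OF x]
  have lim: "(\<lambda>N. \<Prod>i<N. f i) \<longlonglongrightarrow> ?S" unfolding f_def by (rule rogers_ramanujan(2)[OF x])
  have f1: "f i \<ge> 1" for i
  proof -
    have "(1 - x ^ (5 * i + 1)) * (1 - x ^ (5 * i + 4)) \<le> 1 * 1"
      using pos[of "5 * i + 1"] pos[of "5 * i + 4"] x by (intro mult_mono) auto
    moreover have "(1 - x ^ (5 * i + 1)) * (1 - x ^ (5 * i + 4)) > 0" by (intro mult_pos_pos pos) auto
    ultimately show ?thesis by (simp add: f_def)
  qed
  have P1: "(\<Prod>i<N. f i) \<ge> 1" for N using f1 by (intro prod_ge_1) auto
  show S1: "?S \<ge> 1" by (rule LIMSEQ_le_const[OF lim]) (use P1 in auto)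
  define l where "l r = (if rr_index r then - ln (1 - x ^ r) else 0)" for r
  have l0: "l r \<ge> 0" for r
    using pos[of r] x by (auto simp: l_def rr_index_def)
  have lnf: "ln (f i) = - ln (1 - x ^ (5 * i + 1)) - ln (1 - x ^ (5 * i + 4))" for i
    using pos[of "5 * i + 1"] pos[of "5 * i + 4"] by (simp add: f_def ln_div ln_mult)
  \<comment> \<open>The identity starts with one full block: r = 1, absent from \<open>l\<close>,
    lies in it, and ln (1 - x) compensates for it.\<close>
  have block: "(\<Sum>r<5 * Suc N. l r) = ln (1 - x) + ln (\<Prod>i<Suc N. f i)" for N
  proof (induct N)
    case 0
    have "{..<5::nat} = {0, 1, 2, 3, 4}" by auto
    then show ?case using lnf[of 0] by (simp add: l_def rr_index_def)
  next
    case (Suc N)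
    define m where "m = Suc N"
    have "5 * Suc m = Suc (Suc (Suc (Suc (Suc (5 * m)))))" by simp
    then have "(\<Sum>r<5 * Suc m. l r) = (\<Sum>r<5 * m. l r) + (l (5 * m) + l (5 * m + 1) + l (5 * m + 2) + l (5 * m + 3) + l (5 * m + 4))"
      by (simp only: sum.lessThan_Suc) (simp add: eval_nat_numeral)
    also have "l (5 * m) + l (5 * m + 1) + l (5 * m + 2) + l (5 * m + 3) + l (5 * m + 4) = ln (f m)"
    proof -
      have "(5 * m) mod 5 = 0" "(5 * m + 1) mod 5 = 1" "(5 * m + 2) mod 5 = 2" "(5 * m + 3) mod 5 = 3" "(5 * m + 4) mod 5 = 4"
        by presburger+
      moreover have "5 * m + 1 \<ge> 2" "5 * m + 4 \<ge> 2" by (auto simp: m_def)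
      ultimately show ?thesis unfolding lnf l_def rr_index_def by simp
    qed
    also have "(\<Sum>r<5 * m. l r) = ln (1 - x) + ln (\<Prod>i<m. f i)" unfolding m_def by (rule Suc)
    also have "ln (1 - x) + ln (\<Prod>i<m. f i) + ln (f m) = ln (1 - x) + ln (\<Prod>i<Suc m. f i)"
      using P1[of m] f1[of m] ln_mult_pos[of "\<Prod>i<m. f i" "f m"] by simp
    finally show ?case by (simp only: m_def)
  qed
  have "(\<lambda>N. ln (1 - x) + ln (\<Prod>i<Suc N. f i)) \<longlonglongrightarrow> ln (1 - x) + ln ?S"
    using S1 by (intro tendsto_intros LIMSEQ_Suc[OF lim]) auto
  then have "(\<lambda>N. \<Sum>r<5 * Suc N. l r) \<longlonglongrightarrow> ln (1 - x) + ln ?S" by (simp only: block)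
  then have "(\<lambda>N. \<Sum>r<5 * N. l r) \<longlonglongrightarrow> ln (1 - x) + ln ?S" by (rule LIMSEQ_imp_Suc)
  then have "l sums (ln (1 - x) + ln ?S)" by (rule sums_of_blocks[OF l0])
  also have "ln (1 - x) + ln ?S = ln ((1 - x) * ?S)" using x S1 by (simp add: ln_mult)
  finally show "(\<lambda>r. if rr_index r then - ln (1 - x ^ r) else 0) sums ln ((1 - x) * ?S)"
    by (simp add: l_def[abs_def])
qed

text \<open>For an admissible index, the logarithm of 1 / (1 - q^(1 - r)), the zeta value to which
  the r-th factors of all irreducibles multiply.\<close>

definition rr_log :: "nat \<Rightarrow> nat \<Rightarrow> real" where
  "rr_log q r = (if rr_index r then - ln (1 - (1 / real q) ^ (r - 1)) else 0)"

text \<open>The product over all irreducibles of \<open>(1 - q\<^bsup>-d r\<^esup>)\<^bsup>-1\<^esup>\<close> is the zeta function of the affine line,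
  \<open>1 / (1 - q\<^bsup>1 - r\<^esup>)\<close>; Tannery's theorem exchanges it with the product over \<open>r\<close>.\<close>

lemma prod_local_value_tendsto:
  "(\<lambda>D. \<Prod>\<phi>\<in>(irr_upto D :: 'a::{field,finite} poly set). fps_value 1 (local_fps CARD('a) (degree \<phi>)))
    \<longlonglongrightarrow> exp (suminf (rr_log CARD('a)))" (is ?lim)
  and summable_rr_log: "summable (rr_log CARD('a))"
proof -
  define q where "q = real CARD('a)"
  have q: "q \<ge> 2" using card_ge_2[where 'a='a] by (simp add: q_def)
  have u: "0 \<le> (1 / q) ^ (r - 1)" "(1 / q) ^ (r - 1) < 1" "(1 / q) ^ (r - 1) \<le> 1 / 2" if "rr_index r" for r
  proof -
    have "r \<ge> 2" using that by (simp add: rr_index_def)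
    then have "r - 1 = Suc (r - 2)" by simp
    then have "(1 / q) ^ (r - 1) = 1 / q * (1 / q) ^ (r - 2)" by simp
    also have "\<dots> \<le> 1 / q * 1" using q by (intro mult_left_mono power_le_one) auto
    also have "\<dots> \<le> 1 / 2" using q by (simp add: field_simps)
    finally show "(1 / q) ^ (r - 1) \<le> 1 / 2" .
    then show "(1 / q) ^ (r - 1) < 1" by linarith
    show "0 \<le> (1 / q) ^ (r - 1)" using q by simp
  qed
  define Z where "Z D r = fps_value ((1 / q) ^ (r - 1)) (monics_fps (irr_upto D :: 'a poly set))" for D r
  define x where "x \<phi> = 1 / real (CARD('a) ^ degree \<phi>)" for \<phi> :: "'a poly"
  have x: "0 < x \<phi>" "x \<phi> < 1" if "\<phi> \<in> irr_upto D" for \<phi> D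
  proof -
    have "degree \<phi> > 0" using that by (auto simp: irr_upto_def intro: monic_irreducible_degree_pos)
    then have "(1 / q) ^ degree \<phi> < 1" using q by (intro power_less_one_iff[THEN iffD2]) auto
    then show "x \<phi> < 1" by (simp add: x_def q_def power_one_over)
    show "0 < x \<phi>" using q by (simp add: x_def q_def)
  qed
  define v where "v \<phi> = fps_value 1 (local_fps CARD('a) (degree \<phi>))" for \<phi> :: "'a poly"
  have v: "v \<phi> = (1 - x \<phi>) * (\<Sum>m. x \<phi> ^ (m * m) / qpoch (x \<phi>) m)" if "\<phi> \<in> irr_upto D" for \<phi> D
    unfolding v_def x_def using that
    by (intro fps_value_local card_ge_2) (auto simp: irr_upto_def intro: monic_irreducible_degree_pos)
  have vpos: "v \<phi> > 0" if "\<phi> \<in> irr_upto D" for \<phi> D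
    unfolding v[OF that] using x[OF that] ln_rogers_ramanujan(1)[OF x[OF that]] by (intro mult_pos_pos) auto
  define l where "l r \<phi> = (if rr_index r then - ln (1 - x \<phi> ^ r) else 0)" for r and \<phi> :: "'a poly"
  have lsums: "(\<lambda>r. l r \<phi>) sums ln (v \<phi>)" if "\<phi> \<in> irr_upto D" for \<phi> D
    unfolding l_def v[OF that] by (rule ln_rogers_ramanujan(2)[OF x[OF that]])
  define f where "f r D = (\<Sum>\<phi>\<in>irr_upto D. l r \<phi>)" for r D
  have f: "f r D = (if rr_index r then ln (Z D r) else 0)" for r D
  proof (cases "rr_index r")
    case True
    \<comment> \<open>This fixes the argument of the zeta function: at u = q^(1 - r), (u / q)^d is
      q^(-d r).\<close>
    have xr: "((1 / q) ^ (r - 1) / real CARD('a)) ^ degree \<phi> = x \<phi> ^ r" for \<phi> :: "'a poly"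
    proof -
      have "r = Suc (r - 1)" using True by (simp add: rr_index_def)
      then have "x \<phi> ^ r = ((1 / q) ^ Suc (r - 1)) ^ degree \<phi>"
        by (simp add: x_def q_def power_one_over mult.commute flip: power_mult)
      then show ?thesis by (simp add: q_def)
    qed
    have pos: "1 - x \<phi> ^ r > 0" if "\<phi> \<in> irr_upto D" for \<phi>
      using one_minus_power_pos[OF x[OF that], of r] True by (simp add: rr_index_def)
    then have pos': "x \<phi> ^ r \<noteq> 1" if "\<phi> \<in> irr_upto D" for \<phi> using that by force
    have Z: "(\<Prod>\<phi>\<in>irr_upto D. 1 - x \<phi> ^ r) * Z D r = 1"
      using monics_value(2)[OF u(1,2)[OF True], of D, where 'a='a] unfolding xr Z_def .
    moreover have "(\<Prod>\<phi>\<in>irr_upto D. 1 - x \<phi> ^ r) > 0" using pos by (intro prod_pos) auto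
    moreover have "Z D r = 1 / (\<Prod>\<phi>\<in>irr_upto D. 1 - x \<phi> ^ r)"
      using inverse_unique[OF Z] by (simp only: inverse_eq_divide)
    ultimately have "ln (Z D r) = - ln (\<Prod>\<phi>\<in>irr_upto D. 1 - x \<phi> ^ r)"
      using \<open>(\<Prod>\<phi>\<in>irr_upto D. 1 - x \<phi> ^ r) > 0\<close> by (simp add: ln_div)
    also have "\<dots> = - (\<Sum>\<phi>\<in>irr_upto D. ln (1 - x \<phi> ^ r))"
      using pos pos' by (subst ln_prod) (auto simp: finite_irr_upto)
    finally show ?thesis using True by (simp add: f_def l_def sum_negf)
  qed (simp add: f_def l_def)
  \<comment> \<open>The partial zeta values lie between 1 and 1 / (1 - u) for every
    \<open>D\<close>, so the limit itself serves as the dominating sequence.\<close>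
  have bound: "\<bar>f r D\<bar> \<le> rr_log CARD('a) r" for r D
  proof (cases "rr_index r")
    case True
    note m = monics_value(3,4)[OF u(1,2)[OF True], of D, where 'a='a, folded Z_def]
    then have "ln (Z D r) \<le> ln (1 / (1 - (1 / q) ^ (r - 1)))" "0 \<le> ln (Z D r)"
      using u(2)[OF True] by auto
    then show ?thesis using True u(2)[OF True] by (simp add: f rr_log_def q_def ln_div)
  qed (simp add: f rr_log_def)
  \<comment> \<open>From -ln (1 - u) <= u + 2 u^2 and u <= 1/2.\<close>
  have rlog_le: "rr_log CARD('a) r \<le> 2 * (1 / q) ^ (r - 1)" for r
  proof (cases "rr_index r")
    case True
    let ?u = "(1 / q) ^ (r - 1)"
    have "- ?u - 2 * ?u\<^sup>2 \<le> ln (1 - ?u)" using u[OF True] by (intro ln_one_minus_pos_lower_bound) auto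
    moreover have "2 * ?u\<^sup>2 \<le> ?u" using u[OF True] mult_left_mono[of ?u "1/2" ?u] by (simp add: power2_eq_square)
    ultimately show ?thesis using True by (simp add: rr_log_def q_def)
  qed (use q in \<open>simp add: rr_log_def\<close>)
  have rlog0: "0 \<le> rr_log CARD('a) r" for r using bound[of r 0] by simp
  have sg: "summable (\<lambda>r. 2 * (1 / q) ^ (r - 1))"
  proof -
    have "summable (\<lambda>r. 2 * (1 / q) ^ r)" using q by (intro summable_mult summable_geometric) auto
    then have "summable (\<lambda>r. 2 * (1 / q) ^ (Suc r - 1))" by simp
    then show ?thesis by (subst summable_Suc_iff[symmetric])
  qed
  show sr: "summable (rr_log CARD('a))"
    by (rule summable_comparison_test'[OF sg]) (use rlog_le rlog0 in auto)
  have lim: "(\<lambda>D. \<Sum>r. f r D) \<longlonglongrightarrow> suminf (rr_log CARD('a))"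
  proof (rule conjunct2[OF conjunct2[OF tannerys_theorem[OF _ _ sr]]])
    show "(\<lambda>D. f r D) \<longlonglongrightarrow> rr_log CARD('a) r" for r
    proof (cases "rr_index r")
      case True
      have "(\<lambda>D. ln (Z D r)) \<longlonglongrightarrow> ln (1 / (1 - (1 / q) ^ (r - 1)))"
        unfolding Z_def using u[OF True] by (intro tendsto_ln monics_value_tendsto) auto
      then show ?thesis using True u(2)[OF True] by (simp add: f rr_log_def q_def ln_div)
    qed (simp add: f rr_log_def)
    show "eventually (\<lambda>(r, D). norm (f r D) \<le> rr_log CARD('a) r) (at_top \<times>\<^sub>F sequentially)"
      using bound by (intro always_eventually) auto
  qed simp
  have "(\<Sum>r. f r D) = (\<Sum>\<phi>\<in>irr_upto D. ln (v \<phi>))" for D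
  proof -
    have "(\<lambda>r. f r D) sums (\<Sum>\<phi>\<in>irr_upto D. ln (v \<phi>))"
      unfolding f_def by (rule sums_sum) (rule lsums)
    then show ?thesis by (rule sums_unique[symmetric])
  qed
  then have "exp (\<Sum>r. f r D) = (\<Prod>\<phi>\<in>irr_upto D. v \<phi>)" for D
    using vpos by (simp add: exp_sum finite_irr_upto)
  with tendsto_exp[OF lim] show ?lim by (simp add: v_def)
qed

text \<open>Here the limit of \<open>card (GL n)\<close> / q^(n^2) meets the product over
  irreducibles: the factor 1 - q^(1 - r) is cancelled for the residues 1 and 4 and survives for 0, 2
  and 3.\<close>

lemma semisimple_factor_eq:
  assumes "q \<ge> 2"
  shows "semisimple_factor q (Suc (Suc r)) = (1 - (1 / real q) ^ Suc r) * exp (rr_log q (Suc (Suc r)))"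
proof -
  let ?s = "Suc (Suc r)"
  have x: "0 < 1 / real q" "1 / real q < 1" using assms by auto
  have pos: "1 - (1 / real q) ^ Suc r > 0" by (rule one_minus_power_pos[OF x]) simp
  have "?s mod 5 < 5" by simp
  then have s: "?s mod 5 \<in> {0, 1, 2, 3, 4}" by auto
  show ?thesis
  proof (cases "rr_index ?s")
    case True
    then have "exp (rr_log q ?s) = inverse (1 - (1 / real q) ^ Suc r)"
      using pos by (simp add: rr_log_def exp_minus del: power_Suc)
    moreover have "semisimple_factor q ?s = 1" using True by (auto simp: semisimple_factor_def rr_index_def)
    ultimately show ?thesis using pos by (simp del: power_Suc)
  next
    case False
    then have "?s mod 5 \<in> {0, 2, 3}" using s by (auto simp: rr_index_def)
    then show ?thesis using False by (simp add: semisimple_factor_def rr_log_def power_one_over del: power_Suc)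
  qed
qed

text \<open>The indices 0 and 1 contribute 1, so the product up to \<open>Suc n\<close> consists of
  the \<open>n\<close> factors with r from 2 to n + 1, matching \<open>qpoch\<close> of length
  \<open>n\<close>.\<close>

lemma prod_semisimple_factor:
  assumes "q \<ge> 2"
  shows "(\<Prod>r\<le>Suc n. semisimple_factor q r) = qpoch (1 / real q) n * exp (\<Sum>r<n. rr_log q (Suc (Suc r)))"
proof (induct n)
  case 0
  show ?case by (simp add: semisimple_factor_def)
next
  case (Suc n)
  have "(\<Prod>r\<le>Suc (Suc n). semisimple_factor q r) = (\<Prod>r\<le>Suc n. semisimple_factor q r) * semisimple_factor q (Suc (Suc n))"
    by (rule prod.atMost_Suc)
  then show ?case unfolding Suc semisimple_factor_eq[OF assms]
    by (simp add: qpoch_Suc exp_add mult_ac)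
qed

section \<open>The exact probability and its limit\<close>

lemma card_carrier_mat: "card (carrier_mat n m :: 'a::finite mat set) = CARD('a) ^ (n * m)"
proof -
  let ?I = "{..<n} \<times> {..<m}"
  have "bij_betw (\<lambda>f. mat n m f) (PiE ?I (\<lambda>_. UNIV :: 'a set)) (carrier_mat n m)"
  proof (rule bij_betwI[of _ _ _ "\<lambda>A. restrict (\<lambda>ij. A $$ ij) ?I"])
    show "restrict (\<lambda>ij. mat n m f $$ ij) ?I = f" if "f \<in> PiE ?I (\<lambda>_. UNIV :: 'a set)" for f
    proof
      fix ij show "restrict (\<lambda>ij. mat n m f $$ ij) ?I ij = f ij"
        using PiE_arb[OF that, of ij] by (cases ij; cases "ij \<in> ?I") simp_all
    qed
    show "mat n m (restrict (\<lambda>ij. A $$ ij) ?I) = A" if "A \<in> carrier_mat n m" for A :: "'a mat"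
      using that by (intro eq_matI) auto
    show "(\<lambda>A. restrict (\<lambda>ij. A $$ ij) ?I) \<in> carrier_mat n m \<rightarrow> PiE ?I (\<lambda>_. UNIV :: 'a set)"
      by (simp only: Pi_iff restrict_PiE_iff) simp
    show "(\<lambda>f. mat n m f) \<in> PiE ?I (\<lambda>_. UNIV :: 'a set) \<rightarrow> carrier_mat n m"
      by (intro Pi_I) simp
  qed
  from bij_betw_same_card[OF this] show ?thesis by (simp add: card_PiE card_cartesian_product)
qed

text \<open>Exact for every \<open>n\<close>, with summands independent of \<open>n\<close>, so the
  limit splits into that of a q-Pochhammer symbol and the sum of a convergent series.\<close>

lemma prob_semisimple:
  "measure_pmf.prob (pmf_of_set (carrier_mat n n :: 'a::{field,finite} mat set)) {A. semisimple_mat A}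
    = qpoch (1 / real CARD('a)) n * (\<Sum>j\<le>n. limit_coeff TYPE('a) j)"
proof -
  let ?I = "irr_upto n :: 'a poly set"
  have q: "CARD('a) > 0" by simp
  have "measure_pmf.prob (pmf_of_set (carrier_mat n n :: 'a mat set)) {A. semisimple_mat A}
    = card {A \<in> carrier_mat n n. semisimple_mat (A :: 'a mat)} / card (carrier_mat n n :: 'a mat set)"
    using measure_pmf_of_set[OF carrier_mat_nonempty finite_carrier_mat, of n n "{A. semisimple_mat (A :: 'a mat)}"]
    by (simp add: Int_def)
  also have "\<dots> = card (ann n (\<Prod>?I)) / real CARD('a) ^ (n * n)"
    by (simp add: card_semisimple card_carrier_mat)
  also have "\<dots> = (real (card (GL n :: 'a mat set)) / real CARD('a) ^ (n * n)) *
      (card (ann n (\<Prod>?I)) / real (card (GL n :: 'a mat set)))"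
    using card_GL_pos[where 'a='a and n=n] by simp
  also have "real (card (GL n :: 'a mat set)) / real CARD('a) ^ (n * n) = qpoch (1 / real CARD('a)) n"
    by (simp add: card_GL gl_order_eq_qpoch[OF q])
  also have "card (ann n (\<Prod>?I)) / real (card (GL n :: 'a mat set)) = (\<Sum>j\<le>n. limit_coeff TYPE('a) j)"
  proof -
    have "card (ann n (\<Prod>?I)) / real (card (GL n :: 'a mat set)) = fps_nth (\<Prod>\<phi>\<in>?I. gl_fps CARD('a) (degree \<phi>)) n"
      by (rule fps_nth_prod_gl_fps[symmetric]) (auto simp: finite_irr_upto, simp add: irr_upto_def)
    also have "\<dots> = (\<Sum>j\<le>n. fps_nth (\<Prod>\<phi>\<in>?I. local_fps CARD('a) (degree \<phi>)) j)"
      by (rule fps_nth_prod_gl_irr_upto)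
    also have "\<dots> = (\<Sum>j\<le>n. limit_coeff TYPE('a) j)"
      unfolding limit_coeff_def
      by (intro sum.cong refl fps_nth_prod_irr_upto_stable fps_one_upto_local_fps) auto
    finally show ?thesis .
  qed
  finally show ?thesis .
qed

theorem theorem3:
  fixes q :: nat
  assumes "primepow q"
    and "CARD('a :: {field, finite}) = q"
  shows "(\<lambda>n. measure_pmf.prob (pmf_of_set (carrier_mat n n :: 'a mat set))
                {A. semisimple_mat A})
           \<longlonglongrightarrow> prodinf (semisimple_factor q)"
proof -
  have q: "q \<ge> 2" using card_ge_2[where 'a='a] assms(2) by simp
  have x: "0 < 1 / real q" "1 / real q < 1" using q by auto
  obtain L where L: "qpoch (1 / real q) \<longlonglongrightarrow> L" by (rule qpoch_limit[OF x]) blast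
  let ?E = "suminf (rr_log q)"
  have sr: "summable (rr_log q)" using summable_rr_log[where 'a='a] assms(2) by simp
  \<comment> \<open>Both sides are limits of the same finite products over
    \<open>irr_upto D\<close>, one obtained by summing coefficients and the other through
    logarithms.\<close>
  have "suminf (limit_coeff TYPE('a)) = exp ?E"
    using LIMSEQ_unique[OF conjunct1[OF limit_coeff_sums] prod_local_value_tendsto[where 'a='a]] assms(2) by simp
  then have "(\<lambda>n. \<Sum>j\<le>n. limit_coeff TYPE('a) j) \<longlonglongrightarrow> exp ?E"
    using summable_LIMSEQ'[OF conjunct2[OF limit_coeff_sums[where 'a='a]]] by simp
  then have "(\<lambda>n. measure_pmf.prob (pmf_of_set (carrier_mat n n :: 'a mat set)) {A. semisimple_mat A}) \<longlonglongrightarrow> L * exp ?E"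
    unfolding prob_semisimple assms(2) by (intro tendsto_mult L)
  moreover have "prodinf (semisimple_factor q) = L * exp ?E"
  proof (rule LIMSEQ_unique)
    show "(\<lambda>n. \<Prod>r\<le>Suc n. semisimple_factor q r) \<longlonglongrightarrow> prodinf (semisimple_factor q)"
      by (rule LIMSEQ_Suc[OF convergent_prod_LIMSEQ[OF convergent_prod_semisimple_factor[OF q]]])
    have "(\<lambda>r. rr_log q (Suc (Suc r))) sums ?E"
    proof -
      have "rr_log q 0 = 0" "rr_log q (Suc 0) = 0" by (simp_all add: rr_log_def rr_index_def)
      then show ?thesis
        using summable_sums[OF sr]
        by (subst sums_Suc_iff[of "\<lambda>r. rr_log q (Suc r)"], subst sums_Suc_iff[of "rr_log q"]) simp
    qed
    then have "(\<lambda>n. \<Sum>r<n. rr_log q (Suc (Suc r))) \<longlonglongrightarrow> ?E" by (simp add: sums_def)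
    then show "(\<lambda>n. \<Prod>r\<le>Suc n. semisimple_factor q r) \<longlonglongrightarrow> L * exp ?E"
      unfolding prod_semisimple_factor[OF q] by (intro tendsto_mult L tendsto_exp)
  qed
  ultimately show ?thesis by simp
qed

end
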